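(* Let $\Omega$ be a bounded pseudoconvex domain in $\mathbb{C}^n$ with boundary of class $\mathcal{C}^\infty$, and let $1\le q\le n$. Suppose that $0<\epsilon\le 1/2$, that $$\mathrm{dom}(\overline{\partial})\cap\mathrm{dom}(\overline{\partial}^* )\subseteq W^{\epsilon}_{(0,q)}(\Omega),$$ and that there exists a constant $C>0$ such that $$\|u\|_{\epsilon,\Omega}\le C\left(\|\overline{\partial}u\|^2+\|\overline{\partial}^*u\|^2\right)^{1/2}$$ for all $u\in\mathrm{dom}(\overline{\partial})\cap\mathrm{dom}(\overline{\partial}^* )\subset L^2_{(0,q)}(\Omega)$. Then the $\overline{\partial}$-Neumann operator $$N:L^2_{(0,q)}(\Omega)\longrightarrow L^2_{(0,q)}(\Omega)$$ is compact, and $N$ can be continuously extended as an operator $$\tilde N: L^{\frac{2n}{n+\epsilon}}_{(0,q)}(\Omega)\longrightarrow L^{\frac{2n}{n-\epsilon}}_{(0,q)}(\Omega),$$ which means that there is a constant $C'>0$ such that $$\|\tilde N u\|_{\frac{2n}{n-\epsilon}}\le C'\,\|u\|_{\frac{2n}{n+\epsilon}}$$ for each $u\in L^{\frac{2n}{n+\epsilon}}_{(0,q)}(\Omega)$.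
   Context: $L^2_{(0,q)}(\Omega)$ is the Hilbert space of $(0,q)$-forms $u=\sum_J' u_J\,d\overline{z}_J$ on $\Omega$ with coefficients in $L^2(\Omega)$ (with respect to Lebesgue measure $\lambda$), where $\sum'$ means summation over strictly increasing multi-indices $J$ with $|J|=q$; $|u|^2=\sum_J'|u_J|^2$, and $\|\cdot\|$ denotes the $L^2$-norm on forms. For $p\ge1$, $L^p_{(0,q)}(\Omega)$ is the space of $(0,q)$-forms with coefficients in $L^p(\Omega)$, with norm $\|u\|_p=\left(\int_\Omega|u|^p\,d\lambda\right)^{1/p}$. $W^\epsilon_{(0,q)}(\Omega)$ is the space of $(0,q)$-forms whose coefficients lie in the standard $L^2$-based Sobolev space $W^\epsilon(\Omega)$ of fractional order $\epsilon$ on $\Omega\subset\mathbb{C}^n\cong\mathbb{R}^{2n}$, and $\|\cdot\|_{\epsilon,\Omega}$ is its norm. The operator $\overline{\partial}:L^2_{(0,q)}(\Omega)\to L^2_{(0,q+1)}(\Omega)$ is given by $\overline{\partial}\left(\sum_J' a_J\,d\overline{z}_J\right)=\sum_{j=1}^n\sum_J' \frac{\partial a_J}{\partial \overline{z}_j}\,d\overline{z}_j\wedge d\overline{z}_J$, with derivatives in the sense of distributions; its domain consists of those forms for which the right-hand side lies in $L^2_{(0,q+1)}(\Omega)$ (for $q=n$, $\overline{\partial}=0$). It is a densely defined closed operator, and $\overline{\partial}^*:L^2_{(0,q+1)}(\Omega)\to L^2_{(0,q)}(\Omega)$ denotes its Hilbert space adjoint. In $\mathrm{dom}(\overline{\partial})\cap\mathrm{dom}(\overline{\partial}^*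 )$ on $(0,q)$-forms, $\overline{\partial}$ maps to $(0,q+1)$-forms and $\overline{\partial}^*$ maps to $(0,q-1)$-forms. The complex Laplacian is $\Box=\overline{\partial}\,\overline{\partial}^*+\overline{\partial}^*\overline{\partial}$ on $\mathrm{dom}(\Box)=\{u\in L^2_{(0,q)}(\Omega): u\in\mathrm{dom}(\overline{\partial})\cap\mathrm{dom}(\overline{\partial}^* ),\ \overline{\partial}u\in\mathrm{dom}(\overline{\partial}^* ),\ \overline{\partial}^*u\in\mathrm{dom}(\overline{\partial})\}$. For a smoothly bounded pseudoconvex domain there is $c>0$ with $\|\overline{\partial}u\|^2+\|\overline{\partial}^*u\|^2\ge c\|u\|^2$ for all $u\in\mathrm{dom}(\overline{\partial})\cap\mathrm{dom}(\overline{\partial}^* )$, and consequently $\Box:\mathrm{dom}(\Box)\to L^2_{(0,q)}(\Omega)$ is bijective with bounded inverse; this inverse $N$ is the $\overline{\partial}$-Neumann operator on $(0,q)$-forms. Since $\Omega$ is bounded and $\frac{2n}{n+\epsilon}<2$, one has $L^2_{(0,q)}(\Omega)\subset L^{2n/(n+\epsilon)}_{(0,q)}(\Omega)$; that $\tilde N$ extends $N$ means $\tilde N u=Nu$ for $u\in L^2_{(0,q)}(\Omega)$. *)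

theory Defs
  imports "HOL-Analysis.Analysis"
begin

text \<open>
  The index type \<open>'n\<close> plays the role of \<open>{1, \<dots>, n}\<close>; its linear order is what
  makes strictly increasing multi-indices (here: subsets \<open>J\<close> with \<open>card J = q\<close>) and the signs
  of the wedge product meaningful.  A \<open>(0,q)\<close>-form is a family of coefficient functions
  indexed by all sets \<open>J\<close>; only the coefficients with \<open>card J = q\<close> and their values
  on \<open>\<Omega>\<close> matter, and forms are identified when they agree almost everywhere
  (\<open>form_eq\<close>).
\<close>

type_synonym 'n form = "'n set \<Rightarrow> (complex, 'n) vec \<Rightarrow> complex"

subsection \<open>Smooth functions and Wirtinger derivatives\<close>

text \<open>The following two notions are meant for open sets \<open>S\<close> only.\<close>

primrec Ck_on :: "nat \<Rightarrow> 'a::euclidean_space set \<Rightarrow> ('a \<Rightarrow> 'b::real_normed_vector) \<Rightarrow> bool" where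
  "Ck_on 0 S f \<longleftrightarrow> continuous_on S f"
| "Ck_on (Suc k) S f \<longleftrightarrow>
     f differentiable_on S \<and> (\<forall>b\<in>Basis. Ck_on k S (\<lambda>x. frechet_derivative f (at x) b))"

definition smooth_on :: "'a::euclidean_space set \<Rightarrow> ('a \<Rightarrow> 'b::real_normed_vector) \<Rightarrow> bool" where
  "smooth_on S f \<longleftrightarrow> (\<forall>k. Ck_on k S f)"

definition d_dz :: "'n::finite \<Rightarrow> (complex^'n \<Rightarrow> complex) \<Rightarrow> complex^'n \<Rightarrow> complex" where
  "d_dz j f z = (frechet_derivative f (at z) (axis j 1)
                   - \<i> * frechet_derivative f (at z) (axis j \<i>)) / 2"

definition d_dzbar :: "'n::finite \<Rightarrow> (complex^'n \<Rightarrow> complex) \<Rightarrow> complex^'n \<Rightarrow> complex" where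
  "d_dzbar j f z = (frechet_derivative f (at z) (axis j 1)
                      + \<i> * frechet_derivative f (at z) (axis j \<i>)) / 2"

definition test_functions :: "(complex^'n::finite) set \<Rightarrow> (complex^'n \<Rightarrow> complex) set" where
  "test_functions \<Omega> = {\<phi>. smooth_on UNIV \<phi> \<and> compact (closure {z. \<phi> z \<noteq> 0})
                            \<and> closure {z. \<phi> z \<noteq> 0} \<subseteq> \<Omega>}"

subsection \<open>Smoothly bounded pseudoconvex domains\<close>

definition smooth_defining_function ::
    "(complex^'n::finite) set \<Rightarrow> (complex^'n) set \<Rightarrow> (complex^'n \<Rightarrow> real) \<Rightarrow> bool" where
  "smooth_defining_function \<Omega> U r \<longleftrightarrow>
     open U \<and> frontier \<Omega> \<subseteq> U \<and> smooth_on U r \<and> \<Omega> \<inter> U = {z\<in>U. r z < 0}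
     \<and> (\<forall>p\<in>frontier \<Omega>. frechet_derivative r (at p) \<noteq> (\<lambda>_. 0))"

definition smooth_boundary :: "(complex^'n::finite) set \<Rightarrow> bool" where
  "smooth_boundary \<Omega> \<longleftrightarrow> (\<exists>U r. smooth_defining_function \<Omega> U r)"

definition levi_form ::
    "(complex^'n::finite \<Rightarrow> real) \<Rightarrow> complex^'n \<Rightarrow> complex^'n \<Rightarrow> complex" where
  "levi_form r p t = (\<Sum>j\<in>UNIV. \<Sum>k\<in>UNIV.
      d_dz j (d_dzbar k (\<lambda>z. of_real (r z))) p * (t $ j) * cnj (t $ k))"

text \<open>
  Levi pseudoconvexity: the Levi form is positive semidefinite on the complex tangent
  space at each boundary point.  The condition does not depend on the choice of the defining
  function, and the Levi form is real-valued, so \<open>Re\<close> loses nothing.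
\<close>

definition pseudoconvex :: "(complex^'n::finite) set \<Rightarrow> bool" where
  "pseudoconvex \<Omega> \<longleftrightarrow> (\<exists>U r. smooth_defining_function \<Omega> U r \<and>
     (\<forall>p\<in>frontier \<Omega>. \<forall>t. (\<Sum>j\<in>UNIV. d_dz j (\<lambda>z. of_real (r z)) p * (t $ j)) = 0
                               \<longrightarrow> 0 \<le> Re (levi_form r p t)))"

subsection \<open>Spaces of forms\<close>

definition form_abs :: "nat \<Rightarrow> ('n::finite) form \<Rightarrow> complex^'n \<Rightarrow> real" where
  "form_abs q u z = sqrt (\<Sum>J | card J = q. (cmod (u J z))\<^sup>2)"

definition form_eq :: "(complex^'n::finite) set \<Rightarrow> nat \<Rightarrow> 'n form \<Rightarrow> 'n form \<Rightarrow> bool" where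
  "form_eq \<Omega> q u v \<longleftrightarrow> (\<forall>J. card J = q \<longrightarrow> (AE z in lebesgue_on \<Omega>. u J z = v J z))"

definition Lp_forms :: "(complex^'n::finite) set \<Rightarrow> real \<Rightarrow> nat \<Rightarrow> 'n form set" where
  "Lp_forms \<Omega> p q = {u. \<forall>J. card J = q \<longrightarrow>
      u J \<in> borel_measurable (lebesgue_on \<Omega>)
      \<and> integrable (lebesgue_on \<Omega>) (\<lambda>z. cmod (u J z) powr p)}"

definition Lp_norm :: "(complex^'n::finite) set \<Rightarrow> real \<Rightarrow> nat \<Rightarrow> 'n form \<Rightarrow> real" where
  "Lp_norm \<Omega> p q u = (LINT z|lebesgue_on \<Omega>. form_abs q u z powr p) powr (1 / p)"

definition L2_inner :: "(complex^'n::finite) set \<Rightarrow> nat \<Rightarrow> 'n form \<Rightarrow> 'n form \<Rightarrow> complex" where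
  "L2_inner \<Omega> q u v = (LINT z|lebesgue_on \<Omega>. (\<Sum>J | card J = q. u J z * cnj (v J z)))"

text \<open>
  The Sobolev space \<open>W\<^sup>\<epsilon>(\<Omega>)\<close> for \<open>0 < \<epsilon> < 1\<close>, with the intrinsic
  (Sobolev--Slobodeckij) norm; the exponent below is \<open>d + 2\<epsilon>\<close> with real dimension
  \<open>d = 2n\<close>.
\<close>

definition slobodeckij ::
    "(complex^'n::finite) set \<Rightarrow> real \<Rightarrow> (complex^'n \<Rightarrow> complex) \<Rightarrow> ennreal" where
  "slobodeckij \<Omega> \<epsilon> f = (\<integral>\<^sup>+x. (\<integral>\<^sup>+y.
      ennreal ((cmod (f x - f y))\<^sup>2 / norm (x - y) powr (2 * real CARD('n) + 2 * \<epsilon>))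
      \<partial>lebesgue_on \<Omega>) \<partial>lebesgue_on \<Omega>)"

definition sobolev_forms :: "(complex^'n::finite) set \<Rightarrow> real \<Rightarrow> nat \<Rightarrow> 'n form set" where
  "sobolev_forms \<Omega> \<epsilon> q =
     {u \<in> Lp_forms \<Omega> 2 q. \<forall>J. card J = q \<longrightarrow> slobodeckij \<Omega> \<epsilon> (u J) < \<infinity>}"

definition sobolev_norm :: "(complex^'n::finite) set \<Rightarrow> real \<Rightarrow> nat \<Rightarrow> 'n form \<Rightarrow> real" where
  "sobolev_norm \<Omega> \<epsilon> q u =
     sqrt ((Lp_norm \<Omega> 2 q u)\<^sup>2 + (\<Sum>J | card J = q. enn2real (slobodeckij \<Omega> \<epsilon> (u J))))"

subsection \<open>The Cauchy--Riemann operator, its adjoint and the complex Laplacian\<close>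

text \<open>The coefficient in front of the \<open>K\<close>-th basis form of the wedge product of the
  \<open>j\<close>-th conjugate differential with the \<open>J\<close>-th basis form.\<close>

definition wedge_coeff :: "'n::{finite,linorder} \<Rightarrow> 'n set \<Rightarrow> 'n set \<Rightarrow> complex" where
  "wedge_coeff j J K =
     (if j \<notin> J \<and> K = insert j J then (-1) ^ card {k\<in>J. k < j} else 0)"

text \<open>
  \<open>v\<close> is the distributional Cauchy--Riemann image of \<open>u\<close>.  The individual distributional
  derivatives need not be functions; only their signed sum for each \<open>K\<close> is.
\<close>

definition weak_dbar ::
    "(complex^'n::{finite,linorder}) set \<Rightarrow> nat \<Rightarrow> 'n form \<Rightarrow> 'n form \<Rightarrow> bool" where
  "weak_dbar \<Omega> q u v \<longleftrightarrow> (\<forall>K. card K = Suc q \<longrightarrow> (\<forall>\<phi>\<in>test_functions \<Omega>.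
     (LINT z|lebesgue_on \<Omega>. v K z * \<phi> z) =
     (\<Sum>j\<in>UNIV. \<Sum>J | card J = q.
        wedge_coeff j J K * - (LINT z|lebesgue_on \<Omega>. u J z * d_dzbar j \<phi> z))))"

definition dbar_dom :: "(complex^'n::{finite,linorder}) set \<Rightarrow> nat \<Rightarrow> 'n form set" where
  "dbar_dom \<Omega> q = {u \<in> Lp_forms \<Omega> 2 q. \<exists>v\<in>Lp_forms \<Omega> 2 (Suc q). weak_dbar \<Omega> q u v}"

text \<open>
  The operators below return some representative of a class that is unique up to
  \<open>form_eq\<close>.
\<close>

definition dbar :: "(complex^'n::{finite,linorder}) set \<Rightarrow> nat \<Rightarrow> 'n form \<Rightarrow> 'n form" where
  "dbar \<Omega> q u = (SOME v. v \<in> Lp_forms \<Omega> 2 (Suc q) \<and> weak_dbar \<Omega> q u v)"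

text \<open>\<open>dbar_star \<Omega> q\<close> maps \<open>(0,q+1)\<close>-forms to \<open>(0,q)\<close>-forms.\<close>

definition is_dbar_adjoint ::
    "(complex^'n::{finite,linorder}) set \<Rightarrow> nat \<Rightarrow> 'n form \<Rightarrow> 'n form \<Rightarrow> bool" where
  "is_dbar_adjoint \<Omega> q w u \<longleftrightarrow>
     (\<forall>f\<in>dbar_dom \<Omega> q. L2_inner \<Omega> (Suc q) (dbar \<Omega> q f) w = L2_inner \<Omega> q f u)"

definition dbar_star_dom :: "(complex^'n::{finite,linorder}) set \<Rightarrow> nat \<Rightarrow> 'n form set" where
  "dbar_star_dom \<Omega> q =
     {w \<in> Lp_forms \<Omega> 2 (Suc q). \<exists>u\<in>Lp_forms \<Omega> 2 q. is_dbar_adjoint \<Omega> q w u}"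

definition dbar_star :: "(complex^'n::{finite,linorder}) set \<Rightarrow> nat \<Rightarrow> 'n form \<Rightarrow> 'n form" where
  "dbar_star \<Omega> q w = (SOME u. u \<in> Lp_forms \<Omega> 2 q \<and> is_dbar_adjoint \<Omega> q w u)"

text \<open>From here on, \<open>(0,q)\<close>-forms with \<open>q \<ge> 1\<close>.\<close>

definition box_dom :: "(complex^'n::{finite,linorder}) set \<Rightarrow> nat \<Rightarrow> 'n form set" where
  "box_dom \<Omega> q = {u \<in> dbar_dom \<Omega> q \<inter> dbar_star_dom \<Omega> (q - 1).
     dbar \<Omega> q u \<in> dbar_star_dom \<Omega> q \<and> dbar_star \<Omega> (q - 1) u \<in> dbar_dom \<Omega> (q - 1)}"

definition box :: "(complex^'n::{finite,linorder}) set \<Rightarrow> nat \<Rightarrow> 'n form \<Rightarrow> 'n form" where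
  "box \<Omega> q u = (\<lambda>J z. dbar \<Omega> (q - 1) (dbar_star \<Omega> (q - 1) u) J z
                        + dbar_star \<Omega> q (dbar \<Omega> q u) J z)"

definition dbar_neumann ::
    "(complex^'n::{finite,linorder}) set \<Rightarrow> nat \<Rightarrow> 'n form \<Rightarrow> 'n form" where
  "dbar_neumann \<Omega> q f = (SOME u. u \<in> box_dom \<Omega> q \<and> form_eq \<Omega> q (box \<Omega> q u) f)"

subsection \<open>Operators between spaces of forms\<close>

text \<open>
  Linear maps \<open>L\<^sup>p \<rightarrow> L\<^sup>r\<close> on classes modulo \<open>form_eq\<close>.
\<close>

definition linear_form_operator ::
    "(complex^'n::finite) set \<Rightarrow> nat \<Rightarrow> real \<Rightarrow> real \<Rightarrow> ('n form \<Rightarrow> 'n form) \<Rightarrow> bool" where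
  "linear_form_operator \<Omega> q p r T \<longleftrightarrow>
     (\<forall>u\<in>Lp_forms \<Omega> p q. T u \<in> Lp_forms \<Omega> r q)
     \<and> (\<forall>u\<in>Lp_forms \<Omega> p q. \<forall>v\<in>Lp_forms \<Omega> p q. form_eq \<Omega> q u v \<longrightarrow> form_eq \<Omega> q (T u) (T v))
     \<and> (\<forall>u\<in>Lp_forms \<Omega> p q. \<forall>v\<in>Lp_forms \<Omega> p q. \<forall>a b.
          form_eq \<Omega> q (T (\<lambda>J z. a * u J z + b * v J z)) (\<lambda>J z. a * T u J z + b * T v J z))"

definition compact_L2_operator ::
    "(complex^'n::finite) set \<Rightarrow> nat \<Rightarrow> ('n form \<Rightarrow> 'n form) \<Rightarrow> bool" where
  "compact_L2_operator \<Omega> q T \<longleftrightarrow> linear_form_operator \<Omega> q 2 2 T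
     \<and> (\<forall>f :: nat \<Rightarrow> 'n form. \<forall>B.
          (\<forall>k. f k \<in> Lp_forms \<Omega> 2 q \<and> Lp_norm \<Omega> 2 q (f k) \<le> B) \<longrightarrow>
          (\<exists>s g. strict_mono (s :: nat \<Rightarrow> nat) \<and> g \<in> Lp_forms \<Omega> 2 q
             \<and> (\<lambda>k. Lp_norm \<Omega> 2 q (\<lambda>J z. T (f (s k)) J z - g J z)) \<longlonglongrightarrow> 0))"

end

theory Submission
  imports Defs "HOL-Library.Diagonal_Subsequence"
begin

text \<open>
  The estimate bounds the \<open>L\<^sup>2\<close> norm, so \<open>Q(u,v) = (\<partial>u, \<partial>v) + (\<partial>\<^sup>* u, \<partial>\<^sup>* v)\<close> (with the
  Cauchy--Riemann operator \<open>\<partial>\<close>) makes the form domain a Hilbert space, and the Riesz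
  representation theorem solves \<open>Q(v,u) = (v,f)\<close> for every \<open>f\<close> that defines a bounded functional.
  For \<open>f\<close> in \<open>L\<^sup>2\<close> the solution is \<open>Nf\<close>: testing with the components orthogonal to the kernels
  of \<open>\<partial>\<close> and \<open>\<partial>\<^sup>*\<close> shows that it lies in the domain of the complex Laplacian.

  By the estimate the form domain also embeds into \<open>W\<^sup>\<epsilon>\<close>, hence compactly into \<open>L\<^sup>2\<close> and
  continuously into \<open>L\<^sup>p\<close> with \<open>p = 2n/(n-\<epsilon>)\<close>.  The first embedding makes \<open>N\<close> compact.  By the
  second one every \<open>f\<close> in the dual exponent \<open>2n/(n+\<epsilon>)\<close> is an admissible right-hand side, and
  the solution is bounded in \<open>L\<^sup>p\<close> by \<open>f\<close>.

  Both embeddings only use that \<open>\<Omega>\<close> fills a fixed proportion of each small ball centred in it.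
  Comparing \<open>u(x)\<close> with its mean over \<open>B(x,r) \<inter> \<Omega>\<close> gives
  \<open>|u(x)| \<le> A (r\<^sup>\<epsilon> D(x) + r\<^bsup>-d/p\<^esup> \<parallel>u\<parallel>\<^sub>p)\<close>, where \<open>d = 2n\<close> and \<open>\<integral> D\<^sup>2\<close> is the Slobodeckij
  seminorm squared; optimising \<open>r\<close> and integrating the \<open>p\<close>-th power yields the Sobolev inequality.
  Comparing with means over a finite \<open>r\<close>-net of balls yields compactness.
\<close>

section \<open>Riesz representation\<close>

text \<open>A form is a family of functions rather than a class modulo null sets, and
  \<open>dbar\<close>, \<open>dbar_star\<close> and \<open>dbar_neumann\<close> return arbitrary
  representatives, so they are linear only up to \<open>form_eq\<close>. The Hilbert space arguments
  are therefore carried out for semi-inner products on a set whose only operation \<open>lc\<close>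
  forms linear combinations, and uniqueness always means uniqueness modulo null sets.

  The pivot is the weak equation \<open>Q v u = ip (Suc m) v f\<close> for all v in the form domain.
  It determines u, and it keeps its meaning when f lies outside \<open>L\<^sup>2\<close> but pairs
  with the form domain. The extension is defined by this equation itself and not by passing to
  limits; its agreement with the Neumann operator on \<open>L\<^sup>2\<close> is then uniqueness of
  weak solutions.

  The difficulty on the \<open>L\<^sup>2\<close> side is that the equation controls only the sum of
  the two terms of \<open>Q\<close>, while the domain of the complex Laplacian asks for regularity
  of \<open>dbar u\<close> and of \<open>dbar_star u\<close> separately. On the Lebesgue side the
  embedding is used twice, once to admit f and once to estimate the solution, so the final bound
  contains the square of its constant.\<close>

locale semi_inner =
  fixes H :: "'v set"
    and lc :: "complex \<Rightarrow> 'v \<Rightarrow> complex \<Rightarrow> 'v \<Rightarrow> 'v"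
    and B :: "'v \<Rightarrow> 'v \<Rightarrow> complex"
  assumes nonempty: "H \<noteq> {}"
    and lc_mem: "u \<in> H \<Longrightarrow> v \<in> H \<Longrightarrow> lc a u b v \<in> H"
    and B_lc: "u \<in> H \<Longrightarrow> v \<in> H \<Longrightarrow> w \<in> H \<Longrightarrow> B (lc a u b v) w = a * B u w + b * B v w"
    and B_cnj: "u \<in> H \<Longrightarrow> v \<in> H \<Longrightarrow> B v u = cnj (B u v)"
    and B_nonneg: "u \<in> H \<Longrightarrow> 0 \<le> Re (B u u)"
begin

definition sqn :: "'v \<Rightarrow> real" where "sqn u = Re (B u u)"

definition cauchy_seq :: "(nat \<Rightarrow> 'v) \<Rightarrow> bool" where
  "cauchy_seq s \<longleftrightarrow> (\<forall>k. s k \<in> H)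
     \<and> (\<forall>e>0. \<exists>N. \<forall>m\<ge>N. \<forall>n\<ge>N. sqn (lc 1 (s m) (-1) (s n)) < e)"

definition complete_carrier :: bool where
  "complete_carrier \<longleftrightarrow> (\<forall>s. cauchy_seq s \<longrightarrow>
     (\<exists>u\<in>H. (\<lambda>k. sqn (lc 1 (s k) (-1) u)) \<longlonglongrightarrow> 0))"

lemma sqn_nonneg: "u \<in> H \<Longrightarrow> 0 \<le> sqn u"
  by (simp add: sqn_def B_nonneg)

lemma B_self: "u \<in> H \<Longrightarrow> B u u = of_real (sqn u)"
proof -
  assume "u \<in> H"
  then have "Im (B u u) = Im (cnj (B u u))" using B_cnj by metis
  then show ?thesis by (simp add: sqn_def complex_eq_iff)
qed

lemma B_lc_right:
  assumes "u \<in> H" "v \<in> H" "w \<in> H"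
  shows "B w (lc a u b v) = cnj a * B w u + cnj b * B w v"
  using assms by (subst B_cnj[of "lc a u b v" w])
    (auto simp: lc_mem B_lc B_cnj[of u w] B_cnj[of v w])

lemma sqn_lc:
  assumes "u \<in> H" "v \<in> H"
  shows "sqn (lc a u b v) = (cmod a)\<^sup>2 * sqn u + (cmod b)\<^sup>2 * sqn v + 2 * Re (a * cnj b * B u v)"
proof -
  have "B (lc a u b v) (lc a u b v)
      = a * cnj a * B u u + b * cnj b * B v v + (a * cnj b * B u v + cnj (a * cnj b * B u v))"
    using assms by (simp add: B_lc B_lc_right lc_mem B_cnj[of u v] algebra_simps)
  also have "\<dots> = of_real ((cmod a)\<^sup>2 * sqn u + (cmod b)\<^sup>2 * sqn v + 2 * Re (a * cnj b * B u v))"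
    using assms by (simp only: B_self complex_add_cnj of_real_add of_real_mult
        complex_norm_square of_real_numeral)
  finally have "Re (B (lc a u b v) (lc a u b v))
      = Re (of_real ((cmod a)\<^sup>2 * sqn u + (cmod b)\<^sup>2 * sqn v + 2 * Re (a * cnj b * B u v)))"
    by (rule arg_cong)
  then show ?thesis
    unfolding sqn_def[of "lc a u b v"] Re_complex_of_real .
qed

text \<open>Nonnegativity of \<open>sqn\<close> on the line u - t B(u,v) v is a quadratic inequality
  in the real number t; the factor B(u,v) makes the cross term real. Since \<open>sqn v = 0\<close>
  does not force v to vanish, the degenerate case is argued separately.\<close>

lemma Cauchy_Schwarz_sqn:
  assumes "u \<in> H" "v \<in> H"
  shows "(cmod (B u v))\<^sup>2 \<le> sqn u * sqn v"
proof -
  define \<beta> where "\<beta> = cmod (B u v)"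
  have *: "0 \<le> sqn u + t\<^sup>2 * \<beta>\<^sup>2 * sqn v - 2 * t * \<beta>\<^sup>2" for t :: real
  proof -
    have "0 \<le> sqn (lc 1 u (- (of_real t * B u v)) v)"
      using assms by (simp add: sqn_nonneg lc_mem)
    also have "\<dots> = sqn u + t\<^sup>2 * \<beta>\<^sup>2 * sqn v - 2 * t * Re (cnj (B u v) * B u v)"
      using assms by (simp add: sqn_lc norm_mult power_mult_distrib \<beta>_def mult.assoc)
    also have "cnj (B u v) * B u v = of_real (\<beta>\<^sup>2)"
      by (simp only: \<beta>_def complex_norm_square mult.commute)
    finally show ?thesis by simp
  qed
  show ?thesis
  proof (cases "sqn v = 0")
    case True
    have "\<beta>\<^sup>2 \<le> 0"
    proof (rule ccontr)
      assume "\<not> \<beta>\<^sup>2 \<le> 0"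
      then have "\<beta>\<^sup>2 > 0" by simp
      \<comment> \<open>With \<open>sqn v = 0\<close> the inequality is linear in t, and at this t
        its right-hand side equals -1.\<close>
      then show False
        using *[of "(sqn u + 1) / (2 * \<beta>\<^sup>2)"] True by simp
    qed
    then show ?thesis using True by (simp add: \<beta>_def)
  next
    case False
    then have p: "sqn v > 0" using sqn_nonneg[OF assms(2)] by simp
    then show ?thesis
    proof -
      have "(1 / sqn v)\<^sup>2 * \<beta>\<^sup>2 * sqn v - 2 * (1 / sqn v) * \<beta>\<^sup>2 = - (\<beta>\<^sup>2 / sqn v)"
        using p by (simp add: power2_eq_square)
      moreover have "0 \<le> sqn u + ((1 / sqn v)\<^sup>2 * \<beta>\<^sup>2 * sqn v - 2 * (1 / sqn v) * \<beta>\<^sup>2)"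
        using *[of "1 / sqn v"] by (simp only: add_diff_eq)
      ultimately have "\<beta>\<^sup>2 / sqn v \<le> sqn u" by simp
      then show ?thesis using p by (simp add: \<beta>_def divide_le_eq)
    qed
  qed
qed

lemma norm_B_le:
  assumes "u \<in> H" "v \<in> H"
  shows "cmod (B u v) \<le> sqrt (sqn u) * sqrt (sqn v)"
  using real_le_rsqrt[OF Cauchy_Schwarz_sqn[OF assms]] by (simp add: real_sqrt_mult)

lemma tendsto_B:
  assumes "\<And>k. s k \<in> H" "u \<in> H" "v \<in> H" "(\<lambda>k. sqn (lc 1 (s k) (-1) u)) \<longlonglongrightarrow> 0"
  shows "(\<lambda>k. B v (s k)) \<longlonglongrightarrow> B v u"
proof -
  have "(\<lambda>k. sqrt (sqn v) * sqrt (sqn (lc 1 (s k) (-1) u))) \<longlonglongrightarrow> sqrt (sqn v) * sqrt 0"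
    by (intro tendsto_intros assms)
  then have "(\<lambda>k. sqrt (sqn v) * sqrt (sqn (lc 1 (s k) (-1) u))) \<longlonglongrightarrow> 0" by simp
  moreover have "cmod (B v (s k) - B v u) \<le> sqrt (sqn v) * sqrt (sqn (lc 1 (s k) (-1) u))" for k
    using norm_B_le[of v "lc 1 (s k) (-1) u"] assms by (simp add: lc_mem B_lc_right)
  ultimately have "(\<lambda>k. B v (s k) - B v u) \<longlonglongrightarrow> 0"
    by (metis (no_types, lifting) Lim_null_comparison eventuallyI)
  then show ?thesis by (rule LIM_zero_cancel)
qed

text \<open>The representing vector minimises \<open>sqn v - 2 * Re (l v)\<close>. The bound on
  \<open>l\<close> keeps this functional bounded below, the parallelogram law makes a minimising
  sequence Cauchy, and the first variation at the limit is the claimed identity.\<close>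

theorem Riesz_representation:
  assumes "complete_carrier"
    and l_lc: "\<And>a u b v. u \<in> H \<Longrightarrow> v \<in> H \<Longrightarrow> l (lc a u b v) = a * l u + b * l v"
    and l_bdd: "\<And>v. v \<in> H \<Longrightarrow> cmod (l v) \<le> C * sqrt (sqn v)"
  shows "\<exists>u\<in>H. \<forall>v\<in>H. B v u = l v"
proof -
  define F where "F v = sqn v - 2 * Re (l v)" for v
  have F_ge: "- C\<^sup>2 \<le> F v" if "v \<in> H" for v
  proof -
    have "Re (l v) \<le> C * sqrt (sqn v)"
      using l_bdd[OF that] complex_Re_le_cmod[of "l v"] by simp
    moreover have "0 \<le> (sqrt (sqn v) - C)\<^sup>2" by simp
    ultimately show ?thesis
      using sqn_nonneg[OF that] by (simp add: F_def power2_diff algebra_simps)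
  qed
  define m where "m = Inf (F ` H)"
  have bdd: "bdd_below (F ` H)" using F_ge by (auto intro!: bdd_belowI)
  have m_le: "m \<le> F v" if "v \<in> H" for v
    unfolding m_def using bdd that by (intro cInf_lower) auto
  have "\<exists>v\<in>H. F v < m + 1 / Suc k" for k
    using cInf_lessD[of "F ` H" "m + 1 / Suc k"] nonempty by (auto simp: m_def)
  then obtain s where "\<forall>k. s k \<in> H \<and> F (s k) < m + 1 / Suc k"
    using choice[of "\<lambda>k v. v \<in> H \<and> F v < m + 1 / Suc k"] by blast
  then have s: "\<And>k. s k \<in> H" "\<And>k. F (s k) < m + 1 / Suc k" by blast+
  have diff: "sqn (lc 1 (s i) (-1) (s j)) \<le> 2 / Suc i + 2 / Suc j" for i j
  proof -
    \<comment> \<open>Here a and b are the values of \<open>F\<close> at two members of the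
      sequence, d is their squared distance, and x is the value at the midpoint, which is at least
      the infimum m.\<close>
    have mid: "d \<le> 2 * (a - m) + 2 * (b - m)" if "x = (a + b) / 2 - d / 4" "m \<le> x" for a b d x :: real
      using that by (simp add: field_simps)
    have "F (lc (1/2) (s i) (1/2) (s j)) = (F (s i) + F (s j)) / 2 - sqn (lc 1 (s i) (-1) (s j)) / 4"
      using s(1) by (simp add: F_def sqn_lc l_lc norm_divide power2_eq_square field_simps)
    then have "sqn (lc 1 (s i) (-1) (s j)) \<le> 2 * (F (s i) - m) + 2 * (F (s j) - m)"
      by (rule mid) (rule m_le[OF lc_mem[OF s(1) s(1)]])
      also have "\<dots> \<le> 2 * (1 / Suc i) + 2 * (1 / Suc j)"
        using s(2)[of i] s(2)[of j] by (intro add_mono mult_left_mono) auto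
      finally show ?thesis by simp
  qed
  have "cauchy_seq s"
    unfolding cauchy_seq_def
  proof (intro conjI allI impI s(1))
    fix e :: real assume "e > 0"
    then have "e / 4 > 0" by simp
    then obtain N where N: "1 / Suc N < e / 4" by (rule nat_approx_posE)
    have "sqn (lc 1 (s i) (-1) (s j)) < e" if "i \<ge> N" "j \<ge> N" for i j
    proof -
      have "1 / Suc i \<le> 1 / Suc N" "1 / Suc j \<le> 1 / Suc N"
        using that by (auto simp: field_simps)
      then show ?thesis using diff[of i j] N by simp
    qed
    then show "\<exists>N. \<forall>i\<ge>N. \<forall>j\<ge>N. sqn (lc 1 (s i) (-1) (s j)) < e" by blast
  qed
  then obtain u where u: "u \<in> H" "(\<lambda>k. sqn (lc 1 (s k) (-1) u)) \<longlonglongrightarrow> 0"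
    using assms(1) unfolding complete_carrier_def by blast
  have "B v u = l v" if v: "v \<in> H" for v
  proof -
    define \<beta> where "\<beta> = B v u - l v"
    \<comment> \<open>The comparison is made at \<open>s k\<close>, where \<open>F\<close> exceeds
      its infimum by less than 1/(k+1), and only the resulting inequality is passed to the
      limit.\<close>
    have var: "0 \<le> (cmod t)\<^sup>2 * sqn v + 2 * Re (t * \<beta>)" for t
    proof -
      have k: "- (1 / Suc k) \<le> (cmod t)\<^sup>2 * sqn v + 2 * Re (t * (B v (s k) - l v))" for k
      proof -
        have "F (lc 1 (s k) t v) = F (s k) + (cmod t)\<^sup>2 * sqn v + 2 * Re (t * (B v (s k) - l v))"
          using s(1) v by (simp add: F_def sqn_lc l_lc B_cnj[OF v s(1)[of k]] algebra_simps)
        then show ?thesis using m_le[OF lc_mem[OF s(1)[of k] v], of 1 t] s(2)[of k] by simp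
      qed
      have "(\<lambda>k. (cmod t)\<^sup>2 * sqn v + 2 * Re (t * (B v (s k) - l v)))
          \<longlonglongrightarrow> (cmod t)\<^sup>2 * sqn v + 2 * Re (t * \<beta>)"
        unfolding \<beta>_def by (intro tendsto_intros tendsto_B s(1) u v)
      moreover have "(\<lambda>k. - (1 / Suc k)) \<longlonglongrightarrow> (0::real)"
        using tendsto_minus[OF LIMSEQ_inverse_real_of_nat] by (simp add: inverse_eq_divide)
      ultimately show ?thesis
        using k LIMSEQ_le by blast
    qed
    have "(cmod \<beta>)\<^sup>2 \<le> 0"
    proof (rule ccontr)
      assume "\<not> (cmod \<beta>)\<^sup>2 \<le> 0"
      then have \<beta>: "(cmod \<beta>)\<^sup>2 > 0" by simp
      \<comment> \<open>The variation t = - r * cnj \<beta> turns the linear term into -2 r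
        |\<beta>|^2. This r satisfies r * sqn v < 1, so the quadratic term cannot compensate
        it.\<close>
      define r where "r = 1 / (sqn v + 1)"
      have r: "r > 0" "r * sqn v < 1" using sqn_nonneg[OF v] by (auto simp: r_def)
      have "\<beta> * cnj \<beta> = of_real ((cmod \<beta>)\<^sup>2)" by (simp only: complex_norm_square)
      then have "of_real r * cnj \<beta> * \<beta> = of_real (r * (cmod \<beta>)\<^sup>2)"
        by (simp add: mult_ac)
      then have "Re (- (of_real r * cnj \<beta>) * \<beta>) = - (r * (cmod \<beta>)\<^sup>2)"
        by (simp only: mult_minus_left uminus_complex.simps Re_complex_of_real)
      then have "0 \<le> r\<^sup>2 * (cmod \<beta>)\<^sup>2 * sqn v - 2 * (r * (cmod \<beta>)\<^sup>2)"
        using var[of "- (of_real r * cnj \<beta>)"] r by (simp add: norm_mult power_mult_distrib)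
      also have "\<dots> = r * (cmod \<beta>)\<^sup>2 * (r * sqn v - 2)" by (simp add: algebra_simps power2_eq_square)
      also have "\<dots> < 0" using r \<beta> by (intro mult_pos_neg mult_pos_pos) auto
      finally show False by simp
    qed
    then show ?thesis by (simp add: \<beta>_def)
  qed
  then show ?thesis using u(1) by blast
qed

text \<open>The projection of f is the vector of \<open>K\<close> that represents the functional v
  -> \<open>B v f\<close> on \<open>K\<close>; the bound for this functional is the Cauchy-Schwarz
  inequality.\<close>

lemma orthogonal_projection:
  assumes K: "K \<subseteq> H" "K \<noteq> {}" "\<And>a u b v. u \<in> K \<Longrightarrow> v \<in> K \<Longrightarrow> lc a u b v \<in> K"
    and complete: "\<And>s. cauchy_seq s \<Longrightarrow> (\<And>k. s k \<in> K) \<Longrightarrow>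
      \<exists>u\<in>K. (\<lambda>k. sqn (lc 1 (s k) (-1) u)) \<longlonglongrightarrow> 0"
    and f: "f \<in> H"
  shows "\<exists>p\<in>K. \<forall>v\<in>K. B v (lc 1 f (-1) p) = 0"
proof -
  interpret K: semi_inner K lc B
  proof
    show "K \<noteq> {}" by fact
    show "lc a u b v \<in> K" if "u \<in> K" "v \<in> K" for u v a b using that by (rule K(3))
    show "B (lc a u b v) w = a * B u w + b * B v w" if "u \<in> K" "v \<in> K" "w \<in> K" for u v w a b
      using that K(1) B_lc by blast
    show "B v u = cnj (B u v)" if "u \<in> K" "v \<in> K" for u v
      using that K(1) B_cnj by blast
    show "0 \<le> Re (B u u)" if "u \<in> K" for u
      using that K(1) B_nonneg by blast
  qed
  have "K.complete_carrier"
    unfolding K.complete_carrier_def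
  proof (intro allI impI)
    fix s assume s: "K.cauchy_seq s"
    then have "s k \<in> K" for k by (simp add: K.cauchy_seq_def)
    moreover have "cauchy_seq s"
      using s K(1) unfolding K.cauchy_seq_def cauchy_seq_def by blast
    ultimately show "\<exists>u\<in>K. (\<lambda>k. sqn (lc 1 (s k) (-1) u)) \<longlonglongrightarrow> 0"
      using complete by blast
  qed
  moreover have "cmod (B v f) \<le> sqrt (sqn f) * sqrt (sqn v)" if "v \<in> K" for v
    using norm_B_le[of v f] K(1) f that by (auto simp: mult.commute)
  moreover have "B (lc a u b v) f = a * B u f + b * B v f" if "u \<in> K" "v \<in> K" for a u b v
    using that K(1) f B_lc by blast
  ultimately obtain p where p: "p \<in> K" "\<And>v. v \<in> K \<Longrightarrow> B v p = B v f"
    using K.Riesz_representation[of "\<lambda>v. B v f" "sqrt (sqn f)"] by blast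
  then have "B v (lc 1 f (-1) p) = 0" if "v \<in> K" for v
    using that K(1) f by (subst B_lc_right) auto
  then show ?thesis using p(1) by blast
qed

end

section \<open>Integral inequalities and completeness\<close>

text \<open>Young's inequality is integrated after both factors have been divided by their norms. A
  factor of norm zero cannot be normalised, but it vanishes almost everywhere.\<close>

lemma Holder_integral:
  fixes f g :: "'a \<Rightarrow> real"
  assumes pq: "p > 1" "q > 1" "1 / p + 1 / q = 1"
    and [measurable]: "f \<in> borel_measurable M" "g \<in> borel_measurable M"
    and f: "integrable M (\<lambda>x. \<bar>f x\<bar> powr p)" and g: "integrable M (\<lambda>x. \<bar>g x\<bar> powr q)"
  shows "integrable M (\<lambda>x. f x * g x)"
    and "(LINT x|M. \<bar>f x * g x\<bar>)
      \<le> (LINT x|M. \<bar>f x\<bar> powr p) powr (1 / p) * (LINT x|M. \<bar>g x\<bar> powr q) powr (1 / q)"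
proof -
  have young: "\<bar>a * b\<bar> \<le> \<bar>a\<bar> powr p / p + \<bar>b\<bar> powr q / q" for a b :: real
    using Youngs_inequality[OF pq, of "\<bar>a\<bar>" "\<bar>b\<bar>"] by (simp add: abs_mult)
  have int: "integrable M (\<lambda>x. \<bar>f x\<bar> powr p / p + \<bar>g x\<bar> powr q / q)"
    using f g by simp
  show fg: "integrable M (\<lambda>x. f x * g x)"
  proof (rule Bochner_Integration.integrable_bound[OF int])
    show "AE x in M. norm (f x * g x) \<le> norm (\<bar>f x\<bar> powr p / p + \<bar>g x\<bar> powr q / q)"
      using order_trans[OF young abs_ge_self] by simp
  qed simp
  define F where "F = (LINT x|M. \<bar>f x\<bar> powr p)"
  define G where "G = (LINT x|M. \<bar>g x\<bar> powr q)"
  have FG: "F \<ge> 0" "G \<ge> 0" by (simp_all add: F_def G_def)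
  show "(LINT x|M. \<bar>f x * g x\<bar>)
      \<le> (LINT x|M. \<bar>f x\<bar> powr p) powr (1 / p) * (LINT x|M. \<bar>g x\<bar> powr q) powr (1 / q)"
  proof (cases "F = 0 \<or> G = 0")
    case True
    have "AE x in M. \<bar>f x * g x\<bar> = 0"
      using True
    proof
      assume "F = 0"
      then have "AE x in M. \<bar>f x\<bar> powr p = 0"
        unfolding F_def using f by (subst (asm) integral_nonneg_eq_0_iff_AE) auto
      then show ?thesis by eventually_elim simp
    next
      assume "G = 0"
      then have "AE x in M. \<bar>g x\<bar> powr q = 0"
        unfolding G_def using g by (subst (asm) integral_nonneg_eq_0_iff_AE) auto
      then show ?thesis by eventually_elim simp
    qed
    then have "(LINT x|M. \<bar>f x * g x\<bar>) = (LINT x|M. 0)"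
      by (intro integral_cong_AE) auto
    then show ?thesis by simp
  next
    case False
    then have FG: "F > 0" "G > 0" using FG by auto
    define a where "a = F powr (1 / p)"
    define b where "b = G powr (1 / q)"
    have ab: "a > 0" "b > 0" using FG by (simp_all add: a_def b_def)
    have ap: "a powr p = F" and bq: "b powr q = G"
      using FG pq by (simp_all add: a_def b_def powr_powr)
    have "(LINT x|M. \<bar>f x * g x\<bar> / (a * b))
        \<le> (LINT x|M. \<bar>f x\<bar> powr p / (F * p) + \<bar>g x\<bar> powr q / (G * q))"
    proof (rule integral_mono)
      show "\<bar>f x * g x\<bar> / (a * b) \<le> \<bar>f x\<bar> powr p / (F * p) + \<bar>g x\<bar> powr q / (G * q)" for x
        using young[of "f x / a" "g x / b"] ab pq
        by (simp add: abs_mult powr_divide ap bq)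
    qed (use fg f g in auto)
    also have "\<dots> = F / (F * p) + G / (G * q)"
      using f g by (subst Bochner_Integration.integral_add) (simp_all add: F_def G_def)
    also have "\<dots> = 1" using FG pq by simp
    finally have "(LINT x|M. \<bar>f x * g x\<bar>) / (a * b) \<le> 1" by simp
    then show ?thesis using ab by (simp add: divide_le_eq a_def b_def F_def G_def)
  qed
qed

text \<open>Hoelder's inequality against the constant function 1, whose norm in the conjugate
  exponent is the power of the total measure.\<close>

lemma (in finite_measure) integral_abs_le_powr:
  fixes f :: "'a \<Rightarrow> real"
  assumes p: "p > 1" and [measurable]: "f \<in> borel_measurable M"
    and f: "integrable M (\<lambda>x. \<bar>f x\<bar> powr p)"
  shows "integrable M f"
    and "(LINT x|M. \<bar>f x\<bar>) \<le> measure M (space M) powr (1 - 1 / p) * (LINT x|M. \<bar>f x\<bar> powr p) powr (1 / p)"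
proof -
  define q where "q = p / (p - 1)"
  have q: "q > 1" "1 / p + 1 / q = 1" "1 / q = 1 - 1 / p"
    using p by (simp_all add: q_def field_simps)
  show "integrable M f"
    using Holder_integral(1)[OF p q(1,2), of f M "\<lambda>_. 1"] f by simp
  show "(LINT x|M. \<bar>f x\<bar>) \<le> measure M (space M) powr (1 - 1 / p) * (LINT x|M. \<bar>f x\<bar> powr p) powr (1 / p)"
    using Holder_integral(2)[OF p q(1,2), of f M "\<lambda>_. 1"] f q(3) by (simp add: mult.commute)
qed

lemma (in finite_measure) integral_abs_le_sqrt:
  fixes f :: "'a \<Rightarrow> real"
  assumes [measurable]: "f \<in> borel_measurable M" and f: "integrable M (\<lambda>x. (f x)\<^sup>2)"
  shows "integrable M f"
    and "(LINT x|M. \<bar>f x\<bar>) \<le> sqrt (measure M (space M)) * sqrt (LINT x|M. (f x)\<^sup>2)"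
proof -
  have eq: "\<bar>t\<bar> powr 2 = t\<^sup>2" for t :: real by (simp add: powr_numeral)
  show "integrable M f"
    using integral_abs_le_powr(1)[of 2 f] f by (simp add: eq)
  show "(LINT x|M. \<bar>f x\<bar>) \<le> sqrt (measure M (space M)) * sqrt (LINT x|M. (f x)\<^sup>2)"
    using integral_abs_le_powr(2)[of 2 f] f by (simp add: eq powr_half_sqrt)
qed

text \<open>Riesz-Fischer on a finite measure space: along a fast subsequence the increments are
  summable in \<open>L\<^sup>1\<close>, because there the \<open>L\<^sup>2\<close> norm dominates
  the \<open>L\<^sup>1\<close> norm. So the subsequence converges almost everywhere, and Fatou's
  lemma carries the Cauchy estimate over to its limit.\<close>

lemma (in finite_measure) L2_complete:
  fixes f :: "nat \<Rightarrow> 'a \<Rightarrow> complex"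
  assumes meas[measurable]: "\<And>k. f k \<in> borel_measurable M"
    and int: "\<And>k. integrable M (\<lambda>x. (cmod (f k x))\<^sup>2)"
    and cauchy: "\<And>e. e > 0 \<Longrightarrow> \<exists>N. \<forall>m\<ge>N. \<forall>n\<ge>N. (LINT x|M. (cmod (f m x - f n x))\<^sup>2) < e"
  shows "\<exists>g. g \<in> borel_measurable M \<and> integrable M (\<lambda>x. (cmod (g x))\<^sup>2)
     \<and> (\<lambda>k. LINT x|M. (cmod (f k x - g x))\<^sup>2) \<longlonglongrightarrow> 0"
proof -
  have sq_diff: "(cmod (a - b))\<^sup>2 \<le> 2 * (cmod a)\<^sup>2 + 2 * (cmod b)\<^sup>2" for a b :: complex
  proof -
    have "cmod (a - b) \<le> cmod a + cmod b" by (rule norm_triangle_ineq4)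
    then have "(cmod (a - b))\<^sup>2 \<le> (cmod a + cmod b)\<^sup>2" by (intro power_mono) auto
    also have "\<dots> \<le> 2 * (cmod a)\<^sup>2 + 2 * (cmod b)\<^sup>2"
      using zero_le_power2[of "cmod a - cmod b"] by (simp add: power2_sum power2_diff)
    finally show ?thesis .
  qed
  have int_diff: "integrable M (\<lambda>x. (cmod (f m x - f n x))\<^sup>2)" for m n
  proof (rule Bochner_Integration.integrable_bound[where f = "\<lambda>x. 2 * (cmod (f m x))\<^sup>2 + 2 * (cmod (f n x))\<^sup>2"])
    show "AE x in M. norm ((cmod (f m x - f n x))\<^sup>2) \<le> norm (2 * (cmod (f m x))\<^sup>2 + 2 * (cmod (f n x))\<^sup>2)"
      using sq_diff by (auto intro!: AE_I2)
  qed (use int in auto)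
  have nn_diff: "(\<integral>\<^sup>+x. ennreal ((cmod (f m x - f n x))\<^sup>2) \<partial>M) = ennreal (LINT x|M. (cmod (f m x - f n x))\<^sup>2)" for m n
    by (rule nn_integral_eq_integral) (use int_diff in auto)
  \<comment> \<open>Squared distances below 4^-k give norms below 2^-k, a summable sequence.\<close>
  have "\<exists>N. \<forall>m\<ge>N. \<forall>n\<ge>N. (LINT x|M. (cmod (f m x - f n x))\<^sup>2) < (1/4) ^ k" for k :: nat
    by (rule cauchy) simp
  then obtain N where N: "\<And>k m n. m \<ge> N k \<Longrightarrow> n \<ge> N k \<Longrightarrow> (LINT x|M. (cmod (f m x - f n x))\<^sup>2) < (1/4) ^ k"
    by metis
  \<comment> \<open>The sum makes r k at least N i for every i up to k, and the added k gives r k >=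
    k, so that the indices eventually pass any given n in the Fatou argument.\<close>
  define r where "r k = (\<Sum>i\<le>k. N i) + k" for k
  have rN: "r k \<ge> N k" "r (Suc k) \<ge> N k" for k
  proof -
    have "N k \<le> (\<Sum>i\<le>k. N i)" by (rule member_le_sum) auto
    then show "r k \<ge> N k" "r (Suc k) \<ge> N k" by (simp_all add: r_def)
  qed
  have r_ge: "r k \<ge> k" for k by (simp add: r_def)
  define h where "h k x = cmod (f (r (Suc k)) x - f (r k) x)" for k x
  have h_meas[measurable]: "h k \<in> borel_measurable M" for k
    unfolding h_def by measurable
  have h_int: "integrable M (h k)" and
    h_le: "(LINT x|M. h k x) \<le> sqrt (measure M (space M)) * (1/2) ^ k" for k
  proof -
    have i2: "integrable M (\<lambda>x. (h k x)\<^sup>2)" unfolding h_def by (rule int_diff)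
    show "integrable M (h k)" by (rule integral_abs_le_sqrt(1)[OF h_meas i2])
    have "sqrt (LINT x|M. (h k x)\<^sup>2) \<le> sqrt ((1/4) ^ k)"
      using N[OF rN(2) rN(1), of k] unfolding h_def by simp
    also have "sqrt ((1/4) ^ k) = (1/2 :: real) ^ k"
      by (rule real_sqrt_unique) (simp_all add: power2_eq_square flip: power_mult_distrib)
    finally have "sqrt (measure M (space M)) * sqrt (LINT x|M. (h k x)\<^sup>2) \<le> sqrt (measure M (space M)) * (1/2) ^ k"
      by (intro mult_left_mono) auto
    moreover have "(LINT x|M. h k x) = (LINT x|M. \<bar>h k x\<bar>)" by (simp add: h_def)
    ultimately show "(LINT x|M. h k x) \<le> sqrt (measure M (space M)) * (1/2) ^ k"
      using integral_abs_le_sqrt(2)[OF h_meas i2] by linarith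
  qed
  have "(\<integral>\<^sup>+x. (\<Sum>k. ennreal (h k x)) \<partial>M) = (\<Sum>k. \<integral>\<^sup>+x. ennreal (h k x) \<partial>M)"
    by (rule nn_integral_suminf) simp
  also have "\<dots> = (\<Sum>k. ennreal (LINT x|M. h k x))"
    using h_int by (subst nn_integral_eq_integral) (auto simp: h_def)
  also have "\<dots> \<le> (\<Sum>k. ennreal (sqrt (measure M (space M)) * (1/2) ^ k))"
    by (intro suminf_le ennreal_leI h_le) auto
  also have "\<dots> = ennreal (\<Sum>k. sqrt (measure M (space M)) * (1/2) ^ k)"
    by (rule suminf_ennreal2) (auto intro!: summable_mult summable_geometric)
  finally have "(\<integral>\<^sup>+x. (\<Sum>k. ennreal (h k x)) \<partial>M) \<noteq> \<infinity>"
    by (auto simp: top_unique)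
  then have "AE x in M. (\<Sum>k. ennreal (h k x)) \<noteq> \<infinity>"
    by (intro nn_integral_noteq_infinite) auto
  then have conv: "AE x in M. convergent (\<lambda>k. f (r k) x)"
  proof eventually_elim
    case (elim x)
    then have "summable (\<lambda>k. h k x)"
      by (intro summable_suminf_not_top) (auto simp: h_def)
    then have "summable (\<lambda>k. f (r (Suc k)) x - f (r k) x)"
      unfolding h_def by (rule summable_norm_cancel)
    then have "convergent (\<lambda>n. \<Sum>k<n. f (r (Suc k)) x - f (r k) x)"
      by (simp add: summable_iff_convergent)
    then have "convergent (\<lambda>n. f (r n) x - f (r 0) x)"
      using sum_lessThan_telescope[of "\<lambda>k. f (r k) x"] by (simp only:)
    then show ?case
      using convergent_add[OF _ convergent_const[of "f (r 0) x"]] by fastforce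
  qed
  define g where "g x = lim (\<lambda>k. f (r k) x)" for x
  have g_meas[measurable]: "g \<in> borel_measurable M"
    unfolding g_def by measurable
  have g_lim: "AE x in M. (\<lambda>k. f (r k) x) \<longlonglongrightarrow> g x"
    using conv by eventually_elim (simp add: g_def convergent_LIMSEQ_iff)
  have fatou: "(\<integral>\<^sup>+x. ennreal ((cmod (f n x - g x))\<^sup>2) \<partial>M) \<le> ennreal e"
    if e: "\<And>m. m \<ge> n \<Longrightarrow> (LINT x|M. (cmod (f n x - f m x))\<^sup>2) \<le> e" for n e
  proof -
    have "(\<integral>\<^sup>+x. ennreal ((cmod (f n x - g x))\<^sup>2) \<partial>M)
        = (\<integral>\<^sup>+x. liminf (\<lambda>k. ennreal ((cmod (f n x - f (r k) x))\<^sup>2)) \<partial>M)"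
    proof (rule nn_integral_cong_AE)
      show "AE x in M. ennreal ((cmod (f n x - g x))\<^sup>2) = liminf (\<lambda>k. ennreal ((cmod (f n x - f (r k) x))\<^sup>2))"
        using g_lim
      proof eventually_elim
        case (elim x)
        have "(\<lambda>k. ennreal ((cmod (f n x - f (r k) x))\<^sup>2)) \<longlonglongrightarrow> ennreal ((cmod (f n x - g x))\<^sup>2)"
          by (intro tendsto_intros elim)
        then show ?case by (intro lim_imp_Liminf[symmetric]) auto
      qed
    qed
    also have "\<dots> \<le> liminf (\<lambda>k. \<integral>\<^sup>+x. ennreal ((cmod (f n x - f (r k) x))\<^sup>2) \<partial>M)"
      by (rule nn_integral_liminf) simp
    also have "\<dots> \<le> ennreal e"
    proof (rule Liminf_le)
      show "\<forall>\<^sub>F k in sequentially. (\<integral>\<^sup>+x. ennreal ((cmod (f n x - f (r k) x))\<^sup>2) \<partial>M) \<le> ennreal e"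
        using eventually_ge_at_top[of n]
      proof eventually_elim
        case (elim k)
        then have "r k \<ge> n" using r_ge[of k] by linarith
        then show ?case using e by (simp add: nn_diff ennreal_leI)
      qed
    qed simp
    finally show ?thesis .
  qed
  have small: "\<exists>N. \<forall>n\<ge>N. (\<integral>\<^sup>+x. ennreal ((cmod (f n x - g x))\<^sup>2) \<partial>M) \<le> ennreal e" if "e > 0" for e
  proof -
    obtain N where "\<forall>m\<ge>N. \<forall>n\<ge>N. (LINT x|M. (cmod (f m x - f n x))\<^sup>2) < e"
      using cauchy[OF \<open>e > 0\<close>] by blast
    then have "(\<integral>\<^sup>+x. ennreal ((cmod (f n x - g x))\<^sup>2) \<partial>M) \<le> ennreal e" if "n \<ge> N" for n
      using that by (intro fatou less_imp_le) auto
    then show ?thesis by blast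
  qed
  \<comment> \<open>A single member at finite distance from g already shows that g is square
    integrable.\<close>
  obtain n0 where n0: "(\<integral>\<^sup>+x. ennreal ((cmod (f n0 x - g x))\<^sup>2) \<partial>M) \<le> ennreal 1"
    using small[of 1] by auto
  have int0: "integrable M (\<lambda>x. (cmod (f n0 x - g x))\<^sup>2)"
    using n0 by (intro integrableI_nonneg) (auto simp: le_less_trans)
  have g_int: "integrable M (\<lambda>x. (cmod (g x))\<^sup>2)"
  proof (rule Bochner_Integration.integrable_bound[where f = "\<lambda>x. 2 * (cmod (f n0 x))\<^sup>2 + 2 * (cmod (f n0 x - g x))\<^sup>2"])
    show "AE x in M. norm ((cmod (g x))\<^sup>2) \<le> norm (2 * (cmod (f n0 x))\<^sup>2 + 2 * (cmod (f n0 x - g x))\<^sup>2)"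
    proof (rule AE_I2)
      fix x
      show "norm ((cmod (g x))\<^sup>2) \<le> norm (2 * (cmod (f n0 x))\<^sup>2 + 2 * (cmod (f n0 x - g x))\<^sup>2)"
        using sq_diff[of "f n0 x" "f n0 x - g x"] by simp
    qed
  qed (use int int0 in auto)
  have int_g: "integrable M (\<lambda>x. (cmod (f n x - g x))\<^sup>2)" for n
  proof (rule Bochner_Integration.integrable_bound[where f = "\<lambda>x. 2 * (cmod (f n x))\<^sup>2 + 2 * (cmod (g x))\<^sup>2"])
    show "AE x in M. norm ((cmod (f n x - g x))\<^sup>2) \<le> norm (2 * (cmod (f n x))\<^sup>2 + 2 * (cmod (g x))\<^sup>2)"
      using sq_diff by (auto intro!: AE_I2)
  qed (use int g_int in auto)
  have "(\<lambda>k. LINT x|M. (cmod (f k x - g x))\<^sup>2) \<longlonglongrightarrow> 0"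
  proof (rule LIMSEQ_I)
    fix e :: real assume e: "e > 0"
    then obtain N where N: "\<And>n. n \<ge> N \<Longrightarrow> (\<integral>\<^sup>+x. ennreal ((cmod (f n x - g x))\<^sup>2) \<partial>M) \<le> ennreal (e / 2)"
      using small[of "e / 2"] by auto
    have "norm ((LINT x|M. (cmod (f n x - g x))\<^sup>2) - 0) < e" if "n \<ge> N" for n
    proof -
      have "ennreal (LINT x|M. (cmod (f n x - g x))\<^sup>2) \<le> ennreal (e / 2)"
        using N[OF that] by (subst nn_integral_eq_integral[symmetric]) (use int_g in auto)
      then show ?thesis using e by (simp add: ennreal_le_iff)
    qed
    then show "\<exists>N. \<forall>n\<ge>N. norm ((LINT x|M. (cmod (f n x - g x))\<^sup>2) - 0) < e" by blast
  qed
  then show ?thesis using g_meas g_int by blast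
qed

section \<open>Fractional Sobolev spaces on domains satisfying a measure density condition\<close>

lemma powr_sum_le:
  fixes a b p :: real
  assumes "a \<ge> 0" "b \<ge> 0" "p \<ge> 0"
  shows "(a + b) powr p \<le> 2 powr p * (a powr p + b powr p)"
proof -
  have "(a + b) powr p \<le> (2 * max a b) powr p"
    using assms by (intro powr_mono2) auto
  also have "\<dots> = 2 powr p * max a b powr p"
    using assms by (simp add: powr_mult)
  also have "max a b powr p \<le> a powr p + b powr p"
    by (simp add: max_def)
  finally show ?thesis by simp
qed

text \<open>The inner integral of the squared Slobodeckij seminorm. Its real value is called
  \<open>D x\<close> in later proofs, so the D(x) of the overview is \<open>sqrt (D x)\<close>. On
  the diagonal the quotient is 0/0, that is 0.\<close>

definition gagliardo :: "'a::euclidean_space set \<Rightarrow> real \<Rightarrow> ('a \<Rightarrow> 'b::real_normed_vector) \<Rightarrow> 'a \<Rightarrow> ennreal" where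
  "gagliardo \<Omega> \<epsilon> f x = (\<integral>\<^sup>+y. ennreal ((norm (f x - f y))\<^sup>2 / norm (x - y) powr (real DIM('a) + 2 * \<epsilon>)) \<partial>lebesgue_on \<Omega>)"

lemma borel_measurable_ident_lebesgue_on:
  "(\<lambda>x::'a::euclidean_space. x) \<in> borel_measurable (lebesgue_on S)"
  using id_borel_measurable_lebesgue_on[of S] by (simp add: id_def)

lemma borel_measurable_gagliardo [measurable]:
  fixes f :: "'a::euclidean_space \<Rightarrow> complex"
  assumes "\<Omega> \<in> lmeasurable" and [measurable]: "f \<in> borel_measurable (lebesgue_on \<Omega>)"
  shows "gagliardo \<Omega> \<epsilon> f \<in> borel_measurable (lebesgue_on \<Omega>)"
proof -
  interpret finite_measure "lebesgue_on \<Omega>"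
    using assms(1) by (rule finite_measure_lebesgue_on)
  note borel_measurable_ident_lebesgue_on[measurable]
  show ?thesis unfolding gagliardo_def by measurable
qed

lemma lebesgue_on_subset_measurable:
  assumes "E \<subseteq> \<Omega>" "f \<in> borel_measurable (lebesgue_on \<Omega>)"
  shows "f \<in> borel_measurable (lebesgue_on E)"
  using measurable_restrict_mono[OF assms(2,1)] .

lemma nn_integral_lebesgue_on_mono:
  assumes "E \<in> sets lebesgue" "\<Omega> \<in> sets lebesgue" "E \<subseteq> \<Omega>"
  shows "(\<integral>\<^sup>+x. h x \<partial>lebesgue_on E) \<le> (\<integral>\<^sup>+x. h x \<partial>lebesgue_on \<Omega>)"
  using assms by (auto simp: nn_integral_restrict_space intro!: nn_integral_mono split: split_indicator)

text \<open>For y in \<open>ball x \<rho>\<close> the factor |x - y|^(d + 2\<epsilon>) in the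
  denominator is at most \<rho>^(d + 2\<epsilon>).\<close>

lemma local_energy_le:
  fixes f :: "'a::euclidean_space \<Rightarrow> complex"
  assumes \<Omega>: "\<Omega> \<in> sets lebesgue" and E: "E \<in> sets lebesgue" "E \<subseteq> \<Omega>" "E \<subseteq> ball x \<rho>" and \<epsilon>: "\<epsilon> > 0"
    and f: "f \<in> borel_measurable (lebesgue_on \<Omega>)"
  shows "(\<integral>\<^sup>+y. ennreal ((cmod (f x - f y))\<^sup>2) \<partial>lebesgue_on E)
    \<le> ennreal (\<rho> powr (real DIM('a) + 2 * \<epsilon>)) * gagliardo \<Omega> \<epsilon> f x"
proof -
  let ?d = "real DIM('a) + 2 * \<epsilon>"
  note borel_measurable_ident_lebesgue_on[measurable]
  have [measurable]: "f \<in> borel_measurable (lebesgue_on E)"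
    by (rule lebesgue_on_subset_measurable[OF E(2) f])
  have "(\<integral>\<^sup>+y. ennreal ((cmod (f x - f y))\<^sup>2) \<partial>lebesgue_on E)
      \<le> (\<integral>\<^sup>+y. ennreal (\<rho> powr ?d) * ennreal ((cmod (f x - f y))\<^sup>2 / norm (x - y) powr ?d) \<partial>lebesgue_on E)"
  proof (rule nn_integral_mono)
    fix y assume "y \<in> space (lebesgue_on E)"
    then have y: "norm (x - y) < \<rho>" using E(3) by (auto simp: dist_norm)
    have "(cmod (f x - f y))\<^sup>2 \<le> \<rho> powr ?d * ((cmod (f x - f y))\<^sup>2 / norm (x - y) powr ?d)"
    proof (cases "x = y")
      case False
      then have "0 < norm (x - y) powr ?d" by simp
      moreover have "norm (x - y) powr ?d \<le> \<rho> powr ?d"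
        using y \<epsilon> by (intro powr_mono2) auto
      ultimately show ?thesis by (simp add: field_simps mult_left_mono)
    qed simp
    then show "ennreal ((cmod (f x - f y))\<^sup>2)
        \<le> ennreal (\<rho> powr ?d) * ennreal ((cmod (f x - f y))\<^sup>2 / norm (x - y) powr ?d)"
      by (simp add: ennreal_mult'[symmetric] ennreal_leI)
  qed
  also have "\<dots> = ennreal (\<rho> powr ?d) * (\<integral>\<^sup>+y. ennreal ((cmod (f x - f y))\<^sup>2 / norm (x - y) powr ?d) \<partial>lebesgue_on E)"
    by (rule nn_integral_cmult) measurable
  also have "\<dots> \<le> ennreal (\<rho> powr ?d) * gagliardo \<Omega> \<epsilon> f x"
    unfolding gagliardo_def using E \<Omega> by (intro mult_left_mono nn_integral_lebesgue_on_mono) auto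
  finally show ?thesis .
qed

text \<open>Cauchy-Schwarz on E turns the local energy bound into an \<open>L\<^sup>1\<close> bound.
  Integrability of f on E comes out as well: y -> f x - f y is square integrable there, and E has
  finite measure.\<close>

lemma mean_deviation_le:
  fixes f :: "'a::euclidean_space \<Rightarrow> complex"
  assumes \<Omega>: "\<Omega> \<in> lmeasurable" and E: "E \<in> sets lebesgue" "E \<subseteq> \<Omega>" "E \<subseteq> ball x \<rho>"
    and \<epsilon>: "\<epsilon> > 0" and f: "f \<in> borel_measurable (lebesgue_on \<Omega>)"
    and fin: "gagliardo \<Omega> \<epsilon> f x < \<infinity>"
  shows "integrable (lebesgue_on E) f"
    and "(LINT y|lebesgue_on E. cmod (f x - f y))
      \<le> sqrt (measure lebesgue E) * sqrt (\<rho> powr (real DIM('a) + 2 * \<epsilon>) * enn2real (gagliardo \<Omega> \<epsilon> f x))"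
proof -
  let ?R = "\<rho> powr (real DIM('a) + 2 * \<epsilon>)"
  define G where "G = enn2real (gagliardo \<Omega> \<epsilon> f x)"
  have G: "gagliardo \<Omega> \<epsilon> f x = ennreal G" using fin by (simp add: G_def)
  have El: "E \<in> lmeasurable" using \<Omega> E fmeasurableI2 by blast
  interpret E: finite_measure "lebesgue_on E"
    using El by (rule finite_measure_lebesgue_on)
  have fE[measurable]: "f \<in> borel_measurable (lebesgue_on E)"
    by (rule lebesgue_on_subset_measurable[OF E(2) f])
  have le: "(\<integral>\<^sup>+y. ennreal ((cmod (f x - f y))\<^sup>2) \<partial>lebesgue_on E) \<le> ennreal (?R * G)"
    using local_energy_le[OF fmeasurableD[OF \<Omega>] E \<epsilon> f] by (simp add: G ennreal_mult')
  then have int: "integrable (lebesgue_on E) (\<lambda>y. (cmod (f x - f y))\<^sup>2)"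
    by (intro integrableI_nonneg le_less_trans[OF le]) auto
  have "ennreal (LINT y|lebesgue_on E. (cmod (f x - f y))\<^sup>2) \<le> ennreal (?R * G)"
    using le by (subst nn_integral_eq_integral[symmetric]) (use int in auto)
  then have le': "(LINT y|lebesgue_on E. (cmod (f x - f y))\<^sup>2) \<le> ?R * G"
    by (subst (asm) ennreal_le_iff) (auto simp: G_def)
  have i: "integrable (lebesgue_on E) (\<lambda>y. cmod (f x - f y))"
    by (rule E.integral_abs_le_sqrt(1)) (use int in auto)
  then have "integrable (lebesgue_on E) (\<lambda>y. f x - f y)"
    by (subst (asm) integrable_norm_iff) auto
  then have "integrable (lebesgue_on E) (\<lambda>y. f x - (f x - f y))"
    by (rule Bochner_Integration.integrable_diff[rotated]) simp
  then show "integrable (lebesgue_on E) f" by (simp only: diff_diff_eq2 add_diff_cancel_left')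
  have "(LINT y|lebesgue_on E. \<bar>cmod (f x - f y)\<bar>)
      \<le> sqrt (measure (lebesgue_on E) (space (lebesgue_on E))) * sqrt (LINT y|lebesgue_on E. (cmod (f x - f y))\<^sup>2)"
    by (rule E.integral_abs_le_sqrt(2)) (use int in auto)
  also have "\<dots> \<le> sqrt (measure lebesgue E) * sqrt (?R * G)"
    using le' E(1) by (intro mult_mono) (auto simp: measure_restrict_space)
  finally show "(LINT y|lebesgue_on E. cmod (f x - f y)) \<le> sqrt (measure lebesgue E) * sqrt (?R * enn2real (gagliardo \<Omega> \<epsilon> f x))"
    by (simp add: G_def)
qed

text \<open>The geometric input of both embeddings: means over
  \<open>ball x r \<inter> \<Omega>\<close> behave like means over full balls, up to and beyond the
  boundary.\<close>

definition measure_density :: "'a::euclidean_space set \<Rightarrow> real \<Rightarrow> real \<Rightarrow> bool" where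
  "measure_density \<Omega> c r0 \<longleftrightarrow> c > 0 \<and> r0 > 0 \<and>
     (\<forall>x\<in>\<Omega>. \<forall>r. 0 < r \<and> r \<le> r0 \<longrightarrow> c * r ^ DIM('a) \<le> measure lebesgue (ball x r \<inter> \<Omega>))"

text \<open>Average |f x| <= |f x - f y| + |f y| over y in E, the part of the ball inside \<Omega>,
  of measure m. Cauchy-Schwarz leaves a factor m^(-1/2) on the first mean and Hoelder a factor
  m^(-1/p) on the second; m >= c r^d turns both into powers of r, and r^(-d/2) cancels against the
  energy bound.\<close>

lemma pointwise_average_le:
  fixes f :: "'a::euclidean_space \<Rightarrow> complex"
  assumes \<Omega>: "\<Omega> \<in> lmeasurable" and dens: "measure_density \<Omega> c r0"
    and x: "x \<in> \<Omega>" and r: "0 < r" "r \<le> r0" and \<epsilon>: "\<epsilon> > 0" and p: "p > 1"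
    and f: "f \<in> borel_measurable (lebesgue_on \<Omega>)" and fp: "integrable (lebesgue_on \<Omega>) (\<lambda>x. cmod (f x) powr p)"
    and fin: "gagliardo \<Omega> \<epsilon> f x < \<infinity>"
  shows "cmod (f x) \<le> (c powr (-1/2) + c powr (-1/p)) *
    (r powr \<epsilon> * sqrt (enn2real (gagliardo \<Omega> \<epsilon> f x))
      + r powr (- real DIM('a) / p) * (LINT y|lebesgue_on \<Omega>. cmod (f y) powr p) powr (1 / p))"
proof -
  define E where "E = ball x r \<inter> \<Omega>"
  define m where "m = measure lebesgue E"
  define G where "G = enn2real (gagliardo \<Omega> \<epsilon> f x)"
  define S where "S = (LINT y|lebesgue_on \<Omega>. cmod (f y) powr p) powr (1 / p)"
  let ?d = "real DIM('a)"
  have E: "E \<in> sets lebesgue" "E \<subseteq> \<Omega>" "E \<subseteq> ball x r"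
    using \<Omega> by (auto simp: E_def)
  have c: "c > 0" using dens by (simp add: measure_density_def)
  have m_ge: "c * r powr ?d \<le> m"
    using dens x r by (simp add: measure_density_def m_def E_def powr_realpow)
  moreover have "0 < c * r powr ?d" using c r by simp
  ultimately have m: "m > 0" by linarith
  have El: "E \<in> lmeasurable" using \<Omega> E fmeasurableI2 by blast
  interpret E: finite_measure "lebesgue_on E"
    using El by (rule finite_measure_lebesgue_on)
  have mE: "measure (lebesgue_on E) (space (lebesgue_on E)) = m"
    using E(1) by (simp add: m_def measure_restrict_space)
  have fE[measurable]: "f \<in> borel_measurable (lebesgue_on E)"
    by (rule lebesgue_on_subset_measurable[OF E(2) f])
  note dev = mean_deviation_le[OF \<Omega> E \<epsilon> f fin]
  have fpE: "integrable (lebesgue_on E) (\<lambda>x. cmod (f x) powr p)"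
    and fpE_le: "(LINT y|lebesgue_on E. cmod (f y) powr p) \<le> (LINT y|lebesgue_on \<Omega>. cmod (f y) powr p)"
  proof -
    have nn: "(\<integral>\<^sup>+y. ennreal (cmod (f y) powr p) \<partial>lebesgue_on E) \<le> ennreal (LINT y|lebesgue_on \<Omega>. cmod (f y) powr p)"
      using nn_integral_lebesgue_on_mono[OF E(1) fmeasurableD[OF \<Omega>] E(2), of "\<lambda>y. ennreal (cmod (f y) powr p)"]
        nn_integral_eq_integral[OF fp] by simp
    then show i: "integrable (lebesgue_on E) (\<lambda>x. cmod (f x) powr p)"
      by (intro integrableI_nonneg le_less_trans[OF nn]) auto
    show "(LINT y|lebesgue_on E. cmod (f y) powr p) \<le> (LINT y|lebesgue_on \<Omega>. cmod (f y) powr p)"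
      using nn by (simp add: nn_integral_eq_integral[OF i])
  qed
  have "m * cmod (f x) = (LINT y|lebesgue_on E. cmod (f x))"
    using mE by simp
  also have "\<dots> \<le> (LINT y|lebesgue_on E. cmod (f x - f y) + cmod (f y))"
  proof (rule integral_mono)
    show "integrable (lebesgue_on E) (\<lambda>y. cmod (f x - f y) + cmod (f y))"
      using dev(1) by (intro Bochner_Integration.integrable_add integrable_norm Bochner_Integration.integrable_diff) auto
    show "cmod (f x) \<le> cmod (f x - f y) + cmod (f y)" for y
      using norm_triangle_ineq[of "f x - f y" "f y"] by simp
  qed simp
  also have "\<dots> = (LINT y|lebesgue_on E. cmod (f x - f y)) + (LINT y|lebesgue_on E. \<bar>cmod (f y)\<bar>)"
    using dev(1) by (subst Bochner_Integration.integral_add) (auto intro!: integrable_norm Bochner_Integration.integrable_diff)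
  also have "\<dots> \<le> sqrt m * sqrt (r powr (?d + 2 * \<epsilon>) * G) + m powr (1 - 1 / p) * S"
  proof (rule add_mono)
    show "(LINT y|lebesgue_on E. cmod (f x - f y)) \<le> sqrt m * sqrt (r powr (?d + 2 * \<epsilon>) * G)"
      using dev(2) by (simp add: m_def G_def)
    have "(LINT y|lebesgue_on E. \<bar>cmod (f y)\<bar>) \<le> m powr (1 - 1 / p) * (LINT y|lebesgue_on E. cmod (f y) powr p) powr (1 / p)"
      using E.integral_abs_le_powr(2)[OF p, of "\<lambda>y. cmod (f y)"] fpE mE by simp
    also have "\<dots> \<le> m powr (1 - 1 / p) * S"
      unfolding S_def using p fpE_le by (intro mult_left_mono powr_mono2) auto
    finally show "(LINT y|lebesgue_on E. \<bar>cmod (f y)\<bar>) \<le> m powr (1 - 1 / p) * S" .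
  qed
  finally have "m * cmod (f x) \<le> m * (m powr (-1/2) * sqrt (r powr (?d + 2 * \<epsilon>) * G) + m powr (-1/p) * S)"
  proof -
    have "m powr (1/2) = m powr (1 + (-1/2))" by simp
    also have "\<dots> = m * m powr (-1/2)" using m by (subst powr_add) simp
    finally have 1: "sqrt m = m * m powr (-1/2)" using m by (simp add: powr_half_sqrt)
    have "m powr (1 - 1/p) = m powr (1 + (-1/p))" by simp
    also have "\<dots> = m * m powr (-1/p)" using m by (subst powr_add) simp
    finally have 2: "m powr (1 - 1/p) = m * m powr (-1/p)" .
    assume "m * cmod (f x) \<le> sqrt m * sqrt (r powr (?d + 2 * \<epsilon>) * G) + m powr (1 - 1 / p) * S"
    then show ?thesis unfolding 1 2 by (simp add: algebra_simps)
  qed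
  then have *: "cmod (f x) \<le> m powr (-1/2) * sqrt (r powr (?d + 2 * \<epsilon>) * G) + m powr (-1/p) * S"
    using m by simp
  have m_powr: "m powr (-s) \<le> c powr (-s) * r powr (- ?d * s)" if "s > 0" for s
  proof -
    have "m powr (-s) \<le> (c * r powr ?d) powr (-s)"
      using m_ge \<open>0 < c * r powr ?d\<close> that by (intro powr_mono2') auto
    also have "\<dots> = c powr (-s) * r powr (- ?d * s)"
      using c by (simp add: powr_mult powr_powr)
    finally show ?thesis .
  qed
  have "sqrt (r powr (?d + 2 * \<epsilon>) * G) = r powr (?d / 2 + \<epsilon>) * sqrt G"
  proof -
    have "sqrt (r powr (?d + 2 * \<epsilon>)) = (r powr (?d + 2 * \<epsilon>)) powr (1/2)"
      by (rule powr_half_sqrt[symmetric]) simp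
    also have "\<dots> = r powr (?d / 2 + \<epsilon>)"
      by (simp add: powr_powr add_divide_distrib)
    finally show ?thesis by (simp add: real_sqrt_mult)
  qed
  then have "m powr (-1/2) * sqrt (r powr (?d + 2 * \<epsilon>) * G)
      \<le> (c powr (-1/2) * r powr (- ?d / 2)) * (r powr (?d / 2 + \<epsilon>) * sqrt G)"
    using m_powr[of "1/2"] by (auto intro!: mult_right_mono simp: G_def)
  also have "\<dots> = c powr (-1/2) * (r powr (- ?d / 2 + (?d / 2 + \<epsilon>)) * sqrt G)"
    unfolding powr_add by (simp only: mult_ac)
  also have "- ?d / 2 + (?d / 2 + \<epsilon>) = \<epsilon>" by (simp add: field_simps)
  finally have 1: "m powr (-1/2) * sqrt (r powr (?d + 2 * \<epsilon>) * G) \<le> c powr (-1/2) * (r powr \<epsilon> * sqrt G)" .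
  have 2: "m powr (-1/p) * S \<le> c powr (-1/p) * (r powr (- ?d / p) * S)"
  proof -
    have "m powr (-(1/p)) * S \<le> c powr (-(1/p)) * r powr (- ?d * (1/p)) * S"
      using p by (intro mult_right_mono m_powr) (auto simp: S_def)
    then show ?thesis by (simp add: mult.assoc)
  qed
  have "cmod (f x) \<le> c powr (-1/2) * (r powr \<epsilon> * sqrt G) + c powr (-1/p) * (r powr (- ?d / p) * S)"
    using * 1 2 by linarith
  also have "\<dots> \<le> (c powr (-1/2) + c powr (-1/p)) * (r powr \<epsilon> * sqrt G + r powr (- ?d / p) * S)"
  proof -
    have "a * X + b * Y \<le> (a + b) * (X + Y)" if "a \<ge> 0" "b \<ge> 0" "X \<ge> 0" "Y \<ge> 0" for a b X Y :: real
      using that by (simp add: algebra_simps)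
    then show ?thesis by (simp add: S_def G_def)
  qed
  finally show ?thesis by (simp add: G_def S_def)
qed

text \<open>The terms r^a T and r^-b S balance at r = (S/T)^(1/(a+b)), where both equal T^(b/(a+b))
  S^(a/(a+b)). If this radius is larger than r0, then \<open>large\<close> is used instead: r0^a T
  is still below the balanced value, and the price is the lower order term with L. For T = 0 no
  balancing radius exists, and \<open>large\<close> suffices.\<close>

lemma interpolate_radius:
  fixes a b A L S T r0 y :: real
  assumes ab: "a > 0" "b > 0" and A: "A \<ge> 0" and r0: "r0 > 0" and ST: "S > 0" "T \<ge> 0" "L \<ge> 0"
    and small: "\<And>r. 0 < r \<Longrightarrow> r \<le> r0 \<Longrightarrow> y \<le> A * (r powr a * T + r powr (- b) * S)"
    and large: "y \<le> A * (r0 powr a * T + r0 powr (- (a + b)) * L)"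
  shows "y \<le> 2 * A * (T powr (b / (a + b)) * S powr (a / (a + b))) + A * (r0 powr (- (a + b)) * L)"
proof (cases "T = 0")
  case True
  then show ?thesis using large by simp
next
  case False
  then have T: "T > 0" using ST by simp
  define \<theta> where "\<theta> = a / (a + b)"
  have \<theta>: "b / (a + b) = 1 - \<theta>" using ab by (simp add: \<theta>_def field_simps)
  define X where "X = T powr (1 - \<theta>) * S powr \<theta>"
  define r where "r = (S / T) powr (1 / (a + b))"
  have r: "r > 0" using ST T by (simp add: r_def)
  have ra: "r powr a * T = X"
  proof -
    have "r powr a = (S / T) powr \<theta>" by (simp add: r_def powr_powr \<theta>_def)
    also have "\<dots> = S powr \<theta> * T powr (- \<theta>)"
      using ST T by (simp add: powr_divide powr_minus_divide)
    finally have "r powr a * T = S powr \<theta> * (T powr (- \<theta>) * T powr 1)" using T by simp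
    also have "T powr (- \<theta>) * T powr 1 = T powr (1 - \<theta>)"
      by (subst powr_add[symmetric]) simp
    finally show ?thesis by (simp add: X_def mult.commute)
  qed
  have rb: "r powr (- b) * S = X"
  proof -
    have "r powr (- b) = (S / T) powr (- (1 - \<theta>))" by (simp add: r_def powr_powr \<theta>[symmetric])
    also have "\<dots> = S powr (- (1 - \<theta>)) * T powr (1 - \<theta>)"
    proof -
      have "inverse (T powr (- (1 - \<theta>))) = T powr (1 - \<theta>)"
        by (simp only: powr_minus inverse_inverse_eq)
      moreover have "(S / T) powr (- (1 - \<theta>)) = S powr (- (1 - \<theta>)) / T powr (- (1 - \<theta>))"
        by (rule powr_divide)
      ultimately show ?thesis by (simp only: divide_inverse)
    qed
    finally have "r powr (- b) * S = T powr (1 - \<theta>) * (S powr (- (1 - \<theta>)) * S powr 1)" using ST by simp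
    also have "S powr (- (1 - \<theta>)) * S powr 1 = S powr \<theta>"
      by (subst powr_add[symmetric]) simp
    finally show ?thesis by (simp add: X_def)
  qed
  have X: "X \<ge> 0" by (simp add: X_def)
  have LL: "0 \<le> r0 powr (- (a + b)) * L" using ST by simp
  have "y \<le> 2 * A * X + A * (r0 powr (- (a + b)) * L)"
  proof (cases "r \<le> r0")
    case True
    have "y \<le> A * (X + X)" using small[OF r True] by (simp only: ra rb)
    moreover have "0 \<le> A * (r0 powr (- (a + b)) * L)" using A LL by (rule mult_nonneg_nonneg)
    ultimately show ?thesis by (simp add: algebra_simps)
  next
    case False
    then have "r0 powr a * T \<le> r powr a * T"
      using r0 ab T by (intro mult_right_mono powr_mono2) auto
    then have "A * (r0 powr a * T) \<le> A * X" unfolding ra using A by (rule mult_left_mono)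
    moreover have "0 \<le> A * X" using A X by (rule mult_nonneg_nonneg)
    ultimately show ?thesis using large by (simp add: distrib_left)
  qed
  then show ?thesis by (simp add: X_def \<theta> flip: \<theta>_def)
qed

lemma gagliardo_mono:
  assumes "\<And>y. norm (g x - g y) \<le> norm (f x - f y)"
  shows "gagliardo \<Omega> \<epsilon> g x \<le> gagliardo \<Omega> \<epsilon> f x"
  unfolding gagliardo_def
  by (intro nn_integral_mono ennreal_leI divide_right_mono power_mono assms) auto

text \<open>Boundedness makes the critical norm finite a priori, so that it can be divided out of the
  interpolated pointwise bound.\<close>

lemma sobolev_bounded:
  fixes \<Omega> :: "'a::euclidean_space set"
  assumes \<Omega>: "\<Omega> \<in> lmeasurable" and dens: "measure_density \<Omega> c r0"
    and \<epsilon>: "0 < \<epsilon>" "2 * \<epsilon> < real DIM('a)" and p: "p = 2 * real DIM('a) / (real DIM('a) - 2 * \<epsilon>)"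
  shows "\<exists>C>0. \<forall>f :: 'a \<Rightarrow> complex. f \<in> borel_measurable (lebesgue_on \<Omega>) \<longrightarrow> bounded (range f) \<longrightarrow>
      (\<integral>\<^sup>+x. gagliardo \<Omega> \<epsilon> f x \<partial>lebesgue_on \<Omega>) < \<infinity> \<longrightarrow>
      (LINT x|lebesgue_on \<Omega>. cmod (f x) powr p) powr (1 / p)
        \<le> C * sqrt ((LINT x|lebesgue_on \<Omega>. (cmod (f x))\<^sup>2) + enn2real (\<integral>\<^sup>+x. gagliardo \<Omega> \<epsilon> f x \<partial>lebesgue_on \<Omega>))"
proof -
  let ?M = "lebesgue_on \<Omega>"
  interpret finite_measure ?M using \<Omega> by (rule finite_measure_lebesgue_on)
  define d where "d = real DIM('a)"
  \<comment> \<open>With d the dimension, a = \<epsilon>, b = d/p and a + b = d/2 are the exponents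
    of r in the pointwise bound for p and for 2. They give b p/(a+b) = 2 and a p/(a+b) = p - 2, so
    the p-th power of the interpolated bound contains \<open>D x\<close> to the first power and S to
    the power p - 2.\<close>
  define a where "a = \<epsilon>"
  define b where "b = d / 2 - \<epsilon>"
  have ab: "a > 0" "b > 0" "a + b = d / 2" using \<epsilon> by (simp_all add: a_def b_def d_def)
  have pab: "p = 2 * (a + b) / b"
    using \<epsilon> by (simp add: p a_def b_def d_def field_simps)
  have p2: "p > 2" using ab by (simp add: pab field_simps)
  have "p = d / b" unfolding pab ab(3) by simp
  moreover have "d > 0" by (simp add: d_def)
  ultimately have dp: "d / p = b" using ab by simp
  have e1: "b / (a + b) * p = 2" and e2: "a / (a + b) * p = p - 2"
  proof -
    have s: "b / s * (2 * s / b) = 2" "a / s * (2 * s / b) = 2 * a / b" if "s \<noteq> 0" for s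
      using that ab(2) by simp_all
    have "p - 2 = 2 * a / b" using ab(2) by (simp add: pab field_simps)
    then show "b / (a + b) * p = 2" "a / (a + b) * p = p - 2"
      using s[of "a + b"] ab(1,2) by (auto simp add: pab)
  qed
  have e12: "b * p / (a + b) = 2" "a * p / (a + b) = p - 2" using e1 e2 by simp_all
  have r0: "r0 > 0" using dens by (simp add: measure_density_def)
  have e3: "r0 powr (- d / 2) = r0 powr (- (a + b))" by (simp add: ab(3))
  \<comment> \<open>One constant for two uses of the pointwise bound: with exponent p at small radii
    and with exponent 2 at the radius r0.\<close>
  define A where "A = max (c powr (-1/2) + c powr (-1/p)) (c powr (-1/2) + c powr (-1/2))"
  have A: "A \<ge> 0" by (simp add: A_def le_max_iff_disj)
  define \<mu> where "\<mu> = measure ?M (space ?M)"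
  define K1 where "K1 = 2 powr p * (2 * A) powr p"
  define K2 where "K2 = 2 powr p * (A * r0 powr (- (a + b))) powr p * \<mu>"
  have K: "K1 \<ge> 0" "K2 \<ge> 0" by (simp_all add: K1_def K2_def \<mu>_def)
  define C where "C = 1 + K1 + K2"
  have C: "C \<ge> 1" using K by (simp add: C_def)
  have "(LINT x|?M. cmod (f x) powr p) powr (1 / p)
        \<le> C * sqrt ((LINT x|?M. (cmod (f x))\<^sup>2) + enn2real (\<integral>\<^sup>+x. gagliardo \<Omega> \<epsilon> f x \<partial>?M))"
    if f[measurable]: "f \<in> borel_measurable ?M" and bdd: "bounded (range f)"
      and fin: "(\<integral>\<^sup>+x. gagliardo \<Omega> \<epsilon> f x \<partial>?M) < \<infinity>" for f :: "'a \<Rightarrow> complex"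
  proof -
    obtain B where B: "\<And>x. cmod (f x) \<le> B" using bdd by (auto simp: bounded_iff)
    have int_powr: "integrable ?M (\<lambda>x. cmod (f x) powr s)" if "s > 0" for s
    proof (rule integrable_const_bound[where B = "B powr s"])
      show "AE x in ?M. norm (cmod (f x) powr s) \<le> B powr s"
        using B that by (auto intro!: AE_I2 powr_mono2)
    qed measurable
    define G where "G = enn2real (\<integral>\<^sup>+x. gagliardo \<Omega> \<epsilon> f x \<partial>?M)"
    define Sp where "Sp = (LINT x|?M. cmod (f x) powr p)"
    define S where "S = Sp powr (1 / p)"
    define L where "L = (LINT x|?M. cmod (f x) powr 2) powr (1 / 2)"
    define W where "W = sqrt ((LINT x|?M. (cmod (f x))\<^sup>2) + G)"
    have sq: "cmod z powr 2 = (cmod z)\<^sup>2" for z by (simp add: powr_numeral)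
    have L2: "L = sqrt (LINT x|?M. (cmod (f x))\<^sup>2)"
      by (simp add: L_def sq powr_half_sqrt)
    have nonneg: "Sp \<ge> 0" "S \<ge> 0" "L \<ge> 0" "G \<ge> 0" "W \<ge> 0"
      by (simp_all add: Sp_def S_def L_def G_def W_def)
    have LW: "L \<le> W" by (simp add: L2 W_def G_def)
    have GW: "G \<le> W\<^sup>2" by (simp add: W_def G_def)
    have Sp: "Sp = S powr p" using nonneg p2 by (simp add: S_def powr_powr)
    have "S \<le> C * W"
    proof (cases "S = 0")
      case False
      then have S: "S > 0" using nonneg by simp
      define D where "D x = enn2real (gagliardo \<Omega> \<epsilon> f x)" for x
      have ae: "AE x in ?M. gagliardo \<Omega> \<epsilon> f x \<noteq> \<infinity>"
        using \<Omega> fin by (intro nn_integral_noteq_infinite) auto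
      have D_meas[measurable]: "D \<in> borel_measurable ?M" 
      unfolding D_def using borel_measurable_gagliardo[OF \<Omega> f] by (rule borel_measurable_enn2real)
      have nnD: "(\<integral>\<^sup>+x. ennreal (D x) \<partial>?M) = (\<integral>\<^sup>+x. gagliardo \<Omega> \<epsilon> f x \<partial>?M)"
        using ae by (intro nn_integral_cong_AE) (auto simp: D_def ennreal_enn2real_if)
      have D_int: "integrable ?M D"
        using fin nnD by (intro integrableI_nonneg D_meas) (auto simp: D_def)
      have D_G: "(LINT x|?M. D x) = G"
        unfolding G_def nnD[symmetric] by (rule integral_eq_nn_integral[OF D_meas]) (auto simp: D_def)
      have pw: "cmod (f x) powr p \<le> K1 * (S powr (p - 2) * D x) + 2 powr p * (A * r0 powr (- (a + b))) powr p * L powr p"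
        if x: "x \<in> \<Omega>" "gagliardo \<Omega> \<epsilon> f x \<noteq> \<infinity>" for x
      proof -
        have fx: "gagliardo \<Omega> \<epsilon> f x < \<infinity>" using x(2) by (simp add: less_top)
        have "cmod (f x) \<le> 2 * A * (sqrt (D x) powr (b / (a + b)) * S powr (a / (a + b))) + A * (r0 powr (- (a + b)) * L)"
        proof (rule interpolate_radius[OF ab(1,2) A r0 S _ nonneg(3)])
          fix r assume r: "0 < r" "r \<le> r0"
          have "cmod (f x) \<le> (c powr (-1/2) + c powr (-1/p)) * (r powr \<epsilon> * sqrt (D x) + r powr (- d / p) * S)"
            using pointwise_average_le[OF \<Omega> dens x(1) r \<epsilon>(1) _ f int_powr fx, of p] p2
            by (simp add: D_def S_def Sp_def d_def)
          also have "\<dots> \<le> A * (r powr \<epsilon> * sqrt (D x) + r powr (- d / p) * S)"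
            using nonneg by (intro mult_right_mono) (auto simp: A_def D_def)
          finally show "cmod (f x) \<le> A * (r powr a * sqrt (D x) + r powr (- b) * S)"
            using dp by (simp add: a_def)
        next
          have "cmod (f x) \<le> (c powr (-1/2) + c powr (-1/2)) * (r0 powr \<epsilon> * sqrt (D x) + r0 powr (- d / 2) * L)"
            using pointwise_average_le[OF \<Omega> dens x(1) r0 order_refl \<epsilon>(1) _ f int_powr fx, of 2]
            by (simp add: D_def L_def d_def)
          also have "\<dots> \<le> A * (r0 powr \<epsilon> * sqrt (D x) + r0 powr (- d / 2) * L)"
            using nonneg by (intro mult_right_mono) (auto simp: A_def D_def)
          finally show "cmod (f x) \<le> A * (r0 powr a * sqrt (D x) + r0 powr (- (a + b)) * L)"
            by (simp only: e3 a_def)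
        qed (simp add: D_def)
        then have "cmod (f x) powr p \<le> (2 * A * (sqrt (D x) powr (b / (a + b)) * S powr (a / (a + b))) + A * (r0 powr (- (a + b)) * L)) powr p"
          using p2 by (intro powr_mono2) auto
        also have "\<dots> \<le> 2 powr p * ((2 * A * (sqrt (D x) powr (b / (a + b)) * S powr (a / (a + b)))) powr p
            + (A * (r0 powr (- (a + b)) * L)) powr p)"
          using p2 A nonneg by (intro powr_sum_le) auto
        also have "(2 * A * (sqrt (D x) powr (b / (a + b)) * S powr (a / (a + b)))) powr p
            = (2 * A) powr p * (S powr (p - 2) * D x)"
        proof -
          have "sqrt (D x) powr 2 = D x" by (simp add: D_def powr_numeral)
          then show ?thesis
            using A nonneg by (simp add: powr_mult powr_powr e12 mult.commute)
        qed
        also have "(A * (r0 powr (- (a + b)) * L)) powr p = (A * r0 powr (- (a + b))) powr p * L powr p"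
          using A nonneg by (simp add: powr_mult mult.assoc)
        finally show ?thesis by (simp add: K1_def algebra_simps)
      qed
      have "S powr p \<le> (LINT x|?M. K1 * (S powr (p - 2) * D x) + 2 powr p * (A * r0 powr (- (a + b))) powr p * L powr p)"
        unfolding Sp[symmetric] Sp_def
      proof (rule integral_mono_AE)
        show "AE x in ?M. cmod (f x) powr p \<le> K1 * (S powr (p - 2) * D x) + 2 powr p * (A * r0 powr (- (a + b))) powr p * L powr p"
          using ae AE_space by eventually_elim (use pw in auto)
      qed (use D_int int_powr p2 in auto)
      also have "\<dots> = K1 * (S powr (p - 2) * G) + K2 * L powr p"
        using D_int by (simp add: D_G K2_def \<mu>_def mult_ac)
      also have "\<dots> \<le> K1 * (S powr (p - 2) * W\<^sup>2) + K2 * W powr p"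
        using K GW LW nonneg p2 by (intro add_mono mult_left_mono powr_mono2) auto
      finally have main: "S powr p \<le> K1 * (S powr (p - 2) * W\<^sup>2) + K2 * W powr p" .
      show ?thesis
      \<comment> \<open>If S <= W, then C >= 1 finishes. Otherwise W^p <= S^(p-2) W^2, so the K2
        term has the shape of the K1 term and S^(p-2) cancels; the last step uses K1 + K2 <= C <=
        C^2.\<close>
      proof (cases "S \<le> W")
        case True
        then show ?thesis using C nonneg mult_right_mono[of 1 C W] by simp
      next
        case False
        then have WS: "W \<le> S" by simp
        have "W powr p = W powr (p - 2) * W powr 2" by (simp flip: powr_add)
        also have "\<dots> \<le> S powr (p - 2) * W\<^sup>2"
          using WS nonneg p2 by (intro mult_mono powr_mono2) (auto simp: powr_numeral)
        finally have "S powr p \<le> (K1 + K2) * (S powr (p - 2) * W\<^sup>2)"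
          using main mult_left_mono[of "W powr p" "S powr (p - 2) * W\<^sup>2" K2] K by (simp add: distrib_right)
        moreover have "S powr p = S powr (p - 2) * S\<^sup>2"
        proof -
          have "S powr p = S powr (p - 2 + 2)" by simp
          then show ?thesis using S by (simp only: powr_add powr_numeral)
        qed
        ultimately have "S powr (p - 2) * S\<^sup>2 \<le> S powr (p - 2) * ((K1 + K2) * W\<^sup>2)"
          by (simp add: mult_ac)
        then have "S\<^sup>2 \<le> (K1 + K2) * W\<^sup>2" using S by simp
        also have "\<dots> \<le> C\<^sup>2 * W\<^sup>2"
        proof (rule mult_right_mono)
          have "K1 + K2 \<le> C" by (simp add: C_def)
          also have "C \<le> C\<^sup>2" using C by (simp add: power2_eq_square)
          finally show "K1 + K2 \<le> C\<^sup>2" .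
        qed simp
        finally have "S\<^sup>2 \<le> (C * W)\<^sup>2" by (simp add: power_mult_distrib)
        then show ?thesis using C nonneg by (intro power2_le_imp_le[of S]) auto
      qed
    qed (use C nonneg in simp)
    then show ?thesis by (simp add: S_def Sp_def W_def G_def)
  qed
  then show ?thesis using C by (intro exI[of _ C]) auto
qed

text \<open>The truncations min(|f|, k) are bounded, and being images of f under 1-Lipschitz maps
  that do not increase the modulus they raise neither the seminorm nor the \<open>L\<^sup>2\<close>
  norm. The constant of \<open>sobolev_bounded\<close> is independent of k, so Fatou's lemma
  transfers the bound to f.\<close>

theorem sobolev_embedding:
  fixes \<Omega> :: "'a::euclidean_space set"
  assumes \<Omega>: "\<Omega> \<in> lmeasurable" and dens: "measure_density \<Omega> c r0"
    and \<epsilon>: "0 < \<epsilon>" "2 * \<epsilon> < real DIM('a)" and p: "p = 2 * real DIM('a) / (real DIM('a) - 2 * \<epsilon>)"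
  shows "\<exists>C>0. \<forall>f :: 'a \<Rightarrow> complex. f \<in> borel_measurable (lebesgue_on \<Omega>) \<longrightarrow>
      integrable (lebesgue_on \<Omega>) (\<lambda>x. (cmod (f x))\<^sup>2) \<longrightarrow>
      (\<integral>\<^sup>+x. gagliardo \<Omega> \<epsilon> f x \<partial>lebesgue_on \<Omega>) < \<infinity> \<longrightarrow>
      integrable (lebesgue_on \<Omega>) (\<lambda>x. cmod (f x) powr p) \<and>
      (LINT x|lebesgue_on \<Omega>. cmod (f x) powr p) powr (1 / p)
        \<le> C * sqrt ((LINT x|lebesgue_on \<Omega>. (cmod (f x))\<^sup>2) + enn2real (\<integral>\<^sup>+x. gagliardo \<Omega> \<epsilon> f x \<partial>lebesgue_on \<Omega>))"
proof -
  let ?M = "lebesgue_on \<Omega>"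
  have p0: "p > 0" using \<epsilon> by (simp add: p)
  obtain C where C: "C > 0" and bdd: "\<And>f :: 'a \<Rightarrow> complex. f \<in> borel_measurable ?M \<Longrightarrow> bounded (range f) \<Longrightarrow>
      (\<integral>\<^sup>+x. gagliardo \<Omega> \<epsilon> f x \<partial>?M) < \<infinity> \<Longrightarrow> (LINT x|?M. cmod (f x) powr p) powr (1 / p)
        \<le> C * sqrt ((LINT x|?M. (cmod (f x))\<^sup>2) + enn2real (\<integral>\<^sup>+x. gagliardo \<Omega> \<epsilon> f x \<partial>?M))"
    using sobolev_bounded[OF \<Omega> dens \<epsilon> p] by blast
  have "integrable ?M (\<lambda>x. cmod (f x) powr p) \<and> (LINT x|?M. cmod (f x) powr p) powr (1 / p)
        \<le> C * sqrt ((LINT x|?M. (cmod (f x))\<^sup>2) + enn2real (\<integral>\<^sup>+x. gagliardo \<Omega> \<epsilon> f x \<partial>?M))"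
    if f[measurable]: "f \<in> borel_measurable ?M" and f2: "integrable ?M (\<lambda>x. (cmod (f x))\<^sup>2)"
      and fin: "(\<integral>\<^sup>+x. gagliardo \<Omega> \<epsilon> f x \<partial>?M) < \<infinity>" for f :: "'a \<Rightarrow> complex"
  proof -
    interpret finite_measure ?M using \<Omega> by (rule finite_measure_lebesgue_on)
    define W where "W = sqrt ((LINT x|?M. (cmod (f x))\<^sup>2) + enn2real (\<integral>\<^sup>+x. gagliardo \<Omega> \<epsilon> f x \<partial>?M))"
    have W: "W \<ge> 0" by (simp add: W_def)
    define g :: "nat \<Rightarrow> 'a \<Rightarrow> complex" where "g k x = of_real (min (cmod (f x)) (real k))" for k x
    have g_abs: "cmod (g k x) = min (cmod (f x)) (real k)" for k x by (simp add: g_def)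
    have g_meas[measurable]: "g k \<in> borel_measurable ?M" for k
      unfolding g_def by measurable
    have g_int: "integrable ?M (\<lambda>x. cmod (g k x) powr p)" for k
    proof (rule integrable_const_bound[where B = "real k powr p"])
      show "AE x in ?M. norm (cmod (g k x) powr p) \<le> real k powr p"
        using p0 by (auto intro!: AE_I2 powr_mono2 simp: g_abs)
    qed measurable
    have bound: "(LINT x|?M. cmod (g k x) powr p) \<le> (C * W) powr p" for k
    proof -
      have gag: "gagliardo \<Omega> \<epsilon> (g k) x \<le> gagliardo \<Omega> \<epsilon> f x" for x
      proof (rule gagliardo_mono)
        fix y
        have "cmod (g k x - g k y) = \<bar>min (cmod (f x)) (real k) - min (cmod (f y)) (real k)\<bar>"
          unfolding g_def by (simp flip: of_real_diff)
        also have "\<dots> \<le> \<bar>cmod (f x) - cmod (f y)\<bar>" by (auto simp: min_def)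
        also have "\<dots> \<le> cmod (f x - f y)" by (rule norm_triangle_ineq3)
        finally show "cmod (g k x - g k y) \<le> cmod (f x - f y)" .
      qed
      then have nn: "(\<integral>\<^sup>+x. gagliardo \<Omega> \<epsilon> (g k) x \<partial>?M) \<le> (\<integral>\<^sup>+x. gagliardo \<Omega> \<epsilon> f x \<partial>?M)"
        by (intro nn_integral_mono)
      have "(LINT x|?M. (cmod (g k x))\<^sup>2) \<le> (LINT x|?M. (cmod (f x))\<^sup>2)"
      proof (rule integral_mono)
        show "integrable ?M (\<lambda>x. (cmod (g k x))\<^sup>2)"
          by (rule Bochner_Integration.integrable_bound[OF f2]) (auto simp: g_abs intro!: power_mono)
      qed (auto simp: g_abs intro!: power_mono f2)
      moreover have "enn2real (\<integral>\<^sup>+x. gagliardo \<Omega> \<epsilon> (g k) x \<partial>?M) \<le> enn2real (\<integral>\<^sup>+x. gagliardo \<Omega> \<epsilon> f x \<partial>?M)"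
        using nn fin by (intro enn2real_mono) auto
      ultimately have "C * sqrt ((LINT x|?M. (cmod (g k x))\<^sup>2) + enn2real (\<integral>\<^sup>+x. gagliardo \<Omega> \<epsilon> (g k) x \<partial>?M)) \<le> C * W"
        unfolding W_def using C by (intro mult_left_mono real_sqrt_le_mono add_mono) auto
      moreover have "bounded (range (g k))"
        by (rule boundedI[where B = "real k"]) (auto simp: g_abs)
      ultimately have "(LINT x|?M. cmod (g k x) powr p) powr (1 / p) \<le> C * W"
        using bdd[OF g_meas, of k] nn fin by (meson le_less_trans order_trans)
      then have "((LINT x|?M. cmod (g k x) powr p) powr (1 / p)) powr p \<le> (C * W) powr p"
        using p0 by (intro powr_mono2) auto
      then show ?thesis using p0 by (simp add: powr_powr)
    qed
    have lim: "(\<lambda>k. ennreal (cmod (g k x) powr p)) \<longlonglongrightarrow> ennreal (cmod (f x) powr p)" for x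
    proof (rule tendsto_eventually)
      obtain n where n: "cmod (f x) \<le> real n" using real_arch_simple by blast
      show "\<forall>\<^sub>F k in sequentially. ennreal (cmod (g k x) powr p) = ennreal (cmod (f x) powr p)"
        using eventually_ge_at_top[of n]
      proof eventually_elim
        case (elim k)
        then have "cmod (f x) \<le> real k" using n by linarith
        then show ?case by (simp add: g_abs min_def)
      qed
    qed
    have "(\<integral>\<^sup>+x. ennreal (cmod (f x) powr p) \<partial>?M) = (\<integral>\<^sup>+x. liminf (\<lambda>k. ennreal (cmod (g k x) powr p)) \<partial>?M)"
      by (intro nn_integral_cong lim_imp_Liminf[symmetric] lim) auto
    also have "\<dots> \<le> liminf (\<lambda>k. \<integral>\<^sup>+x. ennreal (cmod (g k x) powr p) \<partial>?M)"
      by (rule nn_integral_liminf) simp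
    also have "\<dots> \<le> ennreal ((C * W) powr p)"
      by (rule Liminf_le) (use bound in \<open>auto simp: nn_integral_eq_integral[OF g_int] ennreal_leI\<close>)
    finally have nn: "(\<integral>\<^sup>+x. ennreal (cmod (f x) powr p) \<partial>?M) \<le> ennreal ((C * W) powr p)" .
    have int: "integrable ?M (\<lambda>x. cmod (f x) powr p)"
      by (intro integrableI_nonneg le_less_trans[OF nn]) auto
    have "(LINT x|?M. cmod (f x) powr p) \<le> (C * W) powr p"
      using nn by (simp add: nn_integral_eq_integral[OF int])
    then have "(LINT x|?M. cmod (f x) powr p) powr (1 / p) \<le> ((C * W) powr p) powr (1 / p)"
      using p0 by (intro powr_mono2) auto
    then show ?thesis using int p0 C W by (simp add: powr_powr W_def)
  qed
  then show ?thesis using C by blast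
qed

text \<open>Compactness in quantitative form: up to a small multiple of the energy, the
  \<open>L\<^sup>2\<close> norm is controlled by finitely many linear functionals. Each f x is
  compared with the mean of f over the part in \<Omega> of a ball about a nearby net point; the
  error is of order r^(2\<epsilon>) times the energy.\<close>

theorem rellich_estimate:
  fixes \<Omega> :: "'a::euclidean_space set"
  assumes \<Omega>: "open \<Omega>" "bounded \<Omega>" and dens: "measure_density \<Omega> c r0"
    and \<epsilon>: "0 < \<epsilon>" and e: "0 < e"
  shows "\<exists>\<E> C. finite \<E> \<and> C \<ge> 0 \<and> (\<forall>E\<in>\<E>. E \<in> sets lebesgue \<and> E \<subseteq> \<Omega>) \<and>
    (\<forall>f :: 'a \<Rightarrow> complex. f \<in> borel_measurable (lebesgue_on \<Omega>) \<longrightarrow>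
      integrable (lebesgue_on \<Omega>) (\<lambda>x. (cmod (f x))\<^sup>2) \<longrightarrow>
      (\<integral>\<^sup>+x. gagliardo \<Omega> \<epsilon> f x \<partial>lebesgue_on \<Omega>) < \<infinity> \<longrightarrow>
      (LINT x|lebesgue_on \<Omega>. (cmod (f x))\<^sup>2) \<le> e * enn2real (\<integral>\<^sup>+x. gagliardo \<Omega> \<epsilon> f x \<partial>lebesgue_on \<Omega>)
         + C * (\<Sum>E\<in>\<E>. (cmod (LINT x|lebesgue_on E. f x))\<^sup>2))"
proof -
  let ?M = "lebesgue_on \<Omega>"
  define d where "d = real DIM('a)"
  have \<Omega>l: "\<Omega> \<in> lmeasurable" using \<Omega> by (simp add: bounded_set_imp_lmeasurable)
  interpret finite_measure ?M using \<Omega>l by (rule finite_measure_lebesgue_on)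
  have c: "c > 0" and r0: "r0 > 0" using dens by (auto simp: measure_density_def)
  \<comment> \<open>The factor 2 comes from (s+t)^2 <= 2 s^2 + 2 t^2, the power of 2 from enclosing
    a net ball of radius r in the ball of radius 2r about x, and 1/c from the density bound. The
    radius is then chosen so that K r^(2\<epsilon>) <= e.\<close>
  define K where "K = 2 * 2 powr (d + 2 * \<epsilon>) / c"
  have K: "K > 0" using c by (simp add: K_def)
  define r where "r = min r0 ((e / K) powr (1 / (2 * \<epsilon>)))"
  have r: "r > 0" "r \<le> r0" using r0 e K by (simp_all add: r_def)
  have "r powr (2 * \<epsilon>) \<le> ((e / K) powr (1 / (2 * \<epsilon>))) powr (2 * \<epsilon>)"
    using r \<epsilon> by (intro powr_mono2) (auto simp: r_def)
  then have re: "K * r powr (2 * \<epsilon>) \<le> e"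
    using e K \<epsilon> by (simp add: powr_powr field_simps)
  have "compact (closure \<Omega>)" using \<Omega> by (simp add: compact_closure)
  \<comment> \<open>The density bound is available only at centres inside \<Omega>; balls about such
    centres still cover the compact closure.\<close>
  moreover have "closure \<Omega> \<subseteq> (\<Union>z\<in>\<Omega>. ball z r)"
  proof
    fix y assume "y \<in> closure \<Omega>"
    then obtain z where "z \<in> \<Omega>" "dist z y < r" using r(1) closure_approachable by blast
    then show "y \<in> (\<Union>z\<in>\<Omega>. ball z r)" by auto
  qed
  ultimately obtain F where F: "F \<subseteq> \<Omega>" "finite F" "closure \<Omega> \<subseteq> (\<Union>z\<in>F. ball z r)"
    using compactE_image[of "closure \<Omega>" \<Omega> "\<lambda>z. ball z r"] by auto
  define E where "E z = ball z r \<inter> \<Omega>" for z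
  have E: "E z \<in> sets lebesgue" "E z \<subseteq> \<Omega>" for z using \<Omega> by (auto simp: E_def)
  have El: "E z \<in> lmeasurable" for z using \<Omega>l E fmeasurableI2 by blast
  define m where "m = c * r powr d"
  have m: "m > 0" using c r by (simp add: m_def)
  have m_le: "m \<le> measure lebesgue (E z)" if "z \<in> F" for z
    using dens that F(1) r by (auto simp: measure_density_def m_def E_def d_def powr_realpow)
  define C where "C = measure ?M (space ?M) * (2 / m\<^sup>2)"
  have "(LINT x|?M. (cmod (f x))\<^sup>2) \<le> e * enn2real (\<integral>\<^sup>+x. gagliardo \<Omega> \<epsilon> f x \<partial>?M)
         + C * (\<Sum>E\<in>E`F. (cmod (LINT x|lebesgue_on E. f x))\<^sup>2)"
    if f[measurable]: "f \<in> borel_measurable ?M" and f2: "integrable ?M (\<lambda>x. (cmod (f x))\<^sup>2)"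
      and fin: "(\<integral>\<^sup>+x. gagliardo \<Omega> \<epsilon> f x \<partial>?M) < \<infinity>" for f :: "'a \<Rightarrow> complex"
  proof -
    define D where "D x = enn2real (gagliardo \<Omega> \<epsilon> f x)" for x
    define \<Sigma> where "\<Sigma> = (\<Sum>E\<in>E`F. (cmod (LINT x|lebesgue_on E. f x))\<^sup>2)"
    have ae: "AE x in ?M. gagliardo \<Omega> \<epsilon> f x \<noteq> \<infinity>"
      using \<Omega>l fin by (intro nn_integral_noteq_infinite) auto
    have D_meas[measurable]: "D \<in> borel_measurable ?M" 
      unfolding D_def using borel_measurable_gagliardo[OF \<Omega>l f] by (rule borel_measurable_enn2real)
    have nnD: "(\<integral>\<^sup>+x. ennreal (D x) \<partial>?M) = (\<integral>\<^sup>+x. gagliardo \<Omega> \<epsilon> f x \<partial>?M)"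
      using ae by (intro nn_integral_cong_AE) (auto simp: D_def ennreal_enn2real_if)
    have D_int: "integrable ?M D"
      using fin nnD by (intro integrableI_nonneg D_meas) (auto simp: D_def)
    have D_G: "(LINT x|?M. D x) = enn2real (\<integral>\<^sup>+x. gagliardo \<Omega> \<epsilon> f x \<partial>?M)"
      unfolding nnD[symmetric] by (rule integral_eq_nn_integral[OF D_meas]) (auto simp: D_def)
    have pw: "(cmod (f x))\<^sup>2 \<le> e * D x + (2 / m\<^sup>2) * \<Sigma>"
      if x: "x \<in> \<Omega>" "gagliardo \<Omega> \<epsilon> f x \<noteq> \<infinity>" for x
    proof -
      have fx: "gagliardo \<Omega> \<epsilon> f x < \<infinity>" using x(2) by (simp add: less_top)
      have "x \<in> closure \<Omega>" using x(1) closure_subset by blast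
      then obtain z where z: "z \<in> F" "dist z x < r" using F(3) by auto
      define n where "n = measure lebesgue (E z)"
      have n: "n \<ge> m" "n > 0" using m_le[OF z(1)] m by (auto simp: n_def)
      have sub: "E z \<subseteq> ball x (2 * r)"
      proof
        fix y assume "y \<in> E z"
        then have "dist z y < r" by (simp add: E_def)
        then have "dist x y < r + r" using z(2) dist_triangle_less_add[of x z r y r] by (simp add: dist_commute)
        then show "y \<in> ball x (2 * r)" by simp
      qed
      interpret E: finite_measure "lebesgue_on (E z)"
        using El by (rule finite_measure_lebesgue_on)
      note dev = mean_deviation_le[OF \<Omega>l E sub \<epsilon> f fx]
      have nE: "measure (lebesgue_on (E z)) (E z) = n"
        using E(1) by (simp add: n_def measure_restrict_space)
      have "n * cmod (f x) = cmod (LINT y|lebesgue_on (E z). f x)"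
        using n by (simp add: nE norm_mult)
      also have "(LINT y|lebesgue_on (E z). f x) = (LINT y|lebesgue_on (E z). f x - f y) + (LINT y|lebesgue_on (E z). f y)"
        using dev(1) by simp
      also have "cmod \<dots> \<le> (LINT y|lebesgue_on (E z). cmod (f x - f y)) + cmod (LINT y|lebesgue_on (E z). f y)"
        by (rule order_trans[OF norm_triangle_ineq add_right_mono[OF integral_norm_bound]])
      also have "\<dots> \<le> sqrt n * sqrt ((2 * r) powr (d + 2 * \<epsilon>) * D x) + cmod (LINT y|lebesgue_on (E z). f y)"
        using dev(2) by (simp add: n_def D_def d_def)
      finally have "(n * cmod (f x))\<^sup>2 \<le> (sqrt n * sqrt ((2 * r) powr (d + 2 * \<epsilon>) * D x) + cmod (LINT y|lebesgue_on (E z). f y))\<^sup>2"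
        using n by (intro power_mono) auto
      also have "\<dots> \<le> 2 * (sqrt n * sqrt ((2 * r) powr (d + 2 * \<epsilon>) * D x))\<^sup>2 + 2 * (cmod (LINT y|lebesgue_on (E z). f y))\<^sup>2"
      proof -
        have "(s + t)\<^sup>2 \<le> 2 * s\<^sup>2 + 2 * t\<^sup>2" for s t :: real
          using zero_le_power2[of "s - t"] by (simp add: power2_sum power2_diff)
        then show ?thesis .
      qed
      also have "(sqrt n * sqrt ((2 * r) powr (d + 2 * \<epsilon>) * D x))\<^sup>2 = n * ((2 * r) powr (d + 2 * \<epsilon>) * D x)"
        using n by (simp add: power_mult_distrib D_def)
      finally have "n\<^sup>2 * (cmod (f x))\<^sup>2 \<le> 2 * (n * ((2 * r) powr (d + 2 * \<epsilon>) * D x)) + 2 * (cmod (LINT y|lebesgue_on (E z). f y))\<^sup>2"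
        by (simp add: power_mult_distrib)
      then have "(cmod (f x))\<^sup>2 \<le> (2 * (n * ((2 * r) powr (d + 2 * \<epsilon>) * D x)) + 2 * (cmod (LINT y|lebesgue_on (E z). f y))\<^sup>2) / n\<^sup>2"
        using n by (simp add: le_divide_eq mult.commute)
      also have "\<dots> = 2 * ((2 * r) powr (d + 2 * \<epsilon>) * D x) / n + 2 * (cmod (LINT y|lebesgue_on (E z). f y))\<^sup>2 / n\<^sup>2"
        using n by (simp add: add_divide_distrib power2_eq_square)
      also have "\<dots> \<le> 2 * ((2 * r) powr (d + 2 * \<epsilon>) * D x) / m + 2 * (cmod (LINT y|lebesgue_on (E z). f y))\<^sup>2 / m\<^sup>2"
        using n m by (intro add_mono divide_left_mono power_mono mult_pos_pos) (auto simp: D_def)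
      also have "2 * ((2 * r) powr (d + 2 * \<epsilon>) * D x) / m = K * r powr (2 * \<epsilon>) * D x"
        using r c by (simp add: K_def m_def powr_mult powr_add)
      also have "\<dots> \<le> e * D x" using re by (intro mult_right_mono) (auto simp: D_def)
      also have "(cmod (LINT y|lebesgue_on (E z). f y))\<^sup>2 \<le> \<Sigma>"
        unfolding \<Sigma>_def using z(1) F(2) by (intro member_le_sum) auto
      finally show ?thesis using m by (simp add: divide_right_mono)
    qed
    have "(LINT x|?M. (cmod (f x))\<^sup>2) \<le> (LINT x|?M. e * D x + (2 / m\<^sup>2) * \<Sigma>)"
    proof (rule integral_mono_AE)
      show "AE x in ?M. (cmod (f x))\<^sup>2 \<le> e * D x + (2 / m\<^sup>2) * \<Sigma>"
        using ae AE_space by eventually_elim (use pw in auto)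
    qed (use D_int f2 in auto)
    also have "\<dots> = e * (LINT x|?M. D x) + C * \<Sigma>"
      using D_int by (simp add: C_def)
    finally show ?thesis by (simp add: D_G \<Sigma>_def)
  qed
  moreover have "C \<ge> 0" by (simp add: C_def)
  ultimately show ?thesis using F(2) E by (intro exI[of _ "E ` F"] exI[of _ C]) auto
qed

section \<open>Measure density of smooth domains\<close>

text \<open>\<open>Ck_on\<close> speaks about basis directions only; linearity of the derivative
  gives every other direction.\<close>

lemma continuous_frechet_derivative:
  fixes r :: "'a::euclidean_space \<Rightarrow> real"
  assumes "open U" "Ck_on 1 U r" "p \<in> U"
  shows "continuous (at p) (\<lambda>x. frechet_derivative r (at x) e)"
proof -
  have diff: "(r has_derivative frechet_derivative r (at x)) (at x)" if "x \<in> U" for x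
    using assms that frechet_derivative_works[of r "at x"] at_within_open[of x U]
    by (auto simp: differentiable_on_def)
  have lin: "frechet_derivative r (at x) e = (\<Sum>b\<in>Basis. (e \<bullet> b) * frechet_derivative r (at x) b)" if "x \<in> U" for x
  proof -
    have l: "linear (frechet_derivative r (at x))" using has_derivative_linear[OF diff[OF that]] .
    show ?thesis
      by (subst euclidean_representation[of e, symmetric])
        (simp only: linear_sum[OF l] linear_scale[OF l] real_scaleR_def o_def)
  qed
  have "continuous_on U (\<lambda>x. \<Sum>b\<in>Basis. (e \<bullet> b) * frechet_derivative r (at x) b)"
    using assms(2) by (intro continuous_intros) auto
  then have "continuous_on U (\<lambda>x. frechet_derivative r (at x) e)"
    by (rule continuous_on_eq) (simp add: lin)
  then show ?thesis using assms(1,3) by (simp add: continuous_on_eq_continuous_at)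
qed

text \<open>A uniform interior cone: near a boundary point the defining function decreases in every
  direction of a small ball around \<open>e\<close>, so this cone of directions stays inside the domain.\<close>

lemma boundary_point_cone:
  fixes \<Omega> :: "'a::euclidean_space set" and \<rho> :: "'a \<Rightarrow> real"
  assumes U: "open U" "Ck_on 1 U \<rho>" "\<Omega> \<inter> U = {z\<in>U. \<rho> z < 0}"
    and p: "p \<in> U" "frechet_derivative \<rho> (at p) \<noteq> (\<lambda>_. 0)"
  shows "\<exists>s>0. \<exists>e \<eta>. \<eta> > 0 \<and> norm e + \<eta> \<le> 1 \<and>
    (\<forall>x\<in>\<Omega>. dist p x < s \<longrightarrow> (\<forall>t. 0 < t \<and> t < s \<longrightarrow> ball (x + t *\<^sub>R e) (t * \<eta>) \<subseteq> \<Omega>))"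
proof -
  have diff: "(\<rho> has_derivative frechet_derivative \<rho> (at x)) (at x)" if "x \<in> U" for x
    using U that frechet_derivative_works[of \<rho> "at x"] at_within_open[of x U]
    by (auto simp: differentiable_on_def)
  have lin: "linear (frechet_derivative \<rho> (at x))" if "x \<in> U" for x
    using has_derivative_linear[OF diff[OF that]] .
  obtain v where v: "frechet_derivative \<rho> (at p) v \<noteq> 0" using p(2) by (auto simp: fun_eq_iff)
  define w where "w = (if frechet_derivative \<rho> (at p) v < 0 then v else - v)"
  have w: "frechet_derivative \<rho> (at p) w < 0"
    using v linear_neg[OF lin[OF p(1)], of v] by (auto simp: w_def not_less less_le)
  have w0: "w \<noteq> 0" using w linear_0[OF lin[OF p(1)]] by auto
  \<comment> \<open>Norm 1/2 leaves room for \<eta> <= 1/2, so every direction within \<eta> of e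
    has norm at most 1.\<close>
  define e where "e = (1 / (2 * norm w)) *\<^sub>R w"
  have norm_e: "norm e = 1 / 2" using w0 by (simp add: e_def)
  have "frechet_derivative \<rho> (at p) e = (1 / (2 * norm w)) * frechet_derivative \<rho> (at p) w"
    by (simp add: e_def linear_scale[OF lin[OF p(1)]])
  also have "\<dots> < 0" using w w0 by (intro mult_pos_neg) auto
  finally have e: "frechet_derivative \<rho> (at p) e < 0" .
  define \<delta> where "\<delta> = - frechet_derivative \<rho> (at p) e / 2"
  have \<delta>: "\<delta> > 0" using e by (simp add: \<delta>_def)
  have cont: "\<forall>\<^sub>F x in nhds p. \<bar>frechet_derivative \<rho> (at x) h - frechet_derivative \<rho> (at p) h\<bar> < \<alpha>"
    if "\<alpha> > 0" for h \<alpha>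
    using continuous_frechet_derivative[OF U(1,2) p(1), of h] that
    unfolding continuous_at tendsto_iff
    by (subst eventually_nhds_conv_at) (auto simp: dist_real_def)
  \<comment> \<open>Near p each partial derivative differs by less than 1 from its value at p, so
    turning the direction e by less than \<eta> changes the directional derivative by at most B
    \<eta>, which will be at most \<delta>.\<close>
  define B where "B = (\<Sum>b\<in>Basis. \<bar>frechet_derivative \<rho> (at p) b\<bar> + 1)"
  have B: "B > 0" unfolding B_def by (intro sum_pos) (auto simp: add_nonneg_pos)
  have "\<forall>\<^sub>F x in nhds p. x \<in> U \<and> \<bar>frechet_derivative \<rho> (at x) e - frechet_derivative \<rho> (at p) e\<bar> < \<delta>
      \<and> (\<forall>b\<in>Basis. \<bar>frechet_derivative \<rho> (at x) b - frechet_derivative \<rho> (at p) b\<bar> < 1)"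
    using \<delta> U(1) p(1) by (intro eventually_conj eventually_ball_finite ballI cont eventually_nhds_in_open) auto
  then obtain s where s: "s > 0" and sU: "\<And>x. dist x p < s \<Longrightarrow> x \<in> U"
    and se: "\<And>x. dist x p < s \<Longrightarrow> \<bar>frechet_derivative \<rho> (at x) e - frechet_derivative \<rho> (at p) e\<bar> < \<delta>"
    and sb: "\<And>x b. dist x p < s \<Longrightarrow> b \<in> Basis \<Longrightarrow> \<bar>frechet_derivative \<rho> (at x) b - frechet_derivative \<rho> (at p) b\<bar> < 1"
    unfolding eventually_nhds_metric by blast
  define \<eta> where "\<eta> = min (1 / 2) (\<delta> / B)"
  have \<eta>: "\<eta> > 0" "norm e + \<eta> \<le> 1" "B * \<eta> \<le> \<delta>"
  proof -
    show "\<eta> > 0" using \<delta> B by (simp add: \<eta>_def)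
    have "\<eta> \<le> 1 / 2" unfolding \<eta>_def by (rule min.cobounded1)
    then show "norm e + \<eta> \<le> 1" using norm_e by simp
    have "\<eta> \<le> \<delta> / B" unfolding \<eta>_def by (rule min.cobounded2)
    then show "B * \<eta> \<le> \<delta>" using B by (simp add: field_simps)
  qed
  have neg: "frechet_derivative \<rho> (at x) h < 0" if x: "dist x p < s" and h: "norm (h - e) < \<eta>" for x h
  proof -
    let ?D = "frechet_derivative \<rho> (at x)"
    have l: "linear ?D" using lin sU x by blast
    have "\<bar>?D (h - e)\<bar> = \<bar>\<Sum>b\<in>Basis. ((h - e) \<bullet> b) * ?D b\<bar>"
      by (subst euclidean_representation[of "h - e", symmetric]) (simp add: linear_sum[OF l] linear_scale[OF l])
    also have "\<dots> \<le> (\<Sum>b\<in>Basis. \<bar>((h - e) \<bullet> b) * ?D b\<bar>)" by (rule sum_abs)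
    also have "\<dots> \<le> (\<Sum>b\<in>Basis. \<eta> * (\<bar>frechet_derivative \<rho> (at p) b\<bar> + 1))"
    proof (rule sum_mono)
      fix b :: 'a assume b: "b \<in> Basis"
      have "\<bar>(h - e) \<bullet> b\<bar> \<le> \<eta>" using Basis_le_norm[OF b, of "h - e"] h by linarith
      moreover have "\<bar>?D b\<bar> \<le> \<bar>frechet_derivative \<rho> (at p) b\<bar> + 1" using sb[OF x b] by linarith
      ultimately show "\<bar>((h - e) \<bullet> b) * ?D b\<bar> \<le> \<eta> * (\<bar>frechet_derivative \<rho> (at p) b\<bar> + 1)"
        unfolding abs_mult using \<eta> by (intro mult_mono) auto
    qed
    also have "\<dots> = B * \<eta>" by (simp add: B_def sum_distrib_left mult.commute)
    finally have 1: "\<bar>?D (h - e)\<bar> \<le> \<delta>" using \<eta>(3) by linarith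
    have "?D h = ?D e + ?D (h - e)" by (simp add: linear_diff[OF l])
    moreover have "?D e < - \<delta>" using se[OF x] by (simp add: \<delta>_def)
    ultimately show ?thesis using 1 by linarith
  qed
  \<comment> \<open>Halving s keeps the whole segment from x to y within distance s of p: x lies
    within s/2, and the segment has length at most t < s/2. The mean value theorem along it gives
    \<rho> y < \<rho> x < 0.\<close>
  have "ball (x + t *\<^sub>R e) (t * \<eta>) \<subseteq> \<Omega>" if x: "x \<in> \<Omega>" "dist p x < s / 2" and t: "0 < t" "t < s / 2" for x t
  proof
    fix y assume y: "y \<in> ball (x + t *\<^sub>R e) (t * \<eta>)"
    define h where "h = (1 / t) *\<^sub>R (y - x)"
    have yh: "y = x + t *\<^sub>R h" using t by (simp add: h_def)
    have "t * norm (h - e) = norm (t *\<^sub>R h - t *\<^sub>R e)"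
      using t by (simp flip: scaleR_diff_right)
    also have "\<dots> = dist (x + t *\<^sub>R e) y" by (simp add: yh dist_norm norm_minus_commute)
    also have "\<dots> < t * \<eta>" using y by simp
    finally have he: "norm (h - e) < \<eta>" using t by simp
    have "norm h \<le> 1" using he \<eta>(2) norm_triangle_sub[of h e] by linarith
    have near: "dist (x + \<tau> *\<^sub>R h) p < s" if "0 \<le> \<tau>" "\<tau> \<le> t" for \<tau>
    proof -
      have "dist (x + \<tau> *\<^sub>R h) p \<le> dist (x + \<tau> *\<^sub>R h) x + dist x p" by (rule dist_triangle)
      also have "dist (x + \<tau> *\<^sub>R h) x = \<tau> * norm h" using that by (simp add: dist_norm)
      also have "\<tau> * norm h \<le> t * 1" using that \<open>norm h \<le> 1\<close> by (intro mult_mono) auto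
      finally show ?thesis using x(2) t by (simp add: dist_commute)
    qed
    have xp: "dist x p < s" using near[of 0] t by simp
    have "\<exists>\<tau>>0. \<tau> < t \<and> \<rho> (x + t *\<^sub>R h) - \<rho> (x + 0 *\<^sub>R h) = (t - 0) * frechet_derivative \<rho> (at (x + \<tau> *\<^sub>R h)) h"
    proof (rule MVT2[OF t(1)])
      fix \<tau> assume "0 \<le> \<tau>" "\<tau> \<le> t"
      then have u: "x + \<tau> *\<^sub>R h \<in> U" using near sU by blast
      have "((\<lambda>\<tau>. \<rho> (x + \<tau> *\<^sub>R h)) has_derivative (\<lambda>k. frechet_derivative \<rho> (at (x + \<tau> *\<^sub>R h)) (k *\<^sub>R h))) (at \<tau>)"
        by (rule has_derivative_compose[where f = "\<lambda>\<tau>. x + \<tau> *\<^sub>R h" and f' = "\<lambda>k. k *\<^sub>R h" and g = \<rho>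
              and x = \<tau> and s = UNIV, OF _ diff[OF u]]) (auto intro!: derivative_eq_intros)
      then show "((\<lambda>\<tau>. \<rho> (x + \<tau> *\<^sub>R h)) has_real_derivative frechet_derivative \<rho> (at (x + \<tau> *\<^sub>R h)) h) (at \<tau>)"
        by (simp add: has_field_derivative_def linear_scale[OF lin[OF u]] mult_commute_abs)
    qed
    then obtain \<tau> where \<tau>: "0 < \<tau>" "\<tau> < t" "\<rho> (x + t *\<^sub>R h) - \<rho> x = t * frechet_derivative \<rho> (at (x + \<tau> *\<^sub>R h)) h"
      by auto
    have "t * frechet_derivative \<rho> (at (x + \<tau> *\<^sub>R h)) h < 0"
      using t neg[OF near he, of \<tau>] \<tau> by (intro mult_pos_neg) auto
    moreover have "\<rho> x < 0" using U(3) x(1) sU[OF xp] by blast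
    ultimately have "\<rho> y < 0" using \<tau>(3) by (simp add: yh)
    moreover have "y \<in> U" using near[of t] t sU by (simp add: yh)
    ultimately show "y \<in> \<Omega>" using U(3) by blast
  qed
  then have "s / 2 > 0 \<and> \<eta> > 0 \<and> norm e + \<eta> \<le> 1 \<and>
    (\<forall>x\<in>\<Omega>. dist p x < s / 2 \<longrightarrow> (\<forall>t. 0 < t \<and> t < s / 2 \<longrightarrow> ball (x + t *\<^sub>R e) (t * \<eta>) \<subseteq> \<Omega>))"
    using s \<eta> by auto
  then show ?thesis by blast
qed

text \<open>Compactness of the boundary leaves finitely many cones, hence one scale r0 and one
  opening \<eta>0. A small ball about x either stays in \<Omega> or meets the boundary, and in the
  latter case x is close enough to some cone centre for the cone at x to lie in \<Omega>. In both
  cases \<open>ball x r \<inter> \<Omega>\<close> contains a ball of radius r \<eta>0 / 2.\<close>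

theorem smooth_domain_measure_density:
  fixes \<Omega> :: "'a::euclidean_space set" and \<rho> :: "'a \<Rightarrow> real"
  assumes \<Omega>: "open \<Omega>" "bounded \<Omega>"
    and U: "open U" "frontier \<Omega> \<subseteq> U" "Ck_on 1 U \<rho>" "\<Omega> \<inter> U = {z\<in>U. \<rho> z < 0}"
    and grad: "\<And>p. p \<in> frontier \<Omega> \<Longrightarrow> frechet_derivative \<rho> (at p) \<noteq> (\<lambda>_. 0)"
  shows "\<exists>c r0. measure_density \<Omega> c r0"
proof -
  let ?v = "measure lborel (ball (0::'a) 1)"
  have v: "?v > 0" by (simp add: content_ball_pos)
  have "\<exists>s \<eta> e. s > 0 \<and> \<eta> > 0 \<and> norm e + \<eta> \<le> 1 \<and>
    (\<forall>x\<in>\<Omega>. dist p x < s \<longrightarrow> (\<forall>t. 0 < t \<and> t < s \<longrightarrow> ball (x + t *\<^sub>R e) (t * \<eta>) \<subseteq> \<Omega>))"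
    if "p \<in> frontier \<Omega>" for p
    using boundary_point_cone[OF U(1,3,4) subsetD[OF U(2) that] grad[OF that]] by blast
  then obtain s \<eta> e where s: "\<And>p. p \<in> frontier \<Omega> \<Longrightarrow> s p > 0" "\<And>p. p \<in> frontier \<Omega> \<Longrightarrow> \<eta> p > 0"
      "\<And>p. p \<in> frontier \<Omega> \<Longrightarrow> norm (e p) + \<eta> p \<le> 1"
    and cone: "\<And>p x t. p \<in> frontier \<Omega> \<Longrightarrow> x \<in> \<Omega> \<Longrightarrow> dist p x < s p \<Longrightarrow> 0 < t \<Longrightarrow> t < s p
      \<Longrightarrow> ball (x + t *\<^sub>R e p) (t * \<eta> p) \<subseteq> \<Omega>"
    by metis
  have "compact (frontier \<Omega>)" using \<Omega>(2) by (simp add: compact_frontier_bounded)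
  moreover have "frontier \<Omega> \<subseteq> (\<Union>p\<in>frontier \<Omega>. ball p (s p / 2))" using s(1) by force
  ultimately obtain F where F: "F \<subseteq> frontier \<Omega>" "finite F" "frontier \<Omega> \<subseteq> (\<Union>p\<in>F. ball p (s p / 2))"
    using compactE_image[of "frontier \<Omega>" "frontier \<Omega>" "\<lambda>p. ball p (s p / 2)"] by auto
  \<comment> \<open>A point within r0 of a boundary point that lies in
    \<open>ball p (s p / 2)\<close> is within \<open>s p\<close> of p. The inserted 1 gives the
    minimum a meaning when F is empty.\<close>
  define r0 where "r0 = Min (insert 1 ((\<lambda>p. s p / 2) ` F))"
  define \<eta>0 where "\<eta>0 = Min (insert 1 (\<eta> ` F))"
  have r0: "r0 > 0" "\<And>p. p \<in> F \<Longrightarrow> r0 \<le> s p / 2"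
  proof -
    show "r0 > 0" unfolding r0_def using F(1,2) s(1) by (subst Min_gr_iff) auto
    show "r0 \<le> s p / 2" if "p \<in> F" for p
      unfolding r0_def by (rule Min_le) (use F(2) that in auto)
  qed
  have \<eta>0: "\<eta>0 > 0" "\<eta>0 \<le> 1" "\<And>p. p \<in> F \<Longrightarrow> \<eta>0 \<le> \<eta> p"
  proof -
    show "\<eta>0 > 0" unfolding \<eta>0_def using F(1,2) s(2) by (subst Min_gr_iff) auto
    show "\<eta>0 \<le> 1" unfolding \<eta>0_def by (rule Min_le) (use F(2) in auto)
    show "\<eta>0 \<le> \<eta> p" if "p \<in> F" for p
      unfolding \<eta>0_def by (rule Min_le) (use F(2) that in auto)
  qed
  have ball: "\<exists>z. ball z (r / 2 * \<eta>0) \<subseteq> ball x r \<inter> \<Omega>" if x: "x \<in> \<Omega>" and r: "0 < r" "r \<le> r0" for x r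
  proof (cases "ball x r \<subseteq> \<Omega>")
    case True
    have "r / 2 * \<eta>0 \<le> r / 2 * 1" using r \<eta>0 by (intro mult_left_mono) auto
    then have "ball x (r / 2 * \<eta>0) \<subseteq> ball x r" using r by (intro subset_ball) auto
    then show ?thesis using True by blast
  next
    case False
    moreover have "x \<in> ball x r \<inter> \<Omega>" using x r by simp
    ultimately have "ball x r \<inter> frontier \<Omega> \<noteq> {}"
      by (intro connected_Int_frontier connected_ball) blast+
    then obtain y where y: "y \<in> frontier \<Omega>" "dist x y < r" by auto
    then obtain p where p: "p \<in> F" "dist p y < s p / 2" using F(3) by auto
    have pf: "p \<in> frontier \<Omega>" using p(1) F(1) by blast
    have "dist p x \<le> dist p y + dist x y" by (metis dist_commute dist_triangle)
    then have px: "dist p x < s p" using y(2) p(2) r(2) r0(2)[OF p(1)] by linarith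
    have t: "0 < r / 2" "r / 2 < s p" using r r0(2)[OF p(1)] s(1)[OF pf] by auto
    have "ball (x + (r / 2) *\<^sub>R e p) (r / 2 * \<eta>0) \<subseteq> ball (x + (r / 2) *\<^sub>R e p) (r / 2 * \<eta> p)"
      using \<eta>0(3)[OF p(1)] r by (intro subset_ball mult_left_mono) auto
    also have "\<dots> \<subseteq> \<Omega>" by (rule cone[OF pf x px t])
    finally have 1: "ball (x + (r / 2) *\<^sub>R e p) (r / 2 * \<eta>0) \<subseteq> \<Omega>" .
    have "ball (x + (r / 2) *\<^sub>R e p) (r / 2 * \<eta>0) \<subseteq> ball x r"
    proof
      fix z assume "z \<in> ball (x + (r / 2) *\<^sub>R e p) (r / 2 * \<eta>0)"
      then have "dist (x + (r / 2) *\<^sub>R e p) z < r / 2 * \<eta>0" by simp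
      moreover have "dist x z \<le> dist x (x + (r / 2) *\<^sub>R e p) + dist (x + (r / 2) *\<^sub>R e p) z" by (rule dist_triangle)
      moreover have "dist x (x + (r / 2) *\<^sub>R e p) = r / 2 * norm (e p)" using r by (simp add: dist_norm)
      moreover have "r / 2 * norm (e p) \<le> r / 2 * 1"
        using s(2,3)[OF pf] r by (intro mult_left_mono) auto
      moreover have "r / 2 * \<eta>0 \<le> r / 2 * 1" using r \<eta>0 by (intro mult_left_mono) auto
      ultimately show "z \<in> ball x r" by simp
    qed
    then show ?thesis using 1 by blast
  qed
  have "?v * (\<eta>0 / 2) ^ DIM('a) * r ^ DIM('a) \<le> measure lebesgue (ball x r \<inter> \<Omega>)"
    if x: "x \<in> \<Omega>" and r: "0 < r" "r \<le> r0" for x r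
  proof -
    obtain z where z: "ball z (r / 2 * \<eta>0) \<subseteq> ball x r \<inter> \<Omega>" using ball[OF x r] by blast
    have "?v * (\<eta>0 / 2) ^ DIM('a) * r ^ DIM('a) = (r / 2 * \<eta>0) ^ DIM('a) * ?v"
      by (simp add: power_mult_distrib power_divide)
    also have "\<dots> = measure lebesgue (ball z (r / 2 * \<eta>0))"
      using r \<eta>0 content_ball_conv_unit_ball[of "r / 2 * \<eta>0" z] by simp
    also have "\<dots> \<le> measure lebesgue (ball x r \<inter> \<Omega>)"
      using z \<Omega> by (intro measure_mono_fmeasurable) (auto intro: fmeasurable_Int_fmeasurable)
    finally show ?thesis .
  qed
  then have "measure_density \<Omega> (?v * (\<eta>0 / 2) ^ DIM('a)) r0"
    using v \<eta>0 r0 by (simp add: measure_density_def)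
  then show ?thesis by blast
qed

section \<open>Smooth functions\<close>

lemma frechet_derivative_eqI: "(f has_derivative D) (at x) \<Longrightarrow> frechet_derivative f (at x) = D"
  by (rule frechet_derivative_at[symmetric])

lemma Ck_on_SucD: "Ck_on (Suc k) UNIV f \<Longrightarrow> Ck_on k UNIV f"
proof (induction k arbitrary: f)
  case 0
  then show ?case by (simp add: differentiable_imp_continuous_on)
next
  case (Suc k)
  then show ?case by simp
qed

lemma Ck_on_Suc_has_derivative:
  "Ck_on (Suc k) UNIV f \<Longrightarrow> (f has_derivative frechet_derivative f (at x)) (at x)"
  by (simp add: differentiable_on_def frechet_derivative_works[symmetric])

lemma Ck_on_SucI:
  assumes "\<And>x. (f has_derivative D x) (at x)" "\<And>b. b \<in> Basis \<Longrightarrow> Ck_on k UNIV (\<lambda>x. D x b)"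
  shows "Ck_on (Suc k) UNIV f"
proof -
  have "f differentiable_on UNIV"
    using assms(1) by (auto simp: differentiable_on_def differentiable_def)
  then show ?thesis
    using assms(2) by (simp add: frechet_derivative_eqI[OF assms(1)])
qed

lemma Ck_on_const: "Ck_on k UNIV (\<lambda>x. c)"
proof (induction k arbitrary: c)
  case (Suc k)
  show ?case by (rule Ck_on_SucI[OF has_derivative_const]) (rule Suc)
qed simp

lemma Ck_on_bounded_linear:
  assumes L: "bounded_linear L" and "Ck_on k UNIV f"
  shows "Ck_on k UNIV (\<lambda>x. L (f x))"
  using assms(2)
proof (induction k arbitrary: f)
  case 0
  then show ?case using bounded_linear.continuous_on[OF L] by simp
next
  case (Suc k)
  show ?case
    by (rule Ck_on_SucI[OF bounded_linear.has_derivative[OF L Ck_on_Suc_has_derivative[OF Suc.prems]]])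
      (use Suc in simp)
qed

lemma Ck_on_add:
  assumes "Ck_on k UNIV f" "Ck_on k UNIV g"
  shows "Ck_on k UNIV (\<lambda>x. f x + g x)"
  using assms
proof (induction k arbitrary: f g)
  case 0
  then show ?case by (simp add: continuous_on_add)
next
  case (Suc k)
  show ?case
    by (rule Ck_on_SucI[OF has_derivative_add[OF Suc.prems[THEN Ck_on_Suc_has_derivative]]])
      (use Suc in simp)
qed

lemma Ck_on_bilinear:
  assumes B: "bounded_bilinear h" and "Ck_on k UNIV f" "Ck_on k UNIV g"
  shows "Ck_on k UNIV (\<lambda>x. h (f x) (g x))"
  using assms(2,3)
proof (induction k arbitrary: f g)
  case 0
  then show ?case using bounded_bilinear.continuous_on[OF B] by simp
next
  case (Suc k)
  then have "Ck_on k UNIV f" "Ck_on k UNIV g"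
    by (auto dest: Ck_on_SucD simp del: Ck_on.simps)
  with Suc show ?case
    by (intro Ck_on_SucI[OF bounded_bilinear.FDERIV[OF B Suc.prems[THEN Ck_on_Suc_has_derivative]]])
      (auto intro!: Ck_on_add)
qed

lemma smooth_const: "smooth_on UNIV (\<lambda>x. c)"
  by (simp add: smooth_on_def Ck_on_const)

lemma smooth_bounded_linear: "bounded_linear L \<Longrightarrow> smooth_on UNIV f \<Longrightarrow> smooth_on UNIV (\<lambda>x. L (f x))"
  by (simp add: smooth_on_def Ck_on_bounded_linear)

lemma smooth_add: "smooth_on UNIV f \<Longrightarrow> smooth_on UNIV g \<Longrightarrow> smooth_on UNIV (\<lambda>x. f x + g x)"
  by (simp add: smooth_on_def Ck_on_add)

lemma smooth_mult:
  fixes f g :: "'a::euclidean_space \<Rightarrow> 'b::real_normed_algebra"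
  shows "smooth_on UNIV f \<Longrightarrow> smooth_on UNIV g \<Longrightarrow> smooth_on UNIV (\<lambda>x. f x * g x)"
  by (simp add: smooth_on_def Ck_on_bilinear[OF bounded_bilinear_mult])

lemma smooth_inner:
  "smooth_on UNIV f \<Longrightarrow> smooth_on UNIV g \<Longrightarrow> smooth_on UNIV (\<lambda>x. f x \<bullet> g x)"
  by (simp add: smooth_on_def Ck_on_bilinear[OF bounded_bilinear_inner])

lemma smooth_sum:
  assumes "\<And>i. i \<in> I \<Longrightarrow> smooth_on UNIV (f i)"
  shows "smooth_on UNIV (\<lambda>x. \<Sum>i\<in>I. f i x)"
  using assms by (induction I rule: infinite_finite_induct) (auto intro: smooth_const smooth_add)

lemma smooth_ident: "smooth_on UNIV (\<lambda>x. x)"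
proof -
  have "Ck_on k UNIV (\<lambda>x::'a. x)" for k
  proof (cases k)
    case (Suc n)
    show ?thesis unfolding Suc by (rule Ck_on_SucI[OF has_derivative_ident]) (rule Ck_on_const)
  qed simp
  then show ?thesis by (simp add: smooth_on_def)
qed

lemma smooth_has_derivative:
  "smooth_on UNIV f \<Longrightarrow> (f has_derivative frechet_derivative f (at x)) (at x)"
  using Ck_on_Suc_has_derivative[of 0 f] unfolding smooth_on_def by blast

lemma smooth_continuous: "smooth_on UNIV f \<Longrightarrow> continuous_on UNIV f"
  by (metis smooth_on_def Ck_on.simps(1))

lemma smooth_derivative:
  assumes f: "smooth_on UNIV f"
  shows "smooth_on UNIV (\<lambda>x. frechet_derivative f (at x) e)"
proof -
  have b: "smooth_on UNIV (\<lambda>x. frechet_derivative f (at x) b)" if "b \<in> Basis" for b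
    using f that unfolding smooth_on_def by (metis Ck_on.simps(2))
  have "frechet_derivative f (at x) e = (\<Sum>b\<in>Basis. (e \<bullet> b) *\<^sub>R frechet_derivative f (at x) b)" for x
  proof -
    have l: "linear (frechet_derivative f (at x))"
      using has_derivative_linear[OF smooth_has_derivative[OF f]] .
    show ?thesis
      by (subst euclidean_representation[of e, symmetric])
        (simp only: linear_sum[OF l] linear_scale[OF l] o_def)
  qed
  moreover have "smooth_on UNIV (\<lambda>x. \<Sum>b\<in>Basis. (e \<bullet> b) *\<^sub>R frechet_derivative f (at x) b)"
    by (intro smooth_sum smooth_bounded_linear[OF bounded_linear_scaleR_right] b)
  ultimately show ?thesis by simp
qed

text \<open>The class of functions \<open>P(1/t) exp(-1/t)\<close>, extended by zero, is closed under
  differentiation; this makes \<open>exp(-1/t)\<close> smooth.\<close>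

definition flat :: "real poly \<Rightarrow> real \<Rightarrow> real" where
  "flat p t = (if t > 0 then poly p (1 / t) * exp (- (1 / t)) else 0)"

lemma poly_times_exp_tendsto_0: "((\<lambda>x. poly p x * exp (- x)) \<longlongrightarrow> (0::real)) at_top"
proof -
  have "((\<lambda>x. \<Sum>i\<le>degree p. coeff p i * (x ^ i / exp x)) \<longlongrightarrow> (\<Sum>i\<le>degree p. coeff p i * 0)) at_top"
    by (intro tendsto_intros tendsto_power_div_exp_0)
  moreover have "(\<Sum>i\<le>degree p. coeff p i * (x ^ i / exp x)) = poly p x * exp (- x)" for x :: real
    by (simp add: poly_altdef sum_distrib_right exp_minus divide_inverse mult.assoc)
  ultimately show ?thesis by simp
qed

lemma flat_tendsto_0: "(flat p \<longlongrightarrow> 0) (at 0)"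
proof -
  have "filterlim (\<lambda>t::real. 1 / t) at_top (at_right 0)"
    using filterlim_inverse_at_top_right by (simp add: inverse_eq_divide)
  from filterlim_compose[OF poly_times_exp_tendsto_0[of p] this]
  have "((\<lambda>t. poly p (1 / t) * exp (- (1 / t))) \<longlongrightarrow> 0) (at_right 0)" .
  then have r: "(flat p \<longlongrightarrow> 0) (at_right 0)"
    by (rule Lim_transform_eventually) (auto simp: flat_def eventually_at_filter)
  have l: "(flat p \<longlongrightarrow> 0) (at_left 0)"
    by (rule Lim_transform_eventually[OF tendsto_const]) (auto simp: flat_def eventually_at_filter)
  show ?thesis using filterlim_at_split[of "flat p" "nhds 0" 0] l r by blast
qed

text \<open>In the variable x = 1/t one has d/dt = - x^2 d/dx, which sends P(x) exp(-x) to x^2 (P -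
  P')(x) exp(-x). At 0 the difference quotient of \<open>flat p\<close> is again flat, with
  polynomial x P(x), and tends to 0.\<close>

lemma flat_has_derivative:
  "(flat p has_real_derivative flat ([:0, 0, 1:] * (p - pderiv p)) t) (at t)"
proof -
  let ?q = "[:0, 0, 1:] * (p - pderiv p)"
  consider "t > 0" | "t < 0" | "t = 0" by linarith
  then show ?thesis
  proof cases
    case 1
    have "((\<lambda>t. poly p (1 / t) * exp (- (1 / t))) has_real_derivative
        (poly p (1 / t) * (exp (- (1 / t)) * (1 / t\<^sup>2)) + poly (pderiv p) (1 / t) * (- (1 / t\<^sup>2)) * exp (- (1 / t)))) (at t)"
      using 1 by (auto intro!: derivative_eq_intros DERIV_chain2[OF poly_DERIV] simp: power2_eq_square)
    moreover have "poly p (1 / t) * (exp (- (1 / t)) * (1 / t\<^sup>2)) + poly (pderiv p) (1 / t) * (- (1 / t\<^sup>2)) * exp (- (1 / t)) = flat ?q t"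
      using 1 by (simp add: flat_def power2_eq_square algebra_simps)
    ultimately have *: "((\<lambda>t. poly p (1 / t) * exp (- (1 / t))) has_real_derivative flat ?q t) (at t)"
      by (simp only:)
    show ?thesis
      by (rule has_field_derivative_transform_within_open[OF *, of "{0<..}"]) (use 1 in \<open>auto simp: flat_def\<close>)
  next
    case 2
    have *: "((\<lambda>t. 0) has_real_derivative flat ?q t) (at t)"
      using 2 by (simp add: flat_def)
    show ?thesis
      by (rule has_field_derivative_transform_within_open[OF *, of "{..<0}"]) (use 2 in \<open>auto simp: flat_def\<close>)
  next
    case 3
    have e: "(\<lambda>h. (flat p (0 + h) - flat p 0) / h) = flat ([:0, 1:] * p)"
      by (rule ext) (simp add: flat_def)
    have z: "flat ?q 0 = 0" by (simp add: flat_def)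
    show ?thesis unfolding 3 DERIV_def e z by (rule flat_tendsto_0)
  qed
qed

lemma smooth_flat:
  assumes u: "smooth_on UNIV u"
  shows "smooth_on UNIV (\<lambda>x. flat p (u x))"
proof -
  have "Ck_on k UNIV (\<lambda>x. flat p (u x))" for k
  proof (induction k arbitrary: p)
    case 0
    have "continuous_on UNIV (flat p)"
      using DERIV_continuous_on[of UNIV "flat p"] flat_has_derivative by blast
    then show ?case
      using continuous_on_compose2[OF _ smooth_continuous[OF u], of UNIV "flat p"] by simp
  next
    case (Suc k)
    let ?q = "[:0, 0, 1:] * (p - pderiv p)"
    show ?case
    proof (rule Ck_on_SucI)
      show "((\<lambda>x. flat p (u x)) has_derivative (\<lambda>h. flat ?q (u x) * frechet_derivative u (at x) h)) (at x)" for x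
        using has_derivative_compose[OF smooth_has_derivative[OF u, of x] flat_has_derivative[of p "u x", unfolded has_field_derivative_def]]
        by (simp add: mult_commute_abs)
      show "Ck_on k UNIV (\<lambda>x. flat ?q (u x) * frechet_derivative u (at x) b)" for b
        using smooth_derivative[OF u, of b] unfolding smooth_on_def
        by (intro Ck_on_bilinear[OF bounded_bilinear_mult] Suc) blast
    qed
  qed
  then show ?thesis by (simp add: smooth_on_def)
qed

lemma flat_1: "flat 1 t = (if t > 0 then exp (- (1 / t)) else 0)"
  by (simp add: flat_def)

text \<open>Cover \<open>V\<close> by balls with centres \<open>p\<^sub>i\<close> and add up bumps on the first \<open>k\<close> balls; applying
  \<open>exp(-1/(kt))\<close> to the sum drives it to the indicator function.\<close>

lemma smooth_approx_indicator:
  fixes V :: "'a::euclidean_space set"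
  assumes "open V"
  shows "\<exists>\<phi> :: nat \<Rightarrow> 'a \<Rightarrow> real. \<forall>k. smooth_on UNIV (\<phi> k) \<and> (\<forall>x. 0 \<le> \<phi> k x \<and> \<phi> k x \<le> 1)
    \<and> compact (closure {x. \<phi> k x \<noteq> 0}) \<and> closure {x. \<phi> k x \<noteq> 0} \<subseteq> V
    \<and> (\<forall>x. (\<lambda>k. \<phi> k x) \<longlonglongrightarrow> indicator V x)"
proof -
  define \<F> where "\<F> = {ball p R |p R. R > 0 \<and> cball p R \<subseteq> V}"
  have "\<Union>\<F> = V"
  proof
    show "V \<subseteq> \<Union>\<F>"
    proof
      fix x assume "x \<in> V"
      then obtain R where R: "R > 0" "cball x R \<subseteq> V" using assms open_contains_cball by blast
      then have "ball x R \<in> \<F>" by (auto simp: \<F>_def)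
      then show "x \<in> \<Union>\<F>" using R(1) centre_in_ball by blast
    qed
  qed (auto simp: \<F>_def dest: subsetD[OF ball_subset_cball])
  moreover have "\<And>S. S \<in> \<F> \<Longrightarrow> open S" by (auto simp: \<F>_def)
  ultimately obtain \<G> where \<G>: "\<G> \<subseteq> \<F>" "countable \<G>" "\<Union>\<G> = V"
    using Lindelof[of \<F>] by metis
  \<comment> \<open>Inserting the empty set makes an enumeration possible when \<G> is empty; the
    empty set is represented below as a ball of radius -1.\<close>
  define B where "B = from_nat_into (insert {} \<G>)"
  have cnt: "countable (insert {} \<G>)" using \<G>(2) by simp
  have B_in: "B i \<in> insert {} \<G>" for i unfolding B_def by (rule from_nat_into) simp
  have "\<exists>p R. B i = ball p R \<and> cball p R \<subseteq> V \<and> (R > 0 \<or> R = -1)" for i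
  proof (cases "B i = {}")
    case True
    have "ball (0::'a) (-1) = {}" "cball (0::'a) (-1) = {}" by simp_all
    then show ?thesis by (intro exI[of _ "0::'a"] exI[of _ "-1::real"]) (use True in \<open>simp add: ball_empty\<close>)
  next
    case False
    then have "B i \<in> \<F>" using B_in[of i] \<G>(1) by blast
    then show ?thesis by (auto simp: \<F>_def)
  qed
  then obtain p R where pR: "\<And>i. B i = ball (p i) (R i)" "\<And>i. cball (p i) (R i) \<subseteq> V" "\<And>i. R i > 0 \<or> R i = -1"
    by metis
  \<comment> \<open>Squaring the radius -1 would give 1; the value -1 keeps
    \<open>R2 i - (x - p i) \<bullet> (x - p i)\<close> negative everywhere, so the bump of the
    empty ball is zero.\<close>
  define R2 where "R2 i = (if R i > 0 then (R i)\<^sup>2 else -1)" for i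
  define u where "u i x = flat 1 (R2 i - (x - p i) \<bullet> (x - p i))" for i x
  have u_smooth: "smooth_on UNIV (u i)" for i
  proof -
    have "smooth_on UNIV (\<lambda>x. x - p i)"
      using smooth_add[OF smooth_ident smooth_const[of "- p i"]] by simp
    then have "smooth_on UNIV (\<lambda>x. R2 i + (- 1) * ((x - p i) \<bullet> (x - p i)))"
      by (intro smooth_add smooth_const smooth_mult smooth_inner)
    then show ?thesis unfolding u_def using smooth_flat by fastforce
  qed
  have u_nonneg: "u i x \<ge> 0" for i x by (simp add: u_def flat_1)
  have u_pos: "u i x > 0 \<longleftrightarrow> x \<in> B i" for i x
  proof -
    have "R2 i - (x - p i) \<bullet> (x - p i) > 0 \<longleftrightarrow> x \<in> B i"
    proof (cases "R i > 0")
      case True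
      have "dist (p i) x < R i \<longleftrightarrow> (dist (p i) x)\<^sup>2 < (R i)\<^sup>2"
        using True by (auto intro: power_strict_mono power2_less_imp_less[where y = "R i"])
      then show ?thesis using True
        by (simp add: R2_def pR(1) dist_norm norm_minus_commute power2_norm_eq_inner)
    next
      case False
      moreover have "\<not> dist (p i) x < -1" "\<not> (x - p i) \<bullet> (x - p i) < -1"
        using zero_le_dist[of "p i" x] inner_ge_zero[of "x - p i"] by linarith+
      ultimately show ?thesis using pR(1)[of i] pR(3)[of i] by (auto simp: R2_def)
    qed
    then show ?thesis by (simp add: u_def flat_1)
  qed
  define \<phi> where "\<phi> k x = flat 1 (real k * (\<Sum>i<k. u i x))" for k x
  have "smooth_on UNIV (\<phi> k)" for k
    unfolding \<phi>_def by (intro smooth_flat smooth_mult smooth_const smooth_sum u_smooth)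
  moreover have "0 \<le> \<phi> k x \<and> \<phi> k x \<le> 1" for k x
    by (simp add: \<phi>_def flat_1)
  moreover have supp: "closure {x. \<phi> k x \<noteq> 0} \<subseteq> (\<Union>i<k. cball (p i) (R i))" for k
  proof (rule closure_minimal)
    show "{x. \<phi> k x \<noteq> 0} \<subseteq> (\<Union>i<k. cball (p i) (R i))"
    proof
      fix x assume "x \<in> {x. \<phi> k x \<noteq> 0}"
      then have "(\<Sum>i<k. u i x) \<noteq> 0" by (auto simp: \<phi>_def flat_1)
      then obtain i where "i < k" "u i x \<noteq> 0" by (metis lessThan_iff sum.neutral)
      then have "x \<in> B i" "i < k" using u_pos[of i x] u_nonneg[of i x] by auto
      then show "x \<in> (\<Union>i<k. cball (p i) (R i))"
        by (intro UN_I[of i]) (auto simp: pR(1))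
    qed
  qed (intro closed_UN; auto)
  moreover have "compact (closure {x. \<phi> k x \<noteq> 0})" for k
  proof -
    have "compact (\<Union>i<k. cball (p i) (R i))" by (intro compact_UN) auto
    then show ?thesis
      using supp[of k] by (metis closed_closure compact_Int_closed inf.absorb_iff2)
  qed
  moreover have "closure {x. \<phi> k x \<noteq> 0} \<subseteq> V" for k
    using supp[of k] pR(2) by blast
  moreover have "(\<lambda>k. \<phi> k x) \<longlonglongrightarrow> indicator V x" for x
  proof (cases "x \<in> V")
    case False
    have "\<phi> k x = 0" for k
    proof -
      have "u i x = 0" for i
        using u_pos[of i x] u_nonneg[of i x] False pR(1,2)[of i] ball_subset_cball[of "p i" "R i"] by force
      then show ?thesis by (simp add: \<phi>_def flat_1)
    qed
    then show ?thesis using False by simp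
  next
    case True
    then obtain S where S: "S \<in> \<G>" "x \<in> S" using \<G>(3) by blast
    obtain i where "B i = S"
      using from_nat_into_surj[OF cnt, of S] S(1) by (auto simp: B_def)
    then have ui: "u i x > 0" using u_pos S(2) by blast
    have "filterlim (\<lambda>k. real k * u i x) at_top sequentially"
      using ui by (intro filterlim_at_top_mult_tendsto_pos[OF tendsto_const _ filterlim_real_sequentially])
    moreover have "\<forall>\<^sub>F k in sequentially. real k * u i x \<le> real k * (\<Sum>i<k. u i x)"
      using eventually_gt_at_top[of i]
    proof eventually_elim
      case (elim k)
      have "u i x \<le> (\<Sum>i<k. u i x)" using elim u_nonneg by (intro member_le_sum) auto
      then show ?case by (intro mult_left_mono) auto
    qed
    ultimately have lim: "filterlim (\<lambda>k. real k * (\<Sum>i<k. u i x)) at_top sequentially"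
      by (rule filterlim_at_top_mono)
    have "(\<lambda>k. exp (- (inverse (real k * (\<Sum>i<k. u i x))))) \<longlonglongrightarrow> exp (- 0)"
      by (intro tendsto_intros tendsto_inverse_0_at_top lim)
    then have "(\<lambda>k. \<phi> k x) \<longlonglongrightarrow> exp (- 0)"
    proof (rule Lim_transform_eventually)
      show "\<forall>\<^sub>F k in sequentially. exp (- inverse (real k * (\<Sum>i<k. u i x))) = \<phi> k x"
        using eventually_compose_filterlim[OF eventually_gt_at_top[of 0] lim]
        by eventually_elim (simp add: \<phi>_def flat_1 inverse_eq_divide)
    qed
    then show ?thesis using True by simp
  qed
  ultimately show ?thesis by blast
qed

section \<open>Symmetry of second derivatives\<close>

lemma smooth_line_derivative:
  fixes f :: "'a::euclidean_space \<Rightarrow> real"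
  assumes "smooth_on UNIV f"
  shows "((\<lambda>s. f (y + s *\<^sub>R v)) has_real_derivative frechet_derivative f (at (y + s *\<^sub>R v)) v) (at s)"
proof -
  note D = smooth_has_derivative[OF assms, of "y + s *\<^sub>R v"]
  have "((\<lambda>s. f (y + s *\<^sub>R v)) has_derivative (\<lambda>k. frechet_derivative f (at (y + s *\<^sub>R v)) (k *\<^sub>R v))) (at s)"
    by (rule has_derivative_compose[where f = "\<lambda>s. y + s *\<^sub>R v" and f' = "\<lambda>k. k *\<^sub>R v" and g = f
          and x = s and s = UNIV, OF _ D]) (auto intro!: derivative_eq_intros)
  then show ?thesis
    by (simp add: has_field_derivative_def linear_scale[OF has_derivative_linear[OF D]] mult_commute_abs)
qed

text \<open>The mean value theorem is applied twice, along a to the difference of f at points h b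
  apart, and then along b to the derivative of f in direction a. The left-hand side is symmetric in
  a and b, so exchanging them relates the two mixed derivatives.\<close>

lemma second_difference_mean_value:
  fixes f :: "'a::euclidean_space \<Rightarrow> real"
  assumes f: "smooth_on UNIV f" and h: "h > 0"
  shows "\<exists>\<xi> \<eta>. 0 < \<xi> \<and> \<xi> < h \<and> 0 < \<eta> \<and> \<eta> < h \<and>
    f (x + h *\<^sub>R a + h *\<^sub>R b) - f (x + h *\<^sub>R a) - f (x + h *\<^sub>R b) + f x
      = h * (h * frechet_derivative (\<lambda>y. frechet_derivative f (at y) a) (at (x + \<xi> *\<^sub>R a + \<eta> *\<^sub>R b)) b)"
proof -
  define fa where "fa = (\<lambda>y. frechet_derivative f (at y) a)"
  have fa: "smooth_on UNIV fa" unfolding fa_def by (rule smooth_derivative[OF f])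
  have "\<exists>\<xi>>0. \<xi> < h \<and> (f (x + h *\<^sub>R b + h *\<^sub>R a) - f (x + h *\<^sub>R a)) - (f (x + h *\<^sub>R b + 0 *\<^sub>R a) - f (x + 0 *\<^sub>R a))
      = (h - 0) * (fa (x + h *\<^sub>R b + \<xi> *\<^sub>R a) - fa (x + \<xi> *\<^sub>R a))"
    unfolding fa_def by (rule MVT2[OF h]) (intro DERIV_diff smooth_line_derivative f)
  then obtain \<xi> where \<xi>: "0 < \<xi>" "\<xi> < h"
    "f (x + h *\<^sub>R b + h *\<^sub>R a) - f (x + h *\<^sub>R a) - (f (x + h *\<^sub>R b) - f x) = h * (fa (x + h *\<^sub>R b + \<xi> *\<^sub>R a) - fa (x + \<xi> *\<^sub>R a))"
    by auto
  have "\<exists>\<eta>>0. \<eta> < h \<and> fa (x + \<xi> *\<^sub>R a + h *\<^sub>R b) - fa (x + \<xi> *\<^sub>R a + 0 *\<^sub>R b)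
      = (h - 0) * frechet_derivative fa (at (x + \<xi> *\<^sub>R a + \<eta> *\<^sub>R b)) b"
    by (rule MVT2[OF h]) (intro smooth_line_derivative fa)
  then obtain \<eta> where \<eta>: "0 < \<eta>" "\<eta> < h"
    "fa (x + \<xi> *\<^sub>R a + h *\<^sub>R b) - fa (x + \<xi> *\<^sub>R a) = h * frechet_derivative fa (at (x + \<xi> *\<^sub>R a + \<eta> *\<^sub>R b)) b"
    by auto
  have "f (x + h *\<^sub>R a + h *\<^sub>R b) - f (x + h *\<^sub>R a) - f (x + h *\<^sub>R b) + f x
      = h * (h * frechet_derivative fa (at (x + \<xi> *\<^sub>R a + \<eta> *\<^sub>R b)) b)"
  proof -
    have c: "x + h *\<^sub>R b + h *\<^sub>R a = x + h *\<^sub>R a + h *\<^sub>R b" "x + h *\<^sub>R b + \<xi> *\<^sub>R a = x + \<xi> *\<^sub>R a + h *\<^sub>R b"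
      by (simp_all only: add.assoc add.commute[of "h *\<^sub>R b"])
    show ?thesis using \<xi>(3) unfolding c \<eta>(3) by linarith
  qed
  then show ?thesis using \<xi>(1,2) \<eta>(1,2) unfolding fa_def by blast
qed

text \<open>One second difference is h^2 times each mixed derivative, at two different points near
  x. By continuity the values at x cannot differ by a positive amount.\<close>

lemma mixed_partials_real:
  fixes f :: "'a::euclidean_space \<Rightarrow> real"
  assumes f: "smooth_on UNIV f"
  shows "frechet_derivative (\<lambda>y. frechet_derivative f (at y) a) (at x) b
    = frechet_derivative (\<lambda>y. frechet_derivative f (at y) b) (at x) a"
proof (rule ccontr)
  define P where "P x = frechet_derivative (\<lambda>y. frechet_derivative f (at y) a) (at x) b" for x
  define Q where "Q x = frechet_derivative (\<lambda>y. frechet_derivative f (at y) b) (at x) a" for x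
  have PQ: "continuous_on UNIV P" "continuous_on UNIV Q"
    unfolding P_def Q_def by (intro smooth_continuous smooth_derivative f)+
  assume "frechet_derivative (\<lambda>y. frechet_derivative f (at y) a) (at x) b
    \<noteq> frechet_derivative (\<lambda>y. frechet_derivative f (at y) b) (at x) a"
  then have ne: "P x \<noteq> Q x" by (simp add: P_def Q_def)
  define e where "e = \<bar>P x - Q x\<bar> / 2"
  have e: "e > 0" and e2: "2 * e = \<bar>P x - Q x\<bar>" using ne by (simp_all add: e_def)
  obtain d1 where d1: "d1 > 0" "\<And>y. dist y x < d1 \<Longrightarrow> dist (P y) (P x) < e"
    using PQ(1) e unfolding continuous_on_iff by blast
  obtain d2 where d2: "d2 > 0" "\<And>y. dist y x < d2 \<Longrightarrow> dist (Q y) (Q x) < e"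
    using PQ(2) e unfolding continuous_on_iff by blast
  define N where "N = norm a + norm b + 1"
  have N: "N > 0" by (simp add: N_def add_nonneg_pos)
  \<comment> \<open>All intermediate points lie within h (|a| + |b|) of x, which this h keeps below
    both radii of continuity.\<close>
  define h where "h = min d1 d2 / N"
  have h: "h > 0" using d1(1) d2(1) N by (simp add: h_def)
  have hN: "h * N = min d1 d2" using N by (simp add: h_def)
  have near: "norm (\<xi> *\<^sub>R a + \<eta> *\<^sub>R b) < min d1 d2" if "0 < \<xi>" "\<xi> < h" "0 < \<eta>" "\<eta> < h" for \<xi> \<eta>
  proof -
    have "norm (\<xi> *\<^sub>R a + \<eta> *\<^sub>R b) \<le> \<xi> * norm a + \<eta> * norm b"
      using norm_triangle_ineq[of "\<xi> *\<^sub>R a" "\<eta> *\<^sub>R b"] that by simp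
    also have "\<dots> \<le> h * norm a + h * norm b"
      using that by (intro add_mono mult_right_mono) auto
    also have "\<dots> < h * N" using h by (simp add: N_def algebra_simps)
    finally show ?thesis by (simp add: hN)
  qed
  obtain \<xi> \<eta> where 1: "0 < \<xi>" "\<xi> < h" "0 < \<eta>" "\<eta> < h"
    "f (x + h *\<^sub>R a + h *\<^sub>R b) - f (x + h *\<^sub>R a) - f (x + h *\<^sub>R b) + f x = h * (h * P (x + \<xi> *\<^sub>R a + \<eta> *\<^sub>R b))"
    using second_difference_mean_value[OF f h, of x a b] unfolding P_def by blast
  obtain \<xi>' \<eta>' where 2: "0 < \<xi>'" "\<xi>' < h" "0 < \<eta>'" "\<eta>' < h"
    "f (x + h *\<^sub>R b + h *\<^sub>R a) - f (x + h *\<^sub>R b) - f (x + h *\<^sub>R a) + f x = h * (h * Q (x + \<xi>' *\<^sub>R b + \<eta>' *\<^sub>R a))"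
    using second_difference_mean_value[OF f h, of x b a] unfolding Q_def by blast
  have "x + h *\<^sub>R b + h *\<^sub>R a = x + h *\<^sub>R a + h *\<^sub>R b" by (simp add: add.assoc add.commute)
  then have "h * (h * P (x + \<xi> *\<^sub>R a + \<eta> *\<^sub>R b)) = h * (h * Q (x + \<xi>' *\<^sub>R b + \<eta>' *\<^sub>R a))"
    using 1(5) 2(5)[unfolded \<open>x + h *\<^sub>R b + h *\<^sub>R a = x + h *\<^sub>R a + h *\<^sub>R b\<close>] by linarith
  then have eq: "P (x + \<xi> *\<^sub>R a + \<eta> *\<^sub>R b) = Q (x + \<xi>' *\<^sub>R b + \<eta>' *\<^sub>R a)" using h by simp
  have "dist (x + \<xi> *\<^sub>R a + \<eta> *\<^sub>R b) x < d1"
    using near[OF 1(1-4)] by (simp add: dist_norm add.assoc)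
  then have "dist (P (x + \<xi> *\<^sub>R a + \<eta> *\<^sub>R b)) (P x) < e" by (rule d1(2))
  moreover have "dist (x + \<xi>' *\<^sub>R b + \<eta>' *\<^sub>R a) x < d2"
    using near[OF 2(3,4,1,2)] by (simp add: dist_norm add.assoc add.commute)
  then have "dist (Q (x + \<xi>' *\<^sub>R b + \<eta>' *\<^sub>R a)) (Q x) < e" by (rule d2(2))
  ultimately show False using e2 unfolding eq dist_real_def by linarith
qed

lemma frechet_derivative_bounded_linear:
  assumes "bounded_linear L" "smooth_on UNIV f"
  shows "frechet_derivative (\<lambda>x. L (f x)) (at x) e = L (frechet_derivative f (at x) e)"
proof -
  have "((\<lambda>x. L (f x)) has_derivative (\<lambda>h. L (frechet_derivative f (at x) h))) (at x)"
    by (rule bounded_linear.has_derivative[OF assms(1) smooth_has_derivative[OF assms(2)]])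
  from frechet_derivative_eqI[OF this] show ?thesis by (rule fun_cong)
qed

lemma mixed_partials:
  fixes f :: "'a::euclidean_space \<Rightarrow> complex"
  assumes f: "smooth_on UNIV f"
  shows "frechet_derivative (\<lambda>y. frechet_derivative f (at y) a) (at x) b
    = frechet_derivative (\<lambda>y. frechet_derivative f (at y) b) (at x) a"
proof -
  have L: "L (frechet_derivative (\<lambda>y. frechet_derivative f (at y) a) (at x) b)
      = frechet_derivative (\<lambda>y. frechet_derivative (\<lambda>z. L (f z)) (at y) a) (at x) b"
    if "bounded_linear L" for L :: "complex \<Rightarrow> real" and a b
    by (simp only: frechet_derivative_bounded_linear[OF that] f smooth_derivative)
  have "L (frechet_derivative (\<lambda>y. frechet_derivative f (at y) a) (at x) b)
      = L (frechet_derivative (\<lambda>y. frechet_derivative f (at y) b) (at x) a)"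
    if "bounded_linear L" for L :: "complex \<Rightarrow> real"
    unfolding L[OF that] by (intro mixed_partials_real smooth_bounded_linear[OF that] f)
  from this[OF bounded_linear_Re] this[OF bounded_linear_Im] show ?thesis by (rule complex_eqI)
qed

section \<open>Compactly supported functions and integrals of their derivatives\<close>

lemma compact_closure_subset: "compact K \<Longrightarrow> closure A \<subseteq> K \<Longrightarrow> compact (closure A)"
  using compact_Int_closed[of K "closure A"] by (simp add: inf.absorb2)

lemma compact_subset_cball:
  fixes K :: "'a::real_normed_vector set"
  assumes "compact K"
  obtains R where "K \<subseteq> cball 0 R"
proof -
  obtain R where "\<forall>x\<in>K. norm x \<le> R"
    using compact_imp_bounded[OF assms] unfolding bounded_iff by blast
  then have "K \<subseteq> cball 0 R" by auto
  then show ?thesis by (rule that)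
qed

lemma frechet_derivative_support:
  assumes "smooth_on UNIV f"
  shows "{x. frechet_derivative f (at x) e \<noteq> 0} \<subseteq> closure {x. f x \<noteq> 0}"
proof
  fix x assume x: "x \<in> {x. frechet_derivative f (at x) e \<noteq> 0}"
  show "x \<in> closure {x. f x \<noteq> 0}"
  proof (rule ccontr)
    assume n: "x \<notin> closure {x. f x \<noteq> 0}"
    have "(f has_derivative (\<lambda>_. 0)) (at x)"
      by (rule has_derivative_transform_within_open[OF has_derivative_const[of 0], of "- closure {x. f x \<noteq> 0}"])
        (use n closure_subset[of "{x. f x \<noteq> 0}"] in auto)
    then show False using x by (simp add: frechet_derivative_eqI)
  qed
qed

lemma compact_support_integrable:
  fixes f :: "'a::euclidean_space \<Rightarrow> 'b::{banach, second_countable_topology}"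
  assumes f: "continuous_on UNIV f" and c: "compact (closure {x. f x \<noteq> 0})"
  shows "bounded (range f)" "integrable lborel f"
proof -
  let ?K = "closure {x. f x \<noteq> 0}"
  have "bounded (f ` ?K)"
    by (rule compact_imp_bounded[OF compact_continuous_image[OF continuous_on_subset[OF f subset_UNIV] c]])
  then obtain B where B: "\<And>x. x \<in> ?K \<Longrightarrow> norm (f x) \<le> B" unfolding bounded_iff by blast
  have z: "f x = 0" if "x \<notin> ?K" for x using that closure_subset[of "{x. f x \<noteq> 0}"] by blast
  have B': "norm (f x) \<le> max B 0" for x
  proof (cases "x \<in> ?K")
    case True
    then have "norm (f x) \<le> B" by (rule B)
    then show ?thesis by (simp only: le_max_iff_disj simp_thms)
  next
    case False
    then have "f x = 0" by (rule z)
    then show ?thesis by (simp only: norm_zero max.cobounded2)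
  qed
  then show "bounded (range f)" unfolding bounded_iff by blast
  obtain R where R: "?K \<subseteq> cball 0 R" by (rule compact_subset_cball[OF c])
  have i: "integrable lborel (\<lambda>x. max B 0 * indicator (cball 0 R :: 'a set) x)"
    by (intro integrable_mult_right integrable_real_indicator emeasure_lborel_cball_finite) simp
  show "integrable lborel f"
  proof (rule Bochner_Integration.integrable_bound[OF i])
    show "f \<in> borel_measurable lborel" using f by (simp add: borel_measurable_continuous_onI)
    show "AE x in lborel. norm (f x) \<le> norm (max B 0 * indicator (cball 0 R) x)"
    proof (rule AE_I2)
      fix x show "norm (f x) \<le> norm (max B 0 * indicator (cball 0 R) x)"
      proof (cases "x \<in> ?K")
        case True
        then have "x \<in> cball 0 R" using R by blast
        then have "indicator (cball 0 R) x = (1::real)" by (rule indicator_eq_1_iff[THEN iffD2])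
        then show ?thesis using B'[of x] by (simp only: mult_1_right real_norm_def abs_of_nonneg max.cobounded2)
      next
        case False
        then have "f x = 0" by (rule z)
        then show ?thesis by (simp only: norm_zero norm_ge_zero)
      qed
    qed
  qed
qed

text \<open>By translation invariance every difference quotient has integral zero.\<close>

lemma integral_derivative_eq_0_real:
  fixes f :: "'a::euclidean_space \<Rightarrow> real"
  assumes f: "smooth_on UNIV f" and c: "compact (closure {x. f x \<noteq> 0})"
  shows "(LINT x|lborel. frechet_derivative f (at x) e) = 0"
proof -
  let ?D = "\<lambda>x. frechet_derivative f (at x) e"
  have D: "smooth_on UNIV ?D" by (rule smooth_derivative[OF f])
  have D_supp: "closure {x. ?D x \<noteq> 0} \<subseteq> closure {x. f x \<noteq> 0}"
    by (rule closure_minimal[OF frechet_derivative_support[OF f]]) simp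
  then have "compact (closure {x. ?D x \<noteq> 0})"
    by (rule compact_closure_subset[OF c])
  then obtain B where B: "\<And>x. \<bar>?D x\<bar> \<le> B"
    using compact_support_integrable(1)[OF smooth_continuous[OF D]] unfolding bounded_iff by fastforce
  have B0: "B \<ge> 0" using B[of 0] by linarith
  obtain R where R: "closure {x. f x \<noteq> 0} \<subseteq> cball 0 R" by (rule compact_subset_cball[OF c])
  define t where "t n = 1 / real (Suc n)" for n
  have t: "0 < t n" "t n \<le> 1" for n by (simp_all add: t_def)
  have t_lim: "t \<longlonglongrightarrow> 0" unfolding t_def using LIMSEQ_inverse_real_of_nat by (simp add: inverse_eq_divide)
  define g where "g n x = (f (x + t n *\<^sub>R e) - f x) / t n" for n x
  have f_meas[measurable]: "f \<in> borel_measurable borel"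
    using smooth_continuous[OF f] by (rule borel_measurable_continuous_onI)
  have f_int: "integrable lborel f"
    by (rule compact_support_integrable(2)[OF smooth_continuous[OF f] c])
  have shift: "integrable lborel (\<lambda>x. f (x + v))" "(LINT x|lborel. f (x + v)) = (LINT x|lborel. f x)" for v
  proof -
    have "integrable (distr lborel borel ((+) v)) f" using f_int by (simp add: lborel_distr_plus)
    then show "integrable lborel (\<lambda>x. f (x + v))"
      by (subst (asm) integrable_distr_eq) (auto simp: add.commute)
    have "(LINT x|lborel. f x) = (LINT x|distr lborel borel ((+) v). f x)" by (simp add: lborel_distr_plus)
    also have "\<dots> = (LINT x|lborel. f (v + x))" by (rule integral_distr) auto
    finally show "(LINT x|lborel. f (x + v)) = (LINT x|lborel. f x)" by (simp add: add.commute)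
  qed
  have g0: "(LINT x|lborel. g n x) = 0" for n
    unfolding g_def using shift[of "t n *\<^sub>R e"] f_int by simp
  have "(\<lambda>n. LINT x|lborel. g n x) \<longlonglongrightarrow> (LINT x|lborel. ?D x)"
  \<comment> \<open>As t n <= 1, the translates move the support by at most |e|, so all quotients
    live on the ball of radius R + |e|; there the mean value theorem bounds them by B.\<close>
  proof (rule integral_dominated_convergence[where w = "\<lambda>x. B * indicator (cball 0 (R + norm e) :: 'a set) x"])
    show "?D \<in> borel_measurable lborel"
      using smooth_continuous[OF D] by (simp add: borel_measurable_continuous_onI)
    show "g n \<in> borel_measurable lborel" for n unfolding g_def by measurable
    show "integrable lborel (\<lambda>x. B * indicator (cball 0 (R + norm e) :: 'a set) x)"
      by (intro integrable_mult_right integrable_real_indicator emeasure_lborel_cball_finite) simp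
    show "AE x in lborel. (\<lambda>n. g n x) \<longlonglongrightarrow> ?D x"
    proof (rule AE_I2)
      fix x
      have "((\<lambda>s. f (x + s *\<^sub>R e)) has_real_derivative ?D x) (at 0)"
        using smooth_line_derivative[OF f, of x e 0] by simp
      then have "((\<lambda>h. (f (x + h *\<^sub>R e) - f x) / h) \<longlongrightarrow> ?D x) (at 0)" by (simp add: DERIV_def)
      moreover have "filterlim t (at 0) sequentially"
      proof -
        have "t n \<noteq> 0" for n using t(1)[of n] by simp
        then show ?thesis using t_lim by (simp add: filterlim_at)
      qed
      ultimately show "(\<lambda>n. g n x) \<longlonglongrightarrow> ?D x" unfolding g_def by (rule filterlim_compose)
    qed
    show "AE x in lborel. norm (g n x) \<le> B * indicator (cball 0 (R + norm e)) x" for n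
    proof (rule AE_I2)
      fix x
      show "norm (g n x) \<le> B * indicator (cball 0 (R + norm e)) x"
      proof (cases "x \<in> cball 0 (R + norm e)")
        case True
        have "\<exists>\<xi>>0. \<xi> < t n \<and> f (x + t n *\<^sub>R e) - f (x + 0 *\<^sub>R e) = (t n - 0) * ?D (x + \<xi> *\<^sub>R e)"
          by (rule MVT2[OF t(1)]) (intro smooth_line_derivative f)
        then obtain \<xi> where "f (x + t n *\<^sub>R e) - f x = t n * ?D (x + \<xi> *\<^sub>R e)" by auto
        then have "g n x = ?D (x + \<xi> *\<^sub>R e)" using t(1)[of n] by (simp add: g_def)
        then show ?thesis using B True by simp
      next
        case False
        then have nx: "norm x > R + norm e" by simp
        have "norm (t n *\<^sub>R e) \<le> 1 * norm e" unfolding norm_scaleR using t[of n] by (intro mult_right_mono) auto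
        then have "norm (x + t n *\<^sub>R e) > R"
          using nx norm_triangle_ineq[of "x + t n *\<^sub>R e" "- (t n *\<^sub>R e)"] by simp
        then have "x + t n *\<^sub>R e \<notin> cball 0 R" by simp
        moreover have "norm x > R" using nx norm_ge_zero[of e] by linarith
        then have "x \<notin> cball 0 R" by simp
        ultimately have "f (x + t n *\<^sub>R e) = 0" "f x = 0"
          using R closure_subset[of "{x. f x \<noteq> 0}"] by blast+
        then show ?thesis using B0 by (simp add: g_def)
      qed
    qed
  qed
  then show ?thesis by (simp add: g0 LIMSEQ_const_iff)
qed

lemma integral_derivative_eq_0:
  fixes f :: "'a::euclidean_space \<Rightarrow> complex"
  assumes f: "smooth_on UNIV f" and c: "compact (closure {x. f x \<noteq> 0})"
  shows "(LINT x|lborel. frechet_derivative f (at x) e) = 0"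
proof -
  have D: "smooth_on UNIV (\<lambda>x. frechet_derivative f (at x) e)" by (rule smooth_derivative[OF f])
  have "closure {x. frechet_derivative f (at x) e \<noteq> 0} \<subseteq> closure {x. f x \<noteq> 0}"
    by (rule closure_minimal[OF frechet_derivative_support[OF f]]) simp
  then have "compact (closure {x. frechet_derivative f (at x) e \<noteq> 0})"
    by (rule compact_closure_subset[OF c])
  then have i: "integrable lborel (\<lambda>x. frechet_derivative f (at x) e)"
    by (rule compact_support_integrable(2)[OF smooth_continuous[OF D]])
  have "L (LINT x|lborel. frechet_derivative f (at x) e) = 0" if L: "bounded_linear L" for L :: "complex \<Rightarrow> real"
  proof -
    have "L (LINT x|lborel. frechet_derivative f (at x) e) = (LINT x|lborel. L (frechet_derivative f (at x) e))"
      using integral_bounded_linear[OF L i] by simp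
    also have "\<dots> = (LINT x|lborel. frechet_derivative (\<lambda>x. L (f x)) (at x) e)"
      by (simp add: frechet_derivative_bounded_linear[OF L f])
    also have "\<dots> = 0"
    proof (rule integral_derivative_eq_0_real[OF smooth_bounded_linear[OF L f]])
      have "L 0 = 0" using L by (simp add: bounded_linear.linear linear_0)
      then have "closure {x. L (f x) \<noteq> 0} \<subseteq> closure {x. f x \<noteq> 0}" by (intro closure_mono) auto
      then show "compact (closure {x. L (f x) \<noteq> 0})"
        by (rule compact_closure_subset[OF c])
    qed
    finally show ?thesis .
  qed
  from this[OF bounded_linear_Re] this[OF bounded_linear_Im] show ?thesis by (simp add: complex_eq_iff)
qed

section \<open>Test functions\<close>

lemma test_functionsD:
  assumes "\<phi> \<in> test_functions \<Omega>"
  shows "smooth_on UNIV \<phi>" "compact (closure {z. \<phi> z \<noteq> 0})" "closure {z. \<phi> z \<noteq> 0} \<subseteq> \<Omega>"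
  using assms by (simp_all add: test_functions_def)

lemma test_functions_eq_0: "\<phi> \<in> test_functions \<Omega> \<Longrightarrow> z \<notin> \<Omega> \<Longrightarrow> \<phi> z = 0"
  using test_functionsD(3)[of \<phi> \<Omega>] closure_subset[of "{z. \<phi> z \<noteq> 0}"] by blast

lemma test_functionsI:
  assumes "\<phi> \<in> test_functions \<Omega>" "smooth_on UNIV \<psi>" "{z. \<psi> z \<noteq> 0} \<subseteq> closure {z. \<phi> z \<noteq> 0}"
  shows "\<psi> \<in> test_functions \<Omega>"
proof -
  have "closure {z. \<psi> z \<noteq> 0} \<subseteq> closure {z. \<phi> z \<noteq> 0}"
    using assms(3) by (intro closure_minimal) auto
  then show ?thesis
    using test_functionsD[OF assms(1)] assms(2) compact_closure_subset
    unfolding test_functions_def by blast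
qed

lemma nonzero_subset_closure:
  assumes "\<And>z. \<phi> z = 0 \<Longrightarrow> \<psi> z = 0"
  shows "{z. \<psi> z \<noteq> 0} \<subseteq> closure {z. \<phi> z \<noteq> 0}"
  using assms closure_subset[of "{z. \<phi> z \<noteq> 0}"] by blast

lemma test_functions_mult:
  "\<phi> \<in> test_functions \<Omega> \<Longrightarrow> smooth_on UNIV \<psi> \<Longrightarrow> (\<lambda>z. \<phi> z * \<psi> z) \<in> test_functions \<Omega>"
proof -
  assume \<phi>: "\<phi> \<in> test_functions \<Omega>" and \<psi>: "smooth_on UNIV \<psi>"
  show "(\<lambda>z. \<phi> z * \<psi> z) \<in> test_functions \<Omega>"
  proof (rule test_functionsI[OF \<phi> smooth_mult[OF test_functionsD(1)[OF \<phi>] \<psi>]])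
    show "{z. \<phi> z * \<psi> z \<noteq> 0} \<subseteq> closure {z. \<phi> z \<noteq> 0}"
      by (rule nonzero_subset_closure) simp
  qed
qed

lemma test_functions_linear:
  assumes "bounded_linear L" "\<phi> \<in> test_functions \<Omega>"
  shows "(\<lambda>z. L (\<phi> z)) \<in> test_functions \<Omega>"
proof (rule test_functionsI[OF assms(2) smooth_bounded_linear[OF assms(1) test_functionsD(1)[OF assms(2)]]])
  show "{z. L (\<phi> z) \<noteq> 0} \<subseteq> closure {z. \<phi> z \<noteq> 0}"
    using linear_0[OF bounded_linear.linear[OF assms(1)]] by (intro nonzero_subset_closure) simp
qed

lemma test_functions_cnj: "\<phi> \<in> test_functions \<Omega> \<Longrightarrow> (\<lambda>z. cnj (\<phi> z)) \<in> test_functions \<Omega>"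
  by (rule test_functions_linear[OF bounded_linear_cnj])

section \<open>The conjugate Wirtinger derivatives of test functions\<close>

lemma smooth_d_dzbar:
  assumes "smooth_on UNIV \<phi>"
  shows "smooth_on UNIV (d_dzbar j \<phi>)"
proof -
  have "smooth_on UNIV (\<lambda>z. (frechet_derivative \<phi> (at z) (axis j 1) + \<i> * frechet_derivative \<phi> (at z) (axis j \<i>)) * (1 / 2))"
    by (intro smooth_mult smooth_add smooth_const smooth_derivative assms)
  then show ?thesis by (simp add: d_dzbar_def[abs_def])
qed

lemma test_functions_d_dzbar:
  assumes "\<phi> \<in> test_functions \<Omega>"
  shows "d_dzbar j \<phi> \<in> test_functions \<Omega>"
proof (rule test_functionsI[OF assms smooth_d_dzbar[OF test_functionsD(1)[OF assms]]])
  have "{z. d_dzbar j \<phi> z \<noteq> 0}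
      \<subseteq> {z. frechet_derivative \<phi> (at z) (axis j 1) \<noteq> 0} \<union> {z. frechet_derivative \<phi> (at z) (axis j \<i>) \<noteq> 0}"
    by (auto simp: d_dzbar_def)
  also have "\<dots> \<subseteq> closure {z. \<phi> z \<noteq> 0}"
    by (intro Un_least frechet_derivative_support test_functionsD(1)[OF assms])
  finally show "{z. d_dzbar j \<phi> z \<noteq> 0} \<subseteq> closure {z. \<phi> z \<noteq> 0}" .
qed

lemma d_dzbar_mult:
  assumes "smooth_on UNIV \<phi>" "smooth_on UNIV \<psi>"
  shows "d_dzbar j (\<lambda>z. \<phi> z * \<psi> z) z = \<phi> z * d_dzbar j \<psi> z + d_dzbar j \<phi> z * \<psi> z"
proof -
  have "frechet_derivative (\<lambda>z. \<phi> z * \<psi> z) (at z)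
      = (\<lambda>h. \<phi> z * frechet_derivative \<psi> (at z) h + frechet_derivative \<phi> (at z) h * \<psi> z)"
    by (rule frechet_derivative_eqI[OF has_derivative_mult[OF smooth_has_derivative[OF assms(1)] smooth_has_derivative[OF assms(2)]]])
  then show ?thesis by (simp add: d_dzbar_def field_simps)
qed

lemma d_dzbar_commute:
  assumes f: "smooth_on UNIV \<phi>"
  shows "d_dzbar j (d_dzbar k \<phi>) z = d_dzbar k (d_dzbar j \<phi>) z"
proof -
  have D: "frechet_derivative (d_dzbar k \<phi>) (at z) e
      = (frechet_derivative (\<lambda>z. frechet_derivative \<phi> (at z) (axis k 1)) (at z) e
        + \<i> * frechet_derivative (\<lambda>z. frechet_derivative \<phi> (at z) (axis k \<i>)) (at z) e) / 2" for k e
  proof -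
    have "(d_dzbar k \<phi> has_derivative (\<lambda>e. (frechet_derivative (\<lambda>z. frechet_derivative \<phi> (at z) (axis k 1)) (at z) e
        + \<i> * frechet_derivative (\<lambda>z. frechet_derivative \<phi> (at z) (axis k \<i>)) (at z) e) / 2)) (at z)"
      unfolding d_dzbar_def[abs_def] divide_inverse
      by (intro has_derivative_mult_left has_derivative_add has_derivative_mult_right smooth_has_derivative smooth_derivative f)
    from frechet_derivative_eqI[OF this] show ?thesis by (rule fun_cong)
  qed
  show ?thesis
    unfolding d_dzbar_def[of j "d_dzbar k \<phi>"] d_dzbar_def[of k "d_dzbar j \<phi>"] D
    by (simp add: mixed_partials[OF f, of "axis j 1"] mixed_partials[OF f, of "axis j \<i>"] algebra_simps add_divide_distrib)
qed

text \<open>Derivatives were integrated over the whole space, where translations act, whereas forms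
  are integrated over \<Omega>; functions vanishing off \<Omega> pass between the two.\<close>

lemma integral_lebesgue_on_eq_lborel:
  fixes f :: "'a::euclidean_space \<Rightarrow> complex"
  assumes "open \<Omega>" "continuous_on UNIV f" "\<And>x. x \<notin> \<Omega> \<Longrightarrow> f x = 0"
  shows "(LINT x|lebesgue_on \<Omega>. f x) = (LINT x|lborel. f x)"
proof -
  have "(LINT x|lebesgue_on \<Omega>. f x) = (LINT x|lebesgue. indicator \<Omega> x *\<^sub>R f x)"
    using assms(1) by (intro integral_restrict_space) auto
  also have "(\<lambda>x. indicator \<Omega> x *\<^sub>R f x) = f"
    using assms(3) by (auto simp: fun_eq_iff indicator_def)
  also have "(LINT x|lebesgue. f x) = (LINT x|lborel. f x)"
    using assms(2) by (intro integral_completion) (simp add: borel_measurable_continuous_onI)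
  finally show ?thesis .
qed

lemma integral_d_dzbar_eq_0:
  assumes \<Omega>: "open \<Omega>" and \<phi>: "\<phi> \<in> test_functions \<Omega>"
  shows "(LINT z|lebesgue_on \<Omega>. d_dzbar j \<phi> z) = 0"
proof -
  have T: "d_dzbar j \<phi> \<in> test_functions \<Omega>" by (rule test_functions_d_dzbar[OF \<phi>])
  note f = test_functionsD[OF \<phi>]
  have i: "integrable lborel (\<lambda>z. frechet_derivative \<phi> (at z) e)" for e
  proof (rule compact_support_integrable(2)[OF smooth_continuous[OF smooth_derivative[OF f(1)]]])
    show "compact (closure {z. frechet_derivative \<phi> (at z) e \<noteq> 0})"
      by (rule compact_closure_subset[OF f(2) closure_minimal[OF frechet_derivative_support[OF f(1)]]]) simp
  qed
  have "(LINT z|lebesgue_on \<Omega>. d_dzbar j \<phi> z) = (LINT z|lborel. d_dzbar j \<phi> z)"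
    by (rule integral_lebesgue_on_eq_lborel[OF \<Omega> smooth_continuous[OF test_functionsD(1)[OF T]] test_functions_eq_0[OF T]])
  also have "\<dots> = 0"
    unfolding d_dzbar_def using i by (simp add: integral_derivative_eq_0[OF f(1,2)])
  finally show ?thesis .
qed

lemma test_functions_integrable:
  assumes \<Omega>: "open \<Omega>" and \<phi>: "\<phi> \<in> test_functions \<Omega>"
  shows "\<phi> \<in> borel_measurable (lebesgue_on \<Omega>)" "\<exists>B. \<forall>z. cmod (\<phi> z) \<le> B" "integrable (lebesgue_on \<Omega>) \<phi>"
proof -
  note f = test_functionsD[OF \<phi>]
  have m: "\<phi> \<in> borel_measurable lborel"
    using smooth_continuous[OF f(1)] by (simp add: borel_measurable_continuous_onI)
  then show "\<phi> \<in> borel_measurable (lebesgue_on \<Omega>)"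
    by (intro measurable_restrict_space1 measurable_completion)
  show "\<exists>B. \<forall>z. cmod (\<phi> z) \<le> B"
    using compact_support_integrable(1)[OF smooth_continuous[OF f(1)] f(2)] unfolding bounded_iff by blast
  have "integrable lborel \<phi>"
    by (rule compact_support_integrable(2)[OF smooth_continuous[OF f(1)] f(2)])
  then have "integrable lebesgue \<phi>" using m by (simp add: integrable_completion)
  then have "integrable lebesgue (\<lambda>x. indicator \<Omega> x *\<^sub>R \<phi> x)"
    using \<Omega> by (intro integrable_mult_indicator) auto
  then show "integrable (lebesgue_on \<Omega>) \<phi>"
    using \<Omega> by (subst integrable_restrict_space) auto
qed

lemma integration_by_parts:
  assumes \<Omega>: "open \<Omega>" and \<phi>: "\<phi> \<in> test_functions \<Omega>" and \<psi>: "\<psi> \<in> test_functions \<Omega>"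
  shows "(LINT z|lebesgue_on \<Omega>. d_dzbar j \<phi> z * \<psi> z) = - (LINT z|lebesgue_on \<Omega>. \<phi> z * d_dzbar j \<psi> z)"
proof -
  note s = test_functionsD(1)[OF \<phi>] test_functionsD(1)[OF \<psi>]
  have i1: "integrable (lebesgue_on \<Omega>) (\<lambda>z. \<phi> z * d_dzbar j \<psi> z)"
    by (intro test_functions_integrable(3)[OF \<Omega>] test_functions_mult \<phi> smooth_d_dzbar s)
  have i2: "integrable (lebesgue_on \<Omega>) (\<lambda>z. d_dzbar j \<phi> z * \<psi> z)"
    by (intro test_functions_integrable(3)[OF \<Omega>] test_functions_mult test_functions_d_dzbar \<phi> s)
  have "(LINT z|lebesgue_on \<Omega>. \<phi> z * d_dzbar j \<psi> z + d_dzbar j \<phi> z * \<psi> z) = (LINT z|lebesgue_on \<Omega>. d_dzbar j (\<lambda>z. \<phi> z * \<psi> z) z)"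
    by (simp only: d_dzbar_mult[OF s])
  also have "\<dots> = 0" by (rule integral_d_dzbar_eq_0[OF \<Omega> test_functions_mult[OF \<phi> s(2)]])
  finally have "(LINT z|lebesgue_on \<Omega>. \<phi> z * d_dzbar j \<psi> z) + (LINT z|lebesgue_on \<Omega>. d_dzbar j \<phi> z * \<psi> z) = 0"
    by (simp only: Bochner_Integration.integral_add[OF i1 i2])
  then show ?thesis by (simp only: add_eq_0_iff)
qed

text \<open>Indicators of open sets are bounded limits of test functions, and measurable sets are, up to
  null sets, decreasing limits of open sets.\<close>

lemma integral_indicator_open_eq_0:
  fixes f :: "complex^'n::finite \<Rightarrow> complex"
  assumes \<Omega>: "open \<Omega>" and f: "integrable (lebesgue_on \<Omega>) f"
    and test: "\<And>\<phi>. \<phi> \<in> test_functions \<Omega> \<Longrightarrow> (LINT z|lebesgue_on \<Omega>. f z * \<phi> z) = 0"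
    and V: "open V" "V \<subseteq> \<Omega>"
  shows "(LINT z|lebesgue_on \<Omega>. f z * indicator V z) = 0"
proof -
  obtain \<phi> :: "nat \<Rightarrow> complex^'n \<Rightarrow> real" where \<phi>: "\<And>k. smooth_on UNIV (\<phi> k)"
    "\<And>k x. 0 \<le> \<phi> k x" "\<And>k x. \<phi> k x \<le> 1" "\<And>k. compact (closure {x. \<phi> k x \<noteq> 0})"
    "\<And>k. closure {x. \<phi> k x \<noteq> 0} \<subseteq> V" "\<And>x. (\<lambda>k. \<phi> k x) \<longlonglongrightarrow> indicator V x"
    using smooth_approx_indicator[OF V(1)] by blast
  have "{x. complex_of_real (\<phi> k x) \<noteq> 0} = {x. \<phi> k x \<noteq> 0}" for k by simp
  moreover have "smooth_on UNIV (\<lambda>z. complex_of_real (\<phi> k z))" for k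
    by (rule smooth_bounded_linear[OF bounded_linear_of_real \<phi>(1)])
  ultimately have T: "(\<lambda>z. complex_of_real (\<phi> k z)) \<in> test_functions \<Omega>" for k
    using \<phi>(4)[of k] order_trans[OF \<phi>(5)[of k] V(2)] unfolding test_functions_def by (simp only: mem_Collect_eq simp_thms)
  have [measurable]: "f \<in> borel_measurable (lebesgue_on \<Omega>)" using f by simp
  have [measurable]: "(\<lambda>z. complex_of_real (\<phi> k z)) \<in> borel_measurable (lebesgue_on \<Omega>)" for k
    by (rule test_functions_integrable(1)[OF \<Omega> T])
  have "V \<in> sets (lebesgue_on \<Omega>)" using V \<Omega> by (simp add: sets_restrict_space_iff)
  then have [measurable]: "(indicator V :: _ \<Rightarrow> complex) \<in> borel_measurable (lebesgue_on \<Omega>)" by simp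
  have "(\<lambda>k. LINT z|lebesgue_on \<Omega>. f z * of_real (\<phi> k z)) \<longlonglongrightarrow> (LINT z|lebesgue_on \<Omega>. f z * indicator V z)"
  proof (rule integral_dominated_convergence[where w = "\<lambda>z. cmod (f z)"])
    show "AE z in lebesgue_on \<Omega>. (\<lambda>k. f z * of_real (\<phi> k z)) \<longlonglongrightarrow> f z * indicator V z"
    proof (rule AE_I2)
      fix z
      have "(\<lambda>k. f z * of_real (\<phi> k z)) \<longlonglongrightarrow> f z * of_real (indicator V z)"
        by (intro tendsto_intros \<phi>(6))
      then show "(\<lambda>k. f z * of_real (\<phi> k z)) \<longlonglongrightarrow> f z * indicator V z"
        by (cases "z \<in> V") simp_all
    qed
    show "AE z in lebesgue_on \<Omega>. norm (f z * of_real (\<phi> k z)) \<le> cmod (f z)" for k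
    proof (rule AE_I2)
      fix z
      have "cmod (f z) * \<bar>\<phi> k z\<bar> \<le> cmod (f z) * 1" using \<phi>(2,3)[of k z] by (intro mult_left_mono) auto
      then show "norm (f z * of_real (\<phi> k z)) \<le> cmod (f z)" by (simp add: norm_mult)
    qed
  qed (use f in \<open>simp_all add: integrable_norm\<close>)
  then show ?thesis by (simp add: test[OF T] LIMSEQ_const_iff)
qed

lemma integral_indicator_eq_0:
  fixes f :: "complex^'n::finite \<Rightarrow> complex"
  assumes \<Omega>: "open \<Omega>" and f: "integrable (lebesgue_on \<Omega>) f"
    and test: "\<And>\<phi>. \<phi> \<in> test_functions \<Omega> \<Longrightarrow> (LINT z|lebesgue_on \<Omega>. f z * \<phi> z) = 0"
    and A: "A \<in> sets lebesgue" "A \<subseteq> \<Omega>"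
  shows "(LINT z|lebesgue_on \<Omega>. f z * indicator A z) = 0"
proof -
  have "\<exists>T. open T \<and> A \<subseteq> T \<and> T - A \<in> lmeasurable \<and> emeasure lebesgue (T - A) < ennreal (1 / Suc n)" for n
    by (rule sets_lebesgue_outer_open[OF A(1), of "1 / Suc n"]) (simp, blast)
  then obtain T where T: "\<And>n. open (T n)" "\<And>n. A \<subseteq> T n" "\<And>n. T n - A \<in> lmeasurable"
    "\<And>n. emeasure lebesgue (T n - A) < ennreal (1 / Suc n)"
    using choice[of "\<lambda>n T. open T \<and> A \<subseteq> T \<and> T - A \<in> lmeasurable \<and> emeasure lebesgue (T - A) < ennreal (1 / Suc n)"] by blast
  \<comment> \<open>The open sets \<open>W n\<close> decrease to \<open>G\<close>, a countable
    intersection containing \<open>A\<close> up to which only a null set is added.\<close>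
  define W where "W n = \<Omega> \<inter> (\<Inter>i\<le>n. T i)" for n
  define G where "G = \<Omega> \<inter> (\<Inter>i. T i)"
  have W: "open (W n)" "W n \<subseteq> \<Omega>" for n using \<Omega> T(1) by (auto simp: W_def)
  have W_sets: "W n \<in> sets (lebesgue_on \<Omega>)" for n using W \<Omega> by (simp add: sets_restrict_space_iff)
  have "G \<in> sets borel" unfolding G_def using \<Omega> T(1) by (intro sets.Int sets.countable_INT) auto
  then have GL: "G \<in> sets lebesgue" by auto
  have null: "G - A \<in> null_sets lebesgue"
  proof -
    have bound: "emeasure lebesgue (G - A) \<le> ennreal (1 / Suc n)" for n
    proof -
      have "emeasure lebesgue (G - A) \<le> emeasure lebesgue (T n - A)"
      proof (rule emeasure_mono)
        show "G - A \<subseteq> T n - A" unfolding G_def by blast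
        show "T n - A \<in> sets lebesgue" using T(3) by (rule fmeasurableD)
      qed
      then show ?thesis using T(4)[of n] by simp
    qed
    have lim: "(\<lambda>n. ennreal (1 / Suc n)) \<longlonglongrightarrow> ennreal 0"
      using LIMSEQ_inverse_real_of_nat by (intro tendsto_ennrealI) (simp add: inverse_eq_divide)
    have "emeasure lebesgue (G - A) \<le> ennreal 0"
      by (rule LIMSEQ_le_const[OF lim]) (use bound in blast)
    then have "emeasure lebesgue (G - A) = 0" by simp
    moreover have "G - A \<in> sets lebesgue" using GL A(1) by (rule sets.Diff)
    ultimately show ?thesis by (simp only: null_sets_def mem_Collect_eq simp_thms)
  qed
  have [measurable]: "f \<in> borel_measurable (lebesgue_on \<Omega>)" using f by simp
  have [measurable]: "(indicator (W n) :: _ \<Rightarrow> complex) \<in> borel_measurable (lebesgue_on \<Omega>)" for n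
    using W_sets by simp
  have A_sets: "A \<in> sets (lebesgue_on \<Omega>)" using A \<Omega> by (simp add: sets_restrict_space_iff)
  have [measurable]: "(indicator A :: _ \<Rightarrow> complex) \<in> borel_measurable (lebesgue_on \<Omega>)"
    using A_sets by simp
  have "AE z in lebesgue. z \<notin> G - A" using null by (rule AE_not_in)
  then have ae: "AE z in lebesgue_on \<Omega>. z \<notin> G - A"
    using \<Omega> by (subst AE_restrict_space_iff) auto
  have "(\<lambda>n. LINT z|lebesgue_on \<Omega>. f z * indicator (W n) z) \<longlonglongrightarrow> (LINT z|lebesgue_on \<Omega>. f z * indicator A z)"
  proof (rule integral_dominated_convergence[where w = "\<lambda>z. cmod (f z)"])
    show "AE z in lebesgue_on \<Omega>. (\<lambda>n. f z * indicator (W n) z) \<longlonglongrightarrow> f z * indicator A z"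
      using ae
    proof eventually_elim
      case (elim z)
      have "\<forall>\<^sub>F n in sequentially. f z * indicator (W n) z = f z * indicator A z"
      proof (cases "z \<in> A")
        case True
        then have "z \<in> W n" for n using A(2) T(2) by (auto simp: W_def)
        then show ?thesis using True by simp
      next
        case False
        then have "z \<notin> G" using elim by simp
        then obtain i where i: "z \<notin> \<Omega> \<or> z \<notin> T i" by (auto simp: G_def)
        show ?thesis
          using eventually_ge_at_top[of i]
        proof eventually_elim
          case (elim n)
          then have "z \<notin> W n" using i by (auto simp: W_def)
          then show ?case using False by simp
        qed
      qed
      then show ?case by (rule tendsto_eventually)
    qed
    show "AE z in lebesgue_on \<Omega>. norm (f z * indicator (W n) z) \<le> cmod (f z)" for n
      by (rule AE_I2) (simp add: norm_mult indicator_def)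
  qed (use f in \<open>simp_all add: integrable_norm\<close>)
  then show ?thesis
    by (simp add: integral_indicator_open_eq_0[OF \<Omega> f test W] LIMSEQ_const_iff)
qed

text \<open>Integrating c f over the set where Re (c f) > 0 gives 0, so that set is null for each
  complex c. The choices 1, -1, \<i> and -\<i> together force f = 0 almost everywhere.\<close>

theorem fundamental_lemma:
  fixes f :: "complex^'n::finite \<Rightarrow> complex"
  assumes \<Omega>: "open \<Omega>" and f: "integrable (lebesgue_on \<Omega>) f"
    and test: "\<And>\<phi>. \<phi> \<in> test_functions \<Omega> \<Longrightarrow> (LINT z|lebesgue_on \<Omega>. f z * \<phi> z) = 0"
  shows "AE z in lebesgue_on \<Omega>. f z = 0"
proof -
  let ?M = "lebesgue_on \<Omega>"
  have le: "AE z in ?M. Re (c * f z) \<le> 0" for c :: complex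
  proof -
    have m[measurable]: "f \<in> borel_measurable ?M" using f by simp
    define A where "A = {z \<in> space ?M. Re (c * f z) > 0}"
    have A: "A \<in> sets ?M" unfolding A_def by measurable
    then have AL: "A \<in> sets lebesgue" "A \<subseteq> \<Omega>" using \<Omega> by (auto simp: sets_restrict_space_iff)
    have [measurable]: "(indicator A :: _ \<Rightarrow> complex) \<in> borel_measurable ?M" using A by simp
    have i: "integrable ?M (\<lambda>z. f z * indicator A z)"
    proof (rule Bochner_Integration.integrable_bound[OF f])
      show "AE z in ?M. norm (f z * indicator A z) \<le> norm (f z)"
        by (rule AE_I2) (simp add: norm_mult indicator_def)
    qed measurable
    have "Re (c * (LINT z|?M. f z * indicator A z)) = 0"
      by (simp add: integral_indicator_eq_0[OF \<Omega> f test AL])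
    also have "c * (LINT z|?M. f z * indicator A z) = (LINT z|?M. c * (f z * indicator A z))" by simp
    also have "Re \<dots> = (LINT z|?M. Re (c * (f z * indicator A z)))"
      using i by (intro integral_Re[symmetric]) simp
    finally have 0: "(LINT z|?M. Re (c * (f z * indicator A z))) = 0" .
    have ci: "integrable ?M (\<lambda>z. c * (f z * indicator A z))" using i by (rule integrable_mult_right)
    have nonneg: "0 \<le> Re (c * (f z * indicator A z))" for z
    proof (cases "z \<in> A")
      case True
      then have "Re (c * f z) > 0" by (simp only: A_def mem_Collect_eq)
      then show ?thesis using True by simp
    qed simp
    have "AE z in ?M. Re (c * (f z * indicator A z)) = 0"
      using 0 integral_nonneg_eq_0_iff_AE[OF integrable_Re[OF ci] AE_I2[OF nonneg]] by blast
    then show ?thesis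
      using AE_space
    proof eventually_elim
      case (elim z)
      show ?case
      proof (cases "z \<in> A")
        case True
        then show ?thesis using elim(1) by simp
      next
        case False
        then show ?thesis using elim(2) unfolding A_def by (simp only: mem_Collect_eq simp_thms not_less)
      qed
    qed
  qed
  show ?thesis
    using le[of 1] le[of "-1"] le[of \<i>] le[of "-\<i>"]
    by eventually_elim (simp add: complex_eq_iff)
qed

section \<open>Square-integrable forms\<close>

definition form_lc :: "complex \<Rightarrow> 'n::finite form \<Rightarrow> complex \<Rightarrow> 'n form \<Rightarrow> 'n form" where
  "form_lc a u b v = (\<lambda>J z. a * u J z + b * v J z)"

definition zero_form :: "'n::finite form" where "zero_form = (\<lambda>J z. 0)"

definition single_form :: "'n::finite set \<Rightarrow> (complex^'n \<Rightarrow> complex) \<Rightarrow> 'n form" where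
  "single_form K \<phi> = (\<lambda>J. if J = K then \<phi> else (\<lambda>z. 0))"

text \<open>The formal adjoint of the Cauchy--Riemann operator, applied to \<open>single_form K \<phi>\<close>.\<close>

definition formal_adjoint ::
    "'n::{finite,linorder} set \<Rightarrow> (complex^'n::{finite,linorder} \<Rightarrow> complex) \<Rightarrow> 'n form" where
  "formal_adjoint K \<phi> = (\<lambda>J z. - cnj (\<Sum>j\<in>UNIV. wedge_coeff j J K * d_dzbar j (\<lambda>w. cnj (\<phi> w)) z))"

lemma form_eq_refl: "form_eq \<Omega> q u u"
  by (simp add: form_eq_def)

lemma form_eq_trans:
  assumes "form_eq \<Omega> q u v" "form_eq \<Omega> q v w"
  shows "form_eq \<Omega> q u w"
  unfolding form_eq_def
proof (intro allI impI)
  fix J :: "'a set" assume "card J = q"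
  then have "AE z in lebesgue_on \<Omega>. u J z = v J z" "AE z in lebesgue_on \<Omega>. v J z = w J z"
    using assms by (simp_all add: form_eq_def)
  then show "AE z in lebesgue_on \<Omega>. u J z = w J z" by eventually_elim simp
qed

lemma form_eq_lc:
  assumes "form_eq \<Omega> q u u'" "form_eq \<Omega> q v v'"
  shows "form_eq \<Omega> q (form_lc a u b v) (form_lc a u' b v')"
  unfolding form_eq_def
proof (intro allI impI)
  fix J :: "'a set" assume "card J = q"
  then have "AE z in lebesgue_on \<Omega>. u J z = u' J z" "AE z in lebesgue_on \<Omega>. v J z = v' J z"
    using assms by (simp_all add: form_eq_def)
  then show "AE z in lebesgue_on \<Omega>. form_lc a u b v J z = form_lc a u' b v' J z"
    by eventually_elim (simp add: form_lc_def)
qed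

lemma Lp_forms_2_iff:
  "u \<in> Lp_forms \<Omega> 2 q \<longleftrightarrow> (\<forall>J. card J = q \<longrightarrow> u J \<in> borel_measurable (lebesgue_on \<Omega>)
      \<and> integrable (lebesgue_on \<Omega>) (\<lambda>z. (cmod (u J z))\<^sup>2))"
  by (simp add: Lp_forms_def powr_numeral)

lemma borel_measurable_cnj [measurable (raw)]:
  assumes "g \<in> borel_measurable M"
  shows "(\<lambda>z. cnj (g z)) \<in> borel_measurable M"
  by (rule borel_measurable_continuous_on[OF _ assms]) (intro continuous_intros)

lemma L2_mult_integrable:
  fixes f g :: "'a \<Rightarrow> complex"
  assumes [measurable]: "f \<in> borel_measurable M" "g \<in> borel_measurable M"
    and "integrable M (\<lambda>z. (cmod (f z))\<^sup>2)" "integrable M (\<lambda>z. (cmod (g z))\<^sup>2)"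
  shows "integrable M (\<lambda>z. f z * cnj (g z))"
proof (rule Bochner_Integration.integrable_bound)
  show "integrable M (\<lambda>z. (cmod (f z))\<^sup>2 + (cmod (g z))\<^sup>2)"
    using assms(3,4) by (rule Bochner_Integration.integrable_add)
  show "AE z in M. norm (f z * cnj (g z)) \<le> norm ((cmod (f z))\<^sup>2 + (cmod (g z))\<^sup>2)"
  proof (rule AE_I2)
    fix z
    have "0 \<le> (cmod (f z) - cmod (g z))\<^sup>2" by simp
    then have "2 * (cmod (f z) * cmod (g z)) \<le> (cmod (f z))\<^sup>2 + (cmod (g z))\<^sup>2"
      by (simp add: power2_diff)
    moreover have "0 \<le> cmod (f z) * cmod (g z)" by simp
    ultimately have "cmod (f z) * cmod (g z) \<le> (cmod (f z))\<^sup>2 + (cmod (g z))\<^sup>2" by linarith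
    then show "norm (f z * cnj (g z)) \<le> norm ((cmod (f z))\<^sup>2 + (cmod (g z))\<^sup>2)"
      by (simp add: norm_mult)
  qed
qed simp

lemma L2_lc_integrable:
  fixes f g :: "'a \<Rightarrow> complex"
  assumes [measurable]: "f \<in> borel_measurable M" "g \<in> borel_measurable M"
    and "integrable M (\<lambda>z. (cmod (f z))\<^sup>2)" "integrable M (\<lambda>z. (cmod (g z))\<^sup>2)"
  shows "integrable M (\<lambda>z. (cmod (a * f z + b * g z))\<^sup>2)"
proof (rule Bochner_Integration.integrable_bound)
  show "integrable M (\<lambda>z. 2 * (cmod a)\<^sup>2 * (cmod (f z))\<^sup>2 + 2 * (cmod b)\<^sup>2 * (cmod (g z))\<^sup>2)"
    using assms(3,4) by simp
  show "AE z in M. norm ((cmod (a * f z + b * g z))\<^sup>2) \<le> norm (2 * (cmod a)\<^sup>2 * (cmod (f z))\<^sup>2 + 2 * (cmod b)\<^sup>2 * (cmod (g z))\<^sup>2)"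
  proof (rule AE_I2)
    fix z
    define s t where "s = cmod a * cmod (f z)" and "t = cmod b * cmod (g z)"
    have "cmod (a * f z + b * g z) \<le> s + t"
      unfolding s_def t_def norm_mult[symmetric] by (rule norm_triangle_ineq)
    then have "(cmod (a * f z + b * g z))\<^sup>2 \<le> (s + t)\<^sup>2" by (intro power_mono) auto
    also have "\<dots> \<le> 2 * s\<^sup>2 + 2 * t\<^sup>2"
      using zero_le_power2[of "s - t"] by (simp add: power2_sum power2_diff)
    finally show "norm ((cmod (a * f z + b * g z))\<^sup>2) \<le> norm (2 * (cmod a)\<^sup>2 * (cmod (f z))\<^sup>2 + 2 * (cmod b)\<^sup>2 * (cmod (g z))\<^sup>2)"
      by (simp add: s_def t_def power_mult_distrib)
  qed
qed simp

lemma form_lc_L2: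
  assumes "u \<in> Lp_forms \<Omega> 2 q" "v \<in> Lp_forms \<Omega> 2 q"
  shows "form_lc a u b v \<in> Lp_forms \<Omega> 2 q"
proof -
  have "form_lc a u b v J \<in> borel_measurable (lebesgue_on \<Omega>)
      \<and> integrable (lebesgue_on \<Omega>) (\<lambda>z. (cmod (form_lc a u b v J z))\<^sup>2)" if "card J = q" for J
  proof -
    have "u J \<in> borel_measurable (lebesgue_on \<Omega>)" "integrable (lebesgue_on \<Omega>) (\<lambda>z. (cmod (u J z))\<^sup>2)"
      "v J \<in> borel_measurable (lebesgue_on \<Omega>)" "integrable (lebesgue_on \<Omega>) (\<lambda>z. (cmod (v J z))\<^sup>2)"
      using assms that by (simp_all add: Lp_forms_2_iff)
    then show ?thesis
      unfolding form_lc_def by (intro conjI L2_lc_integrable borel_measurable_add borel_measurable_times borel_measurable_const)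
  qed
  then show ?thesis unfolding Lp_forms_2_iff by blast
qed

lemma zero_form_L2: "zero_form \<in> Lp_forms \<Omega> 2 q"
  by (simp add: Lp_forms_2_iff zero_form_def)

lemma L2_inner_sum:
  assumes "u \<in> Lp_forms \<Omega> 2 q" "v \<in> Lp_forms \<Omega> 2 q"
  shows "L2_inner \<Omega> q u v = (\<Sum>J | card J = q. LINT z|lebesgue_on \<Omega>. u J z * cnj (v J z))"
  unfolding L2_inner_def using assms
  by (intro Bochner_Integration.integral_sum L2_mult_integrable) (auto simp: Lp_forms_2_iff)

lemma L2_inner_lc:
  assumes "u \<in> Lp_forms \<Omega> 2 q" "v \<in> Lp_forms \<Omega> 2 q" "w \<in> Lp_forms \<Omega> 2 q"
  shows "L2_inner \<Omega> q (form_lc a u b v) w = a * L2_inner \<Omega> q u w + b * L2_inner \<Omega> q v w"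
proof -
  have "(LINT z|lebesgue_on \<Omega>. form_lc a u b v J z * cnj (w J z))
      = a * (LINT z|lebesgue_on \<Omega>. u J z * cnj (w J z)) + b * (LINT z|lebesgue_on \<Omega>. v J z * cnj (w J z))"
    if "card J = q" for J
  proof -
    have i: "integrable (lebesgue_on \<Omega>) (\<lambda>z. u J z * cnj (w J z))" "integrable (lebesgue_on \<Omega>) (\<lambda>z. v J z * cnj (w J z))"
      using assms that by (auto simp: Lp_forms_2_iff intro!: L2_mult_integrable)
    have "(LINT z|lebesgue_on \<Omega>. form_lc a u b v J z * cnj (w J z))
        = (LINT z|lebesgue_on \<Omega>. a * (u J z * cnj (w J z)) + b * (v J z * cnj (w J z)))"
      by (simp add: form_lc_def algebra_simps)
    then show ?thesis using i by simp
  qed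
  then show ?thesis
    using assms by (simp add: L2_inner_sum form_lc_L2 sum.distrib sum_distrib_left)
qed

lemma L2_inner_cnj: "L2_inner \<Omega> q v u = cnj (L2_inner \<Omega> q u v)"
proof -
  have "L2_inner \<Omega> q v u = (LINT z|lebesgue_on \<Omega>. cnj (\<Sum>J | card J = q. u J z * cnj (v J z)))"
    unfolding L2_inner_def by (intro Bochner_Integration.integral_cong refl) (simp add: mult.commute)
  also have "\<dots> = cnj (L2_inner \<Omega> q u v)"
    unfolding L2_inner_def by (rule Bochner_Integration.integral_cnj)
  finally show ?thesis .
qed

lemma L2_inner_self: "L2_inner \<Omega> q u u = of_real (LINT z|lebesgue_on \<Omega>. (form_abs q u z)\<^sup>2)"
proof -
  have "(\<Sum>J | card J = q. u J z * cnj (u J z)) = of_real ((form_abs q u z)\<^sup>2)" for z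
  proof -
    have "(form_abs q u z)\<^sup>2 = (\<Sum>J | card J = q. (cmod (u J z))\<^sup>2)"
      unfolding form_abs_def by (intro real_sqrt_pow2 sum_nonneg) simp
    then show ?thesis by (simp only: of_real_sum complex_norm_square)
  qed
  then show ?thesis unfolding L2_inner_def by (simp only: integral_complex_of_real)
qed

lemma semi_inner_L2: "semi_inner (Lp_forms \<Omega> 2 q) form_lc (L2_inner \<Omega> q)"
proof
  show "Lp_forms \<Omega> 2 q \<noteq> {}" using zero_form_L2 by blast
  show "L2_inner \<Omega> q v u = cnj (L2_inner \<Omega> q u v)" for u v by (rule L2_inner_cnj)
  show "0 \<le> Re (L2_inner \<Omega> q u u)" for u by (simp add: L2_inner_self)
qed (simp_all add: form_lc_L2 L2_inner_lc)

text \<open>Boundedness makes the measure finite. Square integrable coefficients are then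
  integrable, which is what \<open>fundamental_lemma\<close> asks for.\<close>

locale bounded_open =
  fixes \<Omega> :: "(complex^'n::{finite,linorder}) set"
  assumes open_domain: "open \<Omega>" and bounded_domain: "bounded \<Omega>"
begin

abbreviation "M \<equiv> lebesgue_on \<Omega>"
abbreviation "L2 \<equiv> Lp_forms \<Omega> 2"
abbreviation "ip \<equiv> L2_inner \<Omega>"
abbreviation "test \<equiv> test_functions \<Omega>"

sublocale L2: semi_inner "Lp_forms \<Omega> 2 q" form_lc "L2_inner \<Omega> q" for q
  by (rule semi_inner_L2)

abbreviation "nsq \<equiv> L2.sqn"

lemma L2_sqn: "nsq q u = (LINT z|lebesgue_on \<Omega>. (form_abs q u z)\<^sup>2)"
  by (simp add: L2.sqn_def L2_inner_self)

lemma Lp_norm_2: "Lp_norm \<Omega> 2 q u = sqrt (nsq q u)"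
proof -
  have "form_abs q u z powr 2 = (form_abs q u z)\<^sup>2" for z
    by (simp add: form_abs_def powr_numeral sum_nonneg)
  then show ?thesis
    by (simp add: Lp_norm_def L2_sqn powr_half_sqrt)
qed


lemma domain_lmeasurable: "\<Omega> \<in> lmeasurable"
  using open_domain bounded_domain by (simp add: bounded_set_imp_lmeasurable)

sublocale finite_measure M
  using domain_lmeasurable by (rule finite_measure_lebesgue_on)

lemma L2_component:
  assumes "u \<in> L2 q" "card J = q"
  shows "u J \<in> borel_measurable M" "integrable M (\<lambda>z. (cmod (u J z))\<^sup>2)" "integrable M (u J)"
proof -
  show m: "u J \<in> borel_measurable M" and i: "integrable M (\<lambda>z. (cmod (u J z))\<^sup>2)"
    using assms by (simp_all add: Lp_forms_2_iff)
  have "integrable M (\<lambda>z. u J z * cnj 1)"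
    by (rule L2_mult_integrable[OF m]) (use i in simp_all)
  then show "integrable M (u J)" by simp
qed

lemma nsq_eq_sum:
  assumes "u \<in> L2 q"
  shows "nsq q u = (\<Sum>J | card J = q. LINT z|M. (cmod (u J z))\<^sup>2)"
proof -
  have "(form_abs q u z)\<^sup>2 = (\<Sum>J | card J = q. (cmod (u J z))\<^sup>2)" for z
    unfolding form_abs_def by (intro real_sqrt_pow2 sum_nonneg) simp
  then show ?thesis
    unfolding L2_sqn using L2_component(2)[OF assms] by (simp add: Bochner_Integration.integral_sum)
qed

lemma nsq_eq_0_imp:
  assumes "u \<in> L2 q" "nsq q u = 0"
  shows "form_eq \<Omega> q u zero_form"
  unfolding form_eq_def
proof (intro allI impI)
  fix J :: "'n set" assume J: "card J = q"
  have "(LINT z|M. (cmod (u J z))\<^sup>2) \<le> (\<Sum>J | card J = q. LINT z|M. (cmod (u J z))\<^sup>2)"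
    by (rule member_le_sum) (use J in auto)
  then have "(LINT z|M. (cmod (u J z))\<^sup>2) = 0"
    unfolding nsq_eq_sum[OF assms(1), symmetric] assms(2) by (intro antisym Bochner_Integration.integral_nonneg) auto
  then have "AE z in M. (cmod (u J z))\<^sup>2 = 0"
    using integral_nonneg_eq_0_iff_AE[OF L2_component(2)[OF assms(1) J]] by simp
  then show "AE z in M. u J z = zero_form J z" by eventually_elim (simp add: zero_form_def)
qed

lemma form_eq_iff_diff: "form_eq \<Omega> q (form_lc 1 u (-1) v) zero_form \<longleftrightarrow> form_eq \<Omega> q u v"
  by (simp add: form_eq_def form_lc_def zero_form_def)

lemma nsq_diff_eq_0_imp:
  assumes "u \<in> L2 q" "v \<in> L2 q" "nsq q (form_lc 1 u (-1) v) = 0"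
  shows "form_eq \<Omega> q u v"
  using nsq_eq_0_imp[OF form_lc_L2[OF assms(1,2)] assms(3)] by (simp only: form_eq_iff_diff)

text \<open>Allows a representative returned by \<open>dbar\<close> or \<open>dbar_star\<close> to
  be exchanged for a known one inside an inner product.\<close>

lemma ip_cong:
  assumes L: "u \<in> L2 q" "u' \<in> L2 q" "v \<in> L2 q" "v' \<in> L2 q"
    and eq: "form_eq \<Omega> q u u'" "form_eq \<Omega> q v v'"
  shows "ip q u v = ip q u' v'"
proof -
  have "(LINT z|M. u J z * cnj (v J z)) = (LINT z|M. u' J z * cnj (v' J z))" if J: "card J = q" for J
  proof (rule Bochner_Integration.integral_cong_AE)
    have "AE z in M. u J z = u' J z" "AE z in M. v J z = v' J z"
      using eq J by (simp_all add: form_eq_def)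
    then show "AE z in M. u J z * cnj (v J z) = u' J z * cnj (v' J z)" by eventually_elim simp
  qed (intro borel_measurable_times borel_measurable_cnj L2_component(1)[OF _ J] L)+
  then show ?thesis using L by (simp add: L2_inner_sum)
qed

lemma ip_zero: "ip q zero_form v = 0" "ip q u zero_form = 0"
  by (simp_all add: L2_inner_def zero_form_def)

lemma nsq_cong:
  assumes "u \<in> L2 q" "u' \<in> L2 q" "form_eq \<Omega> q u u'"
  shows "nsq q u = nsq q u'"
  using ip_cong[OF assms(1,2,1,2,3,3)] by (simp add: L2.sqn_def)

lemma L2_complete_carrier: "L2.complete_carrier q"
  unfolding L2.complete_carrier_def
proof (intro allI impI)
  fix s :: "nat \<Rightarrow> 'n form" assume "L2.cauchy_seq q s"
  then have s: "\<And>k. s k \<in> L2 q"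
    and c: "\<And>e. e > 0 \<Longrightarrow> \<exists>N. \<forall>m\<ge>N. \<forall>n\<ge>N. nsq q (form_lc 1 (s m) (-1) (s n)) < e"
    unfolding L2.cauchy_seq_def by blast+
  have comp_le: "(LINT z|M. (cmod (s m J z - s n J z))\<^sup>2) \<le> nsq q (form_lc 1 (s m) (-1) (s n))"
    if J: "card J = q" for J m n
  proof -
    have "(LINT z|M. (cmod (form_lc 1 (s m) (-1) (s n) J z))\<^sup>2) \<le> nsq q (form_lc 1 (s m) (-1) (s n))"
      unfolding nsq_eq_sum[OF form_lc_L2[OF s s]] by (rule member_le_sum) (use J in auto)
    then show ?thesis by (simp add: form_lc_def)
  qed
  have "\<exists>g. g \<in> borel_measurable M \<and> integrable M (\<lambda>x. (cmod (g x))\<^sup>2)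
     \<and> (\<lambda>k. LINT x|M. (cmod (s k J x - g x))\<^sup>2) \<longlonglongrightarrow> 0" if J: "card J = q" for J
  proof (rule L2_complete)
    show "s k J \<in> borel_measurable M" "integrable M (\<lambda>z. (cmod (s k J z))\<^sup>2)" for k
      by (rule L2_component[OF s J])+
    show "\<exists>N. \<forall>m\<ge>N. \<forall>n\<ge>N. (LINT x|M. (cmod (s m J x - s n J x))\<^sup>2) < e" if "e > 0" for e
    proof -
      obtain N where "\<forall>m\<ge>N. \<forall>n\<ge>N. nsq q (form_lc 1 (s m) (-1) (s n)) < e" using c[OF \<open>e > 0\<close>] by blast
      then have "(LINT x|M. (cmod (s m J x - s n J x))\<^sup>2) < e" if "m \<ge> N" "n \<ge> N" for m n
        using le_less_trans[OF comp_le[OF J]] that by blast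
      then show ?thesis by blast
    qed
  qed
  then have "\<forall>J. \<exists>g. card J = q \<longrightarrow> g \<in> borel_measurable M \<and> integrable M (\<lambda>x. (cmod (g x))\<^sup>2)
     \<and> (\<lambda>k. LINT x|M. (cmod (s k J x - g x))\<^sup>2) \<longlonglongrightarrow> 0" by blast
  from choice[OF this]
  obtain g where g: "\<And>J. card J = q \<Longrightarrow> g J \<in> borel_measurable M"
    "\<And>J. card J = q \<Longrightarrow> integrable M (\<lambda>x. (cmod (g J x))\<^sup>2)"
    "\<And>J. card J = q \<Longrightarrow> (\<lambda>k. LINT x|M. (cmod (s k J x - g J x))\<^sup>2) \<longlonglongrightarrow> 0"
    by blast
  have gL: "g \<in> L2 q" using g(1,2) by (simp add: Lp_forms_2_iff)
  have "(\<lambda>k. \<Sum>J | card J = q. LINT x|M. (cmod (s k J x - g J x))\<^sup>2) \<longlonglongrightarrow> (\<Sum>J :: 'n set | card J = q. 0)"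
    by (intro tendsto_sum g(3)) simp
  moreover have "nsq q (form_lc 1 (s k) (-1) g) = (\<Sum>J | card J = q. LINT x|M. (cmod (s k J x - g J x))\<^sup>2)" for k
    by (subst nsq_eq_sum[OF form_lc_L2[OF s gL]]) (simp add: form_lc_def)
  ultimately have "(\<lambda>k. nsq q (form_lc 1 (s k) (-1) g)) \<longlonglongrightarrow> 0"
    by (simp only: sum.neutral_const)
  then show "\<exists>u\<in>L2 q. (\<lambda>k. nsq q (form_lc 1 (s k) (-1) u)) \<longlonglongrightarrow> 0" using gL by blast
qed

section \<open>Pairing with test forms and the formal adjoint\<close>

lemma test_L2:
  assumes "\<phi> \<in> test"
  shows "\<phi> \<in> borel_measurable M" "integrable M (\<lambda>z. (cmod (\<phi> z))\<^sup>2)"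
proof -
  show m: "\<phi> \<in> borel_measurable M" by (rule test_functions_integrable(1)[OF open_domain assms])
  obtain B where B: "\<And>z. cmod (\<phi> z) \<le> B" using test_functions_integrable(2)[OF open_domain assms] by blast
  show "integrable M (\<lambda>z. (cmod (\<phi> z))\<^sup>2)"
  proof (rule integrable_const_bound[where B = "B\<^sup>2"])
    show "AE z in M. norm ((cmod (\<phi> z))\<^sup>2) \<le> B\<^sup>2"
    proof (rule AE_I2)
      fix z
      have "(cmod (\<phi> z))\<^sup>2 \<le> B\<^sup>2" using B by (intro power_mono) auto
      then show "norm ((cmod (\<phi> z))\<^sup>2) \<le> B\<^sup>2" by simp
    qed
  qed (use m in simp)
qed

lemma single_form_L2: "\<phi> \<in> test \<Longrightarrow> single_form K \<phi> \<in> L2 q"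
  using test_L2 by (simp add: Lp_forms_2_iff single_form_def)

lemma ip_single_form:
  assumes "card K = q"
  shows "ip q (single_form K \<phi>) u = (LINT z|M. \<phi> z * cnj (u K z))"
proof -
  have "(\<Sum>J | card J = q. single_form K \<phi> J z * cnj (u J z)) = \<phi> z * cnj (u K z)" for z
  proof -
    have "(\<Sum>J | card J = q. single_form K \<phi> J z * cnj (u J z)) = (\<Sum>J | card J = q. if J = K then \<phi> z * cnj (u K z) else 0)"
      by (intro sum.cong refl) (simp add: single_form_def)
    also have "\<dots> = \<phi> z * cnj (u K z)"
      using assms by (subst sum.delta) simp_all
    finally show ?thesis .
  qed
  then show ?thesis by (simp only: L2_inner_def)
qed

text \<open>Pairing with \<open>single_form K \<phi>\<close> isolates the coefficient with index K,
  to which the fundamental lemma applies. Uniqueness of the images under both operators rests on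
  this.\<close>

lemma single_forms_separate:
  assumes u: "u \<in> L2 q" and v: "v \<in> L2 q"
    and eq: "\<And>K \<phi>. card K = q \<Longrightarrow> \<phi> \<in> test \<Longrightarrow> ip q (single_form K \<phi>) u = ip q (single_form K \<phi>) v"
  shows "form_eq \<Omega> q u v"
  unfolding form_eq_def
proof (intro allI impI)
  fix K :: "'n set" assume K: "card K = q"
  note uv = L2_component(3)[OF u K] L2_component(3)[OF v K]
  have i: "integrable M (\<lambda>z. cnj (u K z) - cnj (v K z))"
    by (intro Bochner_Integration.integrable_diff integrable_cnj uv)
  have "AE z in M. cnj (u K z) - cnj (v K z) = 0"
  proof (rule fundamental_lemma[OF open_domain i])
    fix \<phi> assume \<phi>: "\<phi> \<in> test"
    have i2: "integrable M (\<lambda>z. \<phi> z * cnj (w K z))" if "w \<in> L2 q" for w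
      by (intro L2_mult_integrable test_L2 \<phi> L2_component[OF that K])
    have "(LINT z|M. (cnj (u K z) - cnj (v K z)) * \<phi> z) = (LINT z|M. \<phi> z * cnj (u K z) - \<phi> z * cnj (v K z))"
      by (simp add: algebra_simps)
    also have "\<dots> = (LINT z|M. \<phi> z * cnj (u K z)) - (LINT z|M. \<phi> z * cnj (v K z))"
      by (rule Bochner_Integration.integral_diff[OF i2[OF u] i2[OF v]])
    also have "\<dots> = 0" using eq[OF K \<phi>] by (simp add: ip_single_form[OF K])
    finally show "(LINT z|M. (cnj (u K z) - cnj (v K z)) * \<phi> z) = 0" .
  qed
  then show "AE z in M. u K z = v K z" by eventually_elim simp
qed

lemma formal_adjoint_L2:
  assumes "\<phi> \<in> test"
  shows "formal_adjoint K \<phi> \<in> L2 q"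
proof -
  note T = test_functions_d_dzbar[OF test_functions_cnj[OF assms]]
  have fin: "(\<lambda>z. \<Sum>j\<in>A. c j * d_dzbar j (\<lambda>w. cnj (\<phi> w)) z) \<in> borel_measurable M
    \<and> integrable M (\<lambda>z. (cmod (\<Sum>j\<in>A. c j * d_dzbar j (\<lambda>w. cnj (\<phi> w)) z))\<^sup>2)" if "finite A" for A c
    using that
  proof induction
    case (insert j A)
    have "integrable M (\<lambda>z. (cmod (c j * d_dzbar j (\<lambda>w. cnj (\<phi> w)) z + 1 * (\<Sum>j\<in>A. c j * d_dzbar j (\<lambda>w. cnj (\<phi> w)) z)))\<^sup>2)"
      using insert.IH by (intro L2_lc_integrable test_L2[OF T]) auto
    moreover have "(\<lambda>z. c j * d_dzbar j (\<lambda>w. cnj (\<phi> w)) z) \<in> borel_measurable M"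
      by (intro borel_measurable_times borel_measurable_const test_L2(1)[OF T])
    ultimately show ?case using insert by (simp add: borel_measurable_add)
  qed simp
  have "(\<lambda>z. \<Sum>j\<in>UNIV. wedge_coeff j J K * d_dzbar j (\<lambda>w. cnj (\<phi> w)) z) \<in> borel_measurable M"
    "integrable M (\<lambda>z. (cmod (\<Sum>j\<in>UNIV. wedge_coeff j J K * d_dzbar j (\<lambda>w. cnj (\<phi> w)) z))\<^sup>2)" for J
    by (rule conjunct1[OF fin[OF finite]], rule conjunct2[OF fin[OF finite]])
  then show ?thesis
    unfolding Lp_forms_2_iff formal_adjoint_def norm_minus_cancel complex_mod_cnj
    by (intro allI impI conjI borel_measurable_uminus borel_measurable_cnj)
qed

lemma ip_formal_adjoint:
  assumes h: "h \<in> L2 q" and \<phi>: "\<phi> \<in> test"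
  shows "ip q h (formal_adjoint K \<phi>)
    = (\<Sum>j\<in>UNIV. \<Sum>J | card J = q. wedge_coeff j J K * - (LINT z|M. h J z * d_dzbar j (\<lambda>w. cnj (\<phi> w)) z))"
proof -
  note T = test_functions_d_dzbar[OF test_functions_cnj[OF \<phi>]]
  have i: "integrable M (\<lambda>z. h J z * d_dzbar j (\<lambda>w. cnj (\<phi> w)) z)" if "card J = q" for J j
  proof -
    have "integrable M (\<lambda>z. h J z * cnj (cnj (d_dzbar j (\<lambda>w. cnj (\<phi> w)) z)))"
      by (rule L2_mult_integrable[OF L2_component(1)[OF h that] borel_measurable_cnj[OF test_L2(1)[OF T]] L2_component(2)[OF h that]])
        (use test_L2(2)[OF T] in simp)
    then show ?thesis by simp
  qed
  have "(LINT z|M. h J z * cnj (formal_adjoint K \<phi> J z))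
      = (\<Sum>j\<in>UNIV. wedge_coeff j J K * - (LINT z|M. h J z * d_dzbar j (\<lambda>w. cnj (\<phi> w)) z))" if J: "card J = q" for J
  proof -
    have "(LINT z|M. h J z * cnj (formal_adjoint K \<phi> J z))
      = (LINT z|M. (\<Sum>j\<in>UNIV. - wedge_coeff j J K * (h J z * d_dzbar j (\<lambda>w. cnj (\<phi> w)) z)))"
      by (simp add: formal_adjoint_def sum_distrib_left sum_negf mult_ac)
    also have "\<dots> = (\<Sum>j\<in>UNIV. LINT z|M. - wedge_coeff j J K * (h J z * d_dzbar j (\<lambda>w. cnj (\<phi> w)) z))"
      by (intro Bochner_Integration.integral_sum integrable_mult_right i J)
    finally show ?thesis by simp
  qed
  then have "ip q h (formal_adjoint K \<phi>)
      = (\<Sum>J | card J = q. \<Sum>j\<in>UNIV. wedge_coeff j J K * - (LINT z|M. h J z * d_dzbar j (\<lambda>w. cnj (\<phi> w)) z))"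
    by (simp add: L2_inner_sum[OF h formal_adjoint_L2[OF \<phi>]])
  also have "\<dots> = (\<Sum>j\<in>UNIV. \<Sum>J | card J = q. wedge_coeff j J K * - (LINT z|M. h J z * d_dzbar j (\<lambda>w. cnj (\<phi> w)) z))"
    by (rule sum.swap)
  finally show ?thesis .
qed

text \<open>\<open>weak_dbar\<close> pairs without conjugation and \<open>ip\<close> with it;
  replacing \<phi> by its conjugate translates one into the other. As an identity between inner
  products the relation is visibly linear and stable under limits.\<close>

lemma weak_dbar_iff:
  assumes u: "u \<in> L2 q" and v: "v \<in> L2 (Suc q)"
  shows "weak_dbar \<Omega> q u v \<longleftrightarrow> (\<forall>K \<phi>. card K = Suc q \<longrightarrow> \<phi> \<in> test \<longrightarrow>
    ip (Suc q) (single_form K \<phi>) v = ip q (formal_adjoint K \<phi>) u)"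
proof -
  have eq: "(LINT z|M. v K z * cnj (\<phi> z)) =
     (\<Sum>j\<in>UNIV. \<Sum>J | card J = q. wedge_coeff j J K * - (LINT z|M. u J z * d_dzbar j (\<lambda>w. cnj (\<phi> w)) z))
     \<longleftrightarrow> ip (Suc q) (single_form K \<phi>) v = ip q (formal_adjoint K \<phi>) u"
    if K: "card K = Suc q" and \<phi>: "\<phi> \<in> test" for K \<phi>
  proof -
    have "(LINT z|M. v K z * cnj (\<phi> z)) = cnj (LINT z|M. \<phi> z * cnj (v K z))"
      by (simp add: mult.commute flip: Bochner_Integration.integral_cnj)
    also have "\<dots> = cnj (ip (Suc q) (single_form K \<phi>) v)" by (simp only: ip_single_form[OF K])
    finally have 1: "(LINT z|M. v K z * cnj (\<phi> z)) = cnj (ip (Suc q) (single_form K \<phi>) v)" .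
    show ?thesis
      unfolding 1 ip_formal_adjoint[OF u \<phi>, symmetric] L2_inner_cnj[of \<Omega> q u "formal_adjoint K \<phi>"]
      by (simp only: complex_cnj_cancel_iff)
  qed
  show ?thesis
    unfolding weak_dbar_def
  proof (intro iffI allI impI ballI)
    fix K :: "'n set" and \<phi> assume K: "card K = Suc q" and \<phi>: "\<phi> \<in> test"
      and *: "\<forall>K. card K = Suc q \<longrightarrow> (\<forall>\<phi>\<in>test. (LINT z|M. v K z * \<phi> z) =
       (\<Sum>j\<in>UNIV. \<Sum>J | card J = q. wedge_coeff j J K * - (LINT z|M. u J z * d_dzbar j \<phi> z)))"
    show "ip (Suc q) (single_form K \<phi>) v = ip q (formal_adjoint K \<phi>) u"
      by (rule iffD1[OF eq[OF K \<phi>]], rule *[rule_format, OF K test_functions_cnj[OF \<phi>]])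
  next
    fix K :: "'n set" and \<phi> assume K: "card K = Suc q" and \<phi>: "\<phi> \<in> test"
      and *: "\<forall>K \<phi>. card K = Suc q \<longrightarrow> \<phi> \<in> test \<longrightarrow> ip (Suc q) (single_form K \<phi>) v = ip q (formal_adjoint K \<phi>) u"
    have "ip (Suc q) (single_form K (\<lambda>w. cnj (\<phi> w))) v = ip q (formal_adjoint K (\<lambda>w. cnj (\<phi> w))) u"
      using * K test_functions_cnj[OF \<phi>] by blast
    then show "(LINT z|M. v K z * \<phi> z) =
       (\<Sum>j\<in>UNIV. \<Sum>J | card J = q. wedge_coeff j J K * - (LINT z|M. u J z * d_dzbar j \<phi> z))"
      unfolding eq[OF K test_functions_cnj[OF \<phi>], symmetric] complex_cnj_cnj .
  qed
qed

end

section \<open>The Cauchy--Riemann operator and its adjoint\<close>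

text \<open>This is the coefficient at K of the wedge product of the j-th and the k-th conjugate
  differential with the L-th basis form. Only J = \<open>insert k L\<close> contributes, and the
  extra sign for k < j arises because the j-th differential must then also pass the k-th
  one.\<close>

lemma sum_wedge_coeff:
  fixes K L :: "'n::{finite,linorder} set"
  assumes L: "card L = q"
  shows "(\<Sum>J | card J = Suc q. wedge_coeff j J K * wedge_coeff k L J)
    = (if k \<notin> L \<and> j \<notin> L \<and> j \<noteq> k \<and> K = insert j (insert k L)
       then (-1) ^ (card {i\<in>L. i < j} + (if k < j then 1 else 0) + card {i\<in>L. i < k}) else 0)"
proof (cases "k \<in> L")
  case True
  then show ?thesis by (simp add: wedge_coeff_def)
next
  case False
  have "card (insert k L) = Suc q" using L False by simp
  have "(\<Sum>J | card J = Suc q. wedge_coeff j J K * wedge_coeff k L J)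
      = (\<Sum>J | card J = Suc q. if J = insert k L then wedge_coeff j (insert k L) K * (-1) ^ card {i\<in>L. i < k} else 0)"
    by (intro sum.cong refl) (simp add: wedge_coeff_def False)
  also have "\<dots> = wedge_coeff j (insert k L) K * (-1) ^ card {i\<in>L. i < k}"
    using \<open>card (insert k L) = Suc q\<close> by (subst sum.delta) simp_all
  also have "card {i \<in> insert k L. i < j} = card {i\<in>L. i < j} + (if k < j then 1 else 0)"
  proof (cases "k < j")
    case True
    then have "{i \<in> insert k L. i < j} = insert k {i\<in>L. i < j}" by auto
    then show ?thesis using True False by simp
  next
    case nkj: False
    then have "{i \<in> insert k L. i < j} = {i\<in>L. i < j}" by auto
    then show ?thesis using nkj by simp
  qed
  then have "wedge_coeff j (insert k L) K = (if j \<notin> insert k L \<and> K = insert j (insert k L)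
      then (-1) ^ (card {i\<in>L. i < j} + (if k < j then 1 else 0)) else 0)"
    by (simp only: wedge_coeff_def)
  finally show ?thesis using False by (simp add: power_add)
qed

text \<open>For j different from k exactly one of k < j and j < k holds, so the two exponents differ
  by one; for j = k both sides vanish.\<close>

lemma sum_wedge_coeff_antisym:
  fixes K L :: "'n::{finite,linorder} set"
  assumes L: "card L = q"
  shows "(\<Sum>J | card J = Suc q. wedge_coeff j J K * wedge_coeff k L J)
    = - (\<Sum>J | card J = Suc q. wedge_coeff k J K * wedge_coeff j L J)"
  unfolding sum_wedge_coeff[OF L]
  by (cases j k rule: linorder_cases) (auto simp: insert_commute power_add)

lemma antisym_sum_eq_0:
  fixes c I :: "'a::finite \<Rightarrow> 'a \<Rightarrow> complex"
  assumes "\<And>j k. c j k = - c k j" "\<And>j k. I j k = I k j"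
  shows "(\<Sum>j\<in>UNIV. \<Sum>k\<in>UNIV. c j k * I j k) = 0"
proof -
  have "(\<Sum>j\<in>UNIV. \<Sum>k\<in>UNIV. c j k * I j k) = (\<Sum>k\<in>UNIV. \<Sum>j\<in>UNIV. c j k * I j k)"
    by (rule sum.swap)
  also have "\<dots> = (\<Sum>k\<in>UNIV. \<Sum>j\<in>UNIV. - (c k j * I k j))"
  proof (intro sum.cong refl)
    fix j k :: 'a
    show "c j k * I j k = - (c k j * I k j)"
      using assms(1)[of j k] assms(2)[of j k] by simp
  qed
  also have "\<dots> = - (\<Sum>j\<in>UNIV. \<Sum>k\<in>UNIV. c j k * I j k)" by (simp only: sum_negf)
  finally show ?thesis by simp
qed

context bounded_open
begin

lemma weak_dbar_lc:
  assumes L: "u \<in> L2 q" "v \<in> L2 (Suc q)" "u' \<in> L2 q" "v' \<in> L2 (Suc q)"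
    and w: "weak_dbar \<Omega> q u v" "weak_dbar \<Omega> q u' v'"
  shows "weak_dbar \<Omega> q (form_lc a u b u') (form_lc a v b v')"
  unfolding weak_dbar_iff[OF form_lc_L2[OF L(1,3)] form_lc_L2[OF L(2,4)]]
proof (intro allI impI)
  fix K :: "'n set" and \<phi> assume K: "card K = Suc q" and \<phi>: "\<phi> \<in> test"
  have "ip (Suc q) (single_form K \<phi>) v = ip q (formal_adjoint K \<phi>) u"
    "ip (Suc q) (single_form K \<phi>) v' = ip q (formal_adjoint K \<phi>) u'"
    using w K \<phi> unfolding weak_dbar_iff[OF L(1,2)] weak_dbar_iff[OF L(3,4)] by blast+
  then show "ip (Suc q) (single_form K \<phi>) (form_lc a v b v') = ip q (formal_adjoint K \<phi>) (form_lc a u b u')"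
    using L by (simp add: L2.B_lc_right single_form_L2[OF \<phi>] formal_adjoint_L2[OF \<phi>])
qed

lemma weak_dbar_unique:
  assumes L: "u \<in> L2 q" "v \<in> L2 (Suc q)" "v' \<in> L2 (Suc q)"
    and w: "weak_dbar \<Omega> q u v" "weak_dbar \<Omega> q u v'"
  shows "form_eq \<Omega> (Suc q) v v'"
proof (rule single_forms_separate[OF L(2,3)])
  fix K :: "'n set" and \<phi> assume "card K = Suc q" "\<phi> \<in> test"
  then show "ip (Suc q) (single_form K \<phi>) v = ip (Suc q) (single_form K \<phi>) v'"
    using w unfolding weak_dbar_iff[OF L(1,2)] weak_dbar_iff[OF L(1,3)] by simp
qed

lemma dbar_domD:
  assumes "u \<in> dbar_dom \<Omega> q"
  shows "u \<in> L2 q" "dbar \<Omega> q u \<in> L2 (Suc q)" "weak_dbar \<Omega> q u (dbar \<Omega> q u)"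
proof -
  show "u \<in> L2 q" using assms by (simp add: dbar_dom_def)
  have "\<exists>v. v \<in> L2 (Suc q) \<and> weak_dbar \<Omega> q u v" using assms by (auto simp: dbar_dom_def)
  then have "dbar \<Omega> q u \<in> L2 (Suc q) \<and> weak_dbar \<Omega> q u (dbar \<Omega> q u)"
    unfolding dbar_def by (rule someI_ex)
  then show "dbar \<Omega> q u \<in> L2 (Suc q)" "weak_dbar \<Omega> q u (dbar \<Omega> q u)" by blast+
qed

lemma dbar_domI:
  assumes "u \<in> L2 q" "v \<in> L2 (Suc q)" "weak_dbar \<Omega> q u v"
  shows "u \<in> dbar_dom \<Omega> q"
  using assms unfolding dbar_dom_def by blast

lemma dbar_eqI:
  assumes "u \<in> L2 q" "v \<in> L2 (Suc q)" "weak_dbar \<Omega> q u v"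
  shows "form_eq \<Omega> (Suc q) (dbar \<Omega> q u) v"
proof -
  note d = dbar_domD[OF dbar_domI[OF assms]]
  show ?thesis by (rule weak_dbar_unique[OF d(1,2) assms(2) d(3) assms(3)])
qed

lemma dbar_dom_lc:
  assumes "u \<in> dbar_dom \<Omega> q" "v \<in> dbar_dom \<Omega> q"
  shows "form_lc a u b v \<in> dbar_dom \<Omega> q"
    "form_eq \<Omega> (Suc q) (dbar \<Omega> q (form_lc a u b v)) (form_lc a (dbar \<Omega> q u) b (dbar \<Omega> q v))"
proof -
  note u = dbar_domD[OF assms(1)] and v = dbar_domD[OF assms(2)]
  note w = form_lc_L2[OF u(1) v(1)] form_lc_L2[OF u(2) v(2)] weak_dbar_lc[OF u(1,2) v(1,2) u(3) v(3)]
  show "form_lc a u b v \<in> dbar_dom \<Omega> q" by (rule dbar_domI[OF w])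
  show "form_eq \<Omega> (Suc q) (dbar \<Omega> q (form_lc a u b v)) (form_lc a (dbar \<Omega> q u) b (dbar \<Omega> q v))"
    by (rule dbar_eqI[OF w])
qed

text \<open>For each fixed test form both sides of the pairing identity are continuous in the
  \<open>L\<^sup>2\<close> norm, so the graph of the operator is closed.\<close>

lemma weak_dbar_closed:
  assumes s: "\<And>k. s k \<in> L2 q" "\<And>k. t k \<in> L2 (Suc q)" "\<And>k. weak_dbar \<Omega> q (s k) (t k)"
    and u: "u \<in> L2 q" "(\<lambda>k. nsq q (form_lc 1 (s k) (-1) u)) \<longlonglongrightarrow> 0"
    and v: "v \<in> L2 (Suc q)" "(\<lambda>k. nsq (Suc q) (form_lc 1 (t k) (-1) v)) \<longlonglongrightarrow> 0"
  shows "weak_dbar \<Omega> q u v"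
  unfolding weak_dbar_iff[OF u(1) v(1)]
proof (intro allI impI)
  fix K :: "'n set" and \<phi> assume K: "card K = Suc q" and \<phi>: "\<phi> \<in> test"
  have eq: "ip (Suc q) (single_form K \<phi>) (t k) = ip q (formal_adjoint K \<phi>) (s k)" for k
    using s(3)[of k] K \<phi> unfolding weak_dbar_iff[OF s(1,2)] by blast
  have "(\<lambda>k. ip (Suc q) (single_form K \<phi>) (t k)) \<longlonglongrightarrow> ip (Suc q) (single_form K \<phi>) v"
    by (rule L2.tendsto_B[OF s(2) v(1) single_form_L2[OF \<phi>] v(2)])
  moreover have "(\<lambda>k. ip (Suc q) (single_form K \<phi>) (t k)) \<longlonglongrightarrow> ip q (formal_adjoint K \<phi>) u"
    unfolding eq by (rule L2.tendsto_B[OF s(1) u(1) formal_adjoint_L2[OF \<phi>] u(2)])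
  ultimately show "ip (Suc q) (single_form K \<phi>) v = ip q (formal_adjoint K \<phi>) u"
    by (rule LIMSEQ_unique)
qed

text \<open>The derivative of a test function is again a test function, so the weak equation for h
  can be used under the one for v. What remains pairs h with second derivatives of \<phi>, symmetric
  in j and k, weighted by wedge coefficients antisymmetric in j and k.\<close>

lemma weak_dbar_dbar:
  assumes h: "h \<in> L2 q" and v: "v \<in> L2 (Suc q)" and w: "weak_dbar \<Omega> q h v"
  shows "weak_dbar \<Omega> (Suc q) v zero_form"
  unfolding weak_dbar_def
proof (intro allI impI ballI)
  fix K :: "'n set" and \<phi> assume K: "card K = Suc (Suc q)" and \<phi>: "\<phi> \<in> test"
  define I where "I j k L = (LINT z|M. h L z * d_dzbar k (d_dzbar j \<phi>) z)" for j k L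
  have I_sym: "I j k L = I k j L" for j k L
    unfolding I_def d_dzbar_commute[OF test_functionsD(1)[OF \<phi>], of k j] ..
  have vJ: "(LINT z|M. v J z * d_dzbar j \<phi> z) = (\<Sum>k\<in>UNIV. \<Sum>L | card L = q. wedge_coeff k L J * - I j k L)"
    if "card J = Suc q" for J j
    unfolding I_def
    using w[unfolded weak_dbar_def, rule_format, OF that test_functions_d_dzbar[OF \<phi>]] .
  have "(\<Sum>j\<in>UNIV. \<Sum>J | card J = Suc q. wedge_coeff j J K * - (LINT z|M. v J z * d_dzbar j \<phi> z))
      = (\<Sum>j\<in>UNIV. \<Sum>J | card J = Suc q. \<Sum>L | card L = q. \<Sum>k\<in>UNIV. wedge_coeff j J K * wedge_coeff k L J * I j k L)"
  proof (intro sum.cong refl)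
    fix j and J :: "'n set" assume "J \<in> {J. card J = Suc q}"
    then have J: "card J = Suc q" by simp
    have "wedge_coeff j J K * - (LINT z|M. v J z * d_dzbar j \<phi> z)
        = (\<Sum>k\<in>UNIV. \<Sum>L | card L = q. wedge_coeff j J K * wedge_coeff k L J * I j k L)"
      unfolding vJ[OF J] by (simp add: sum_negf sum_distrib_left mult.assoc)
    also have "\<dots> = (\<Sum>L | card L = q. \<Sum>k\<in>UNIV. wedge_coeff j J K * wedge_coeff k L J * I j k L)"
      by (rule sum.swap)
    finally show "wedge_coeff j J K * - (LINT z|M. v J z * d_dzbar j \<phi> z)
        = (\<Sum>L | card L = q. \<Sum>k\<in>UNIV. wedge_coeff j J K * wedge_coeff k L J * I j k L)" .
  qed
  also have "\<dots> = (\<Sum>j\<in>UNIV. \<Sum>L | card L = q. \<Sum>J | card J = Suc q. \<Sum>k\<in>UNIV. wedge_coeff j J K * wedge_coeff k L J * I j k L)"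
    by (intro sum.cong refl sum.swap)
  also have "\<dots> = (\<Sum>L | card L = q. \<Sum>j\<in>UNIV. \<Sum>J | card J = Suc q. \<Sum>k\<in>UNIV. wedge_coeff j J K * wedge_coeff k L J * I j k L)"
    by (rule sum.swap)
  also have "\<dots> = (\<Sum>L | card L = q. \<Sum>j\<in>UNIV. \<Sum>k\<in>UNIV. (\<Sum>J | card J = Suc q. wedge_coeff j J K * wedge_coeff k L J) * I j k L)"
    unfolding sum_distrib_right by (intro sum.cong refl sum.swap)
  also have "\<dots> = (\<Sum>L :: 'n set | card L = q. 0)"
  proof (rule sum.cong[OF refl])
    fix L :: "'n set" assume "L \<in> {L. card L = q}"
    then have L: "card L = q" by simp
    show "(\<Sum>j\<in>UNIV. \<Sum>k\<in>UNIV. (\<Sum>J | card J = Suc q. wedge_coeff j J K * wedge_coeff k L J) * I j k L) = 0"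
      by (rule antisym_sum_eq_0[OF sum_wedge_coeff_antisym[OF L] I_sym])
  qed
  finally show "(LINT z|M. zero_form K z * \<phi> z)
      = (\<Sum>j\<in>UNIV. \<Sum>J | card J = Suc q. wedge_coeff j J K * - (LINT z|M. v J z * d_dzbar j \<phi> z))"
    by (simp add: zero_form_def)
qed

text \<open>Integration by parts shows that the classical image v is the weak one. These forms
  separate points, which makes the adjoint single-valued modulo null sets.\<close>

lemma single_form_dbar_dom:
  assumes J0: "card J0 = q" and \<phi>: "\<phi> \<in> test"
  shows "single_form J0 \<phi> \<in> dbar_dom \<Omega> q"
proof -
  define v where "v = (\<lambda>K z. \<Sum>j\<in>UNIV. wedge_coeff j J0 K * d_dzbar j \<phi> z)"
  note T = test_functions_d_dzbar[OF \<phi>]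
  have "smooth_on UNIV (v K)" "{z. v K z \<noteq> 0} \<subseteq> closure {z. \<phi> z \<noteq> 0}" for K
  proof -
    show "smooth_on UNIV (v K)"
      unfolding v_def by (intro smooth_sum smooth_mult smooth_const test_functionsD(1)[OF T])
    show "{z. v K z \<noteq> 0} \<subseteq> closure {z. \<phi> z \<noteq> 0}"
    proof
      fix z assume "z \<in> {z. v K z \<noteq> 0}"
      then have "(\<Sum>j\<in>UNIV. wedge_coeff j J0 K * d_dzbar j \<phi> z) \<noteq> 0" by (simp add: v_def)
      then obtain j where "wedge_coeff j J0 K * d_dzbar j \<phi> z \<noteq> 0" by (rule sum.not_neutral_contains_not_neutral)
      then have "frechet_derivative \<phi> (at z) (axis j 1) \<noteq> 0 \<or> frechet_derivative \<phi> (at z) (axis j \<i>) \<noteq> 0"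
        by (auto simp: d_dzbar_def)
      then show "z \<in> closure {z. \<phi> z \<noteq> 0}"
        using frechet_derivative_support[OF test_functionsD(1)[OF \<phi>]] by blast
    qed
  qed
  then have vT: "v K \<in> test" for K by (intro test_functionsI[OF \<phi>])
  then have vL: "v \<in> L2 (Suc q)" using test_L2[OF vT] by (simp only: Lp_forms_2_iff simp_thms)
  have "weak_dbar \<Omega> q (single_form J0 \<phi>) v"
    unfolding weak_dbar_def
  proof (intro allI impI ballI)
    fix K :: "'n set" and \<psi> assume K: "card K = Suc q" and \<psi>: "\<psi> \<in> test"
    have i: "integrable M (\<lambda>z. wedge_coeff j J0 K * (d_dzbar j \<phi> z * \<psi> z))" for j
      by (intro integrable_mult_right test_functions_integrable(3)[OF open_domain] test_functions_mult T test_functionsD(1)[OF \<psi>])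
    have "(LINT z|M. v K z * \<psi> z) = (LINT z|M. (\<Sum>j\<in>UNIV. wedge_coeff j J0 K * (d_dzbar j \<phi> z * \<psi> z)))"
      by (simp add: v_def sum_distrib_right mult.assoc)
    also have "\<dots> = (\<Sum>j\<in>UNIV. LINT z|M. wedge_coeff j J0 K * (d_dzbar j \<phi> z * \<psi> z))"
      by (rule Bochner_Integration.integral_sum[OF i])
    also have "\<dots> = (\<Sum>j\<in>UNIV. wedge_coeff j J0 K * - (LINT z|M. \<phi> z * d_dzbar j \<psi> z))"
      by (simp add: integration_by_parts[OF open_domain \<phi> \<psi>])
    also have "\<dots> = (\<Sum>j\<in>UNIV. \<Sum>J | card J = q. wedge_coeff j J K * - (LINT z|M. single_form J0 \<phi> J z * d_dzbar j \<psi> z))"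
    proof (intro sum.cong refl)
      fix j
      have "(\<Sum>J | card J = q. wedge_coeff j J K * - (LINT z|M. single_form J0 \<phi> J z * d_dzbar j \<psi> z))
          = (\<Sum>J | card J = q. if J = J0 then wedge_coeff j J0 K * - (LINT z|M. \<phi> z * d_dzbar j \<psi> z) else 0)"
        by (intro sum.cong refl) (simp add: single_form_def)
      also have "\<dots> = wedge_coeff j J0 K * - (LINT z|M. \<phi> z * d_dzbar j \<psi> z)"
        using J0 by (subst sum.delta) simp_all
      finally show "wedge_coeff j J0 K * - (LINT z|M. \<phi> z * d_dzbar j \<psi> z)
          = (\<Sum>J | card J = q. wedge_coeff j J K * - (LINT z|M. single_form J0 \<phi> J z * d_dzbar j \<psi> z))" by (rule sym)
    qed
    finally show "(LINT z|M. v K z * \<psi> z)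
        = (\<Sum>j\<in>UNIV. \<Sum>J | card J = q. wedge_coeff j J K * - (LINT z|M. single_form J0 \<phi> J z * d_dzbar j \<psi> z))" .
  qed
  then show ?thesis by (rule dbar_domI[OF single_form_L2[OF \<phi>] vL])
qed

section \<open>The Hilbert space adjoint\<close>

lemma adjointD:
  "is_dbar_adjoint \<Omega> q w u \<Longrightarrow> f \<in> dbar_dom \<Omega> q \<Longrightarrow> ip (Suc q) (dbar \<Omega> q f) w = ip q f u"
  by (simp add: is_dbar_adjoint_def)

lemma adjoint_unique:
  assumes "u \<in> L2 q" "u' \<in> L2 q" "is_dbar_adjoint \<Omega> q w u" "is_dbar_adjoint \<Omega> q w u'"
  shows "form_eq \<Omega> q u u'"
proof (rule single_forms_separate[OF assms(1,2)])
  fix K :: "'n set" and \<phi> assume "card K = q" "\<phi> \<in> test"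
  then have "single_form K \<phi> \<in> dbar_dom \<Omega> q" by (rule single_form_dbar_dom)
  then show "ip q (single_form K \<phi>) u = ip q (single_form K \<phi>) u'"
    using adjointD[OF assms(3)] adjointD[OF assms(4)] by metis
qed

lemma adjoint_lc:
  assumes L: "w \<in> L2 (Suc q)" "u \<in> L2 q" "w' \<in> L2 (Suc q)" "u' \<in> L2 q"
    and a: "is_dbar_adjoint \<Omega> q w u" "is_dbar_adjoint \<Omega> q w' u'"
  shows "is_dbar_adjoint \<Omega> q (form_lc a w b w') (form_lc a u b u')"
  unfolding is_dbar_adjoint_def
proof
  fix f assume f: "f \<in> dbar_dom \<Omega> q"
  note d = dbar_domD[OF f]
  show "ip (Suc q) (dbar \<Omega> q f) (form_lc a w b w') = ip q f (form_lc a u b u')"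
    unfolding L2.B_lc_right[OF L(1,3) d(2)] L2.B_lc_right[OF L(2,4) d(1)] adjointD[OF a(1) f] adjointD[OF a(2) f] ..
qed

lemma adjoint_closed:
  assumes s: "\<And>k. s k \<in> L2 (Suc q)" "\<And>k. t k \<in> L2 q" "\<And>k. is_dbar_adjoint \<Omega> q (s k) (t k)"
    and w: "w \<in> L2 (Suc q)" "(\<lambda>k. nsq (Suc q) (form_lc 1 (s k) (-1) w)) \<longlonglongrightarrow> 0"
    and u: "u \<in> L2 q" "(\<lambda>k. nsq q (form_lc 1 (t k) (-1) u)) \<longlonglongrightarrow> 0"
  shows "is_dbar_adjoint \<Omega> q w u"
  unfolding is_dbar_adjoint_def
proof
  fix f assume f: "f \<in> dbar_dom \<Omega> q"
  note d = dbar_domD[OF f]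
  have "(\<lambda>k. ip q f (t k)) \<longlonglongrightarrow> ip (Suc q) (dbar \<Omega> q f) w"
    unfolding adjointD[OF s(3) f, symmetric] by (rule L2.tendsto_B[OF s(1) w(1) d(2) w(2)])
  moreover have "(\<lambda>k. ip q f (t k)) \<longlonglongrightarrow> ip q f u"
    by (rule L2.tendsto_B[OF s(2) u(1) d(1) u(2)])
  ultimately show "ip (Suc q) (dbar \<Omega> q f) w = ip q f u" by (rule LIMSEQ_unique)
qed

lemma dbar_star_domD:
  assumes "w \<in> dbar_star_dom \<Omega> q"
  shows "w \<in> L2 (Suc q)" "dbar_star \<Omega> q w \<in> L2 q" "is_dbar_adjoint \<Omega> q w (dbar_star \<Omega> q w)"
proof -
  show "w \<in> L2 (Suc q)" using assms by (simp add: dbar_star_dom_def)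
  have "\<exists>u. u \<in> L2 q \<and> is_dbar_adjoint \<Omega> q w u" using assms by (auto simp: dbar_star_dom_def)
  then have "dbar_star \<Omega> q w \<in> L2 q \<and> is_dbar_adjoint \<Omega> q w (dbar_star \<Omega> q w)"
    unfolding dbar_star_def by (rule someI_ex)
  then show "dbar_star \<Omega> q w \<in> L2 q" "is_dbar_adjoint \<Omega> q w (dbar_star \<Omega> q w)" by blast+
qed

lemma dbar_star_domI:
  assumes "w \<in> L2 (Suc q)" "u \<in> L2 q" "is_dbar_adjoint \<Omega> q w u"
  shows "w \<in> dbar_star_dom \<Omega> q"
  using assms unfolding dbar_star_dom_def by blast

lemma dbar_star_eqI:
  assumes "w \<in> L2 (Suc q)" "u \<in> L2 q" "is_dbar_adjoint \<Omega> q w u"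
  shows "form_eq \<Omega> q (dbar_star \<Omega> q w) u"
proof -
  note d = dbar_star_domD[OF dbar_star_domI[OF assms]]
  show ?thesis by (rule adjoint_unique[OF d(2) assms(2) d(3) assms(3)])
qed

lemma dbar_star_dom_lc:
  assumes "u \<in> dbar_star_dom \<Omega> q" "v \<in> dbar_star_dom \<Omega> q"
  shows "form_lc a u b v \<in> dbar_star_dom \<Omega> q"
    "form_eq \<Omega> q (dbar_star \<Omega> q (form_lc a u b v)) (form_lc a (dbar_star \<Omega> q u) b (dbar_star \<Omega> q v))"
proof -
  note u = dbar_star_domD[OF assms(1)] and v = dbar_star_domD[OF assms(2)]
  note w = form_lc_L2[OF u(1) v(1)] form_lc_L2[OF u(2) v(2)] adjoint_lc[OF u(1,2) v(1,2) u(3) v(3)]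
  show "form_lc a u b v \<in> dbar_star_dom \<Omega> q" by (rule dbar_star_domI[OF w])
  show "form_eq \<Omega> q (dbar_star \<Omega> q (form_lc a u b v)) (form_lc a (dbar_star \<Omega> q u) b (dbar_star \<Omega> q v))"
    by (rule dbar_star_eqI[OF w])
qed

text \<open>The weak equation defining \<open>dbar f\<close>, tested with
  \<open>single_form K \<phi>\<close> and conjugated, is exactly the adjoint identity.\<close>

lemma adjoint_single_form:
  assumes K: "card K = Suc q" and \<phi>: "\<phi> \<in> test"
  shows "is_dbar_adjoint \<Omega> q (single_form K \<phi>) (formal_adjoint K \<phi>)"
  unfolding is_dbar_adjoint_def
proof
  fix f assume f: "f \<in> dbar_dom \<Omega> q"
  note d = dbar_domD[OF f]
  have "ip (Suc q) (single_form K \<phi>) (dbar \<Omega> q f) = ip q (formal_adjoint K \<phi>) f"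
    using d(3) K \<phi> unfolding weak_dbar_iff[OF d(1,2)] by blast
  then show "ip (Suc q) (dbar \<Omega> q f) (single_form K \<phi>) = ip q f (formal_adjoint K \<phi>)"
    by (simp only: L2_inner_cnj[of \<Omega> "Suc q" "dbar \<Omega> q f"] L2_inner_cnj[of \<Omega> q f])
qed

end

section \<open>Weak solutions and the complex Laplacian\<close>

text \<open>The degree is written \<open>Suc m\<close>, so that q - 1 becomes \<open>m\<close>.
  Existence, uniqueness and regularity of weak solutions in \<open>L\<^sup>2\<close> follow from the
  plain \<open>L\<^sup>2\<close> estimate, which is isolated here from the Sobolev estimate.\<close>

locale coercive_domain = bounded_open \<Omega> for \<Omega> :: "(complex^'n::{finite,linorder}) set" +
  fixes m :: nat and C0 :: real
  assumes C0_nonneg: "C0 \<ge> 0"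
    and coercive: "\<And>u. u \<in> dbar_dom \<Omega> (Suc m) \<inter> dbar_star_dom \<Omega> m \<Longrightarrow>
      L2.sqn (Suc m) u \<le> C0 * (L2.sqn (Suc (Suc m)) (dbar \<Omega> (Suc m) u) + L2.sqn m (dbar_star \<Omega> m u))"
begin

abbreviation "A \<equiv> dbar \<Omega> (Suc m)"
abbreviation "S \<equiv> dbar_star \<Omega> m"

definition D :: "'n form set" where "D = dbar_dom \<Omega> (Suc m) \<inter> dbar_star_dom \<Omega> m"

definition Q :: "'n form \<Rightarrow> 'n form \<Rightarrow> complex" where
  "Q u v = ip (Suc (Suc m)) (A u) (A v) + ip m (S u) (S v)"

lemma D_dbar: "u \<in> D \<Longrightarrow> u \<in> dbar_dom \<Omega> (Suc m)" and D_star: "u \<in> D \<Longrightarrow> u \<in> dbar_star_dom \<Omega> m"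
  by (simp_all add: D_def)

lemma D_L2:
  assumes "u \<in> D"
  shows "u \<in> L2 (Suc m)" "A u \<in> L2 (Suc (Suc m))" "S u \<in> L2 m"
  using dbar_domD[OF D_dbar[OF assms]] dbar_star_domD[OF D_star[OF assms]] by blast+

lemma D_lc:
  assumes "u \<in> D" "v \<in> D"
  shows "form_lc a u b v \<in> D"
    "form_eq \<Omega> (Suc (Suc m)) (A (form_lc a u b v)) (form_lc a (A u) b (A v))"
    "form_eq \<Omega> m (S (form_lc a u b v)) (form_lc a (S u) b (S v))"
  using dbar_dom_lc[OF D_dbar[OF assms(1)] D_dbar[OF assms(2)]]
    dbar_star_dom_lc[OF D_star[OF assms(1)] D_star[OF assms(2)]]
  by (simp_all add: D_def)

lemma single_form_D:
  assumes "card K = Suc m" "\<phi> \<in> test"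
  shows "single_form K \<phi> \<in> D"
  unfolding D_def
  using single_form_dbar_dom[OF assms]
    dbar_star_domI[OF single_form_L2[OF assms(2)] formal_adjoint_L2[OF assms(2)] adjoint_single_form[OF assms]]
  by blast

sublocale E: semi_inner D form_lc Q
proof
  have "zero_form \<in> D"
  proof -
    have "weak_dbar \<Omega> (Suc m) zero_form zero_form" by (simp add: weak_dbar_def zero_form_def)
    moreover have "is_dbar_adjoint \<Omega> m zero_form zero_form" by (simp add: is_dbar_adjoint_def ip_zero)
    ultimately show ?thesis
      unfolding D_def using dbar_domI[OF zero_form_L2 zero_form_L2] dbar_star_domI[OF zero_form_L2 zero_form_L2] by blast
  qed
  then show "D \<noteq> {}" by blast
  show "form_lc a u b v \<in> D" if "u \<in> D" "v \<in> D" for u v a b by (rule D_lc(1)[OF that])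
  show "Q (form_lc a u b v) w = a * Q u w + b * Q v w" if u: "u \<in> D" and v: "v \<in> D" and w: "w \<in> D" for u v w a b
  proof -
    note Lu = D_L2[OF u] and Lv = D_L2[OF v] and Lw = D_L2[OF w] and L = D_L2[OF D_lc(1)[OF u v, of a b]]
    have "ip (Suc (Suc m)) (A (form_lc a u b v)) (A w) = a * ip (Suc (Suc m)) (A u) (A w) + b * ip (Suc (Suc m)) (A v) (A w)"
      unfolding L2.B_lc[OF Lu(2) Lv(2) Lw(2), symmetric]
      by (rule ip_cong[OF L(2) form_lc_L2[OF Lu(2) Lv(2)] Lw(2) Lw(2) D_lc(2)[OF u v] form_eq_refl])
    moreover have "ip m (S (form_lc a u b v)) (S w) = a * ip m (S u) (S w) + b * ip m (S v) (S w)"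
      unfolding L2.B_lc[OF Lu(3) Lv(3) Lw(3), symmetric]
      by (rule ip_cong[OF L(3) form_lc_L2[OF Lu(3) Lv(3)] Lw(3) Lw(3) D_lc(3)[OF u v] form_eq_refl])
    ultimately show ?thesis by (simp add: Q_def algebra_simps)
  qed
  show "Q v u = cnj (Q u v)" for u v
    unfolding Q_def complex_cnj_add L2_inner_cnj[of \<Omega> _ "A v"] L2_inner_cnj[of \<Omega> _ "S v"] ..
  show "0 \<le> Re (Q u u)" for u by (simp add: Q_def L2_inner_self)
qed

lemma E_sqn: "E.sqn u = nsq (Suc (Suc m)) (A u) + nsq m (S u)"
  by (simp add: E.sqn_def Q_def L2.sqn_def)

lemma coercive_E: "u \<in> D \<Longrightarrow> nsq (Suc m) u \<le> C0 * E.sqn u"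
  using coercive[of u] by (simp add: E_sqn D_def)

lemma E_sqn_diff:
  assumes "u \<in> D" "v \<in> D"
  shows "E.sqn (form_lc 1 u (-1) v) = nsq (Suc (Suc m)) (form_lc 1 (A u) (-1) (A v)) + nsq m (form_lc 1 (S u) (-1) (S v))"
proof -
  note Lu = D_L2[OF assms(1)] and Lv = D_L2[OF assms(2)] and L = D_L2[OF D_lc(1)[OF assms, of 1 "-1"]]
  show ?thesis
    unfolding E_sqn
      nsq_cong[OF L(2) form_lc_L2[OF Lu(2) Lv(2)] D_lc(2)[OF assms]]
      nsq_cong[OF L(3) form_lc_L2[OF Lu(3) Lv(3)] D_lc(3)[OF assms]] ..
qed

lemma L2_cauchyI:
  assumes "\<And>k. t k \<in> L2 q" "E.cauchy_seq s" "B \<ge> 0"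
    and le: "\<And>i j. nsq q (form_lc 1 (t i) (-1) (t j)) \<le> B * E.sqn (form_lc 1 (s i) (-1) (s j))"
  shows "L2.cauchy_seq q t"
  unfolding L2.cauchy_seq_def
proof (intro conjI allI impI assms(1))
  fix e :: real assume "e > 0"
  then have "e / (B + 1) > 0" using assms(3) by simp
  then obtain N where N: "\<forall>i\<ge>N. \<forall>j\<ge>N. E.sqn (form_lc 1 (s i) (-1) (s j)) < e / (B + 1)"
    using assms(2) unfolding E.cauchy_seq_def by blast
  have "nsq q (form_lc 1 (t i) (-1) (t j)) < e" if "i \<ge> N" "j \<ge> N" for i j
  proof -
    have "B * E.sqn (form_lc 1 (s i) (-1) (s j)) \<le> B * (e / (B + 1))"
      using N that assms(3) by (intro mult_left_mono) (auto intro: less_imp_le)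
    also have "\<dots> < e" using \<open>e > 0\<close> assms(3) by (simp add: field_simps)
    finally show ?thesis using le[of i j] by linarith
  qed
  then show "\<exists>N. \<forall>i\<ge>N. \<forall>j\<ge>N. nsq q (form_lc 1 (t i) (-1) (t j)) < e" by blast
qed

text \<open>A sequence that is Cauchy for \<open>Q\<close> is Cauchy in \<open>L\<^sup>2\<close> by
  coercivity, and so are its images under \<open>A\<close> and \<open>S\<close> because
  \<open>Q\<close> is the sum of their inner products. Closedness of the two operators identifies
  the three limits.\<close>

lemma E_complete: "E.complete_carrier"
  unfolding E.complete_carrier_def
proof (intro allI impI)
  fix s assume c: "E.cauchy_seq s"
  then have s: "s k \<in> D" for k by (simp add: E.cauchy_seq_def)
  have dD: "form_lc 1 (s i) (-1) (s j) \<in> D" for i j by (rule D_lc(1)[OF s s])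
  have nn: "nsq q w \<ge> 0" for q w by (simp add: L2_sqn)
  have "L2.cauchy_seq (Suc m) s"
    by (rule L2_cauchyI[OF D_L2(1)[OF s] c C0_nonneg coercive_E[OF dD]])
  then obtain u where u: "u \<in> L2 (Suc m)" "(\<lambda>k. nsq (Suc m) (form_lc 1 (s k) (-1) u)) \<longlonglongrightarrow> 0"
    using L2_complete_carrier unfolding L2.complete_carrier_def by blast
  have "nsq (Suc (Suc m)) (form_lc 1 (A (s i)) (-1) (A (s j))) \<le> 1 * E.sqn (form_lc 1 (s i) (-1) (s j))" for i j
    unfolding E_sqn_diff[OF s s] using nn by simp
  then have "L2.cauchy_seq (Suc (Suc m)) (\<lambda>k. A (s k))"
    by (rule L2_cauchyI[OF D_L2(2)[OF s] c zero_le_one])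
  then obtain v where v: "v \<in> L2 (Suc (Suc m))" "(\<lambda>k. nsq (Suc (Suc m)) (form_lc 1 (A (s k)) (-1) v)) \<longlonglongrightarrow> 0"
    using L2_complete_carrier unfolding L2.complete_carrier_def by blast
  have "nsq m (form_lc 1 (S (s i)) (-1) (S (s j))) \<le> 1 * E.sqn (form_lc 1 (s i) (-1) (s j))" for i j
    unfolding E_sqn_diff[OF s s] using nn by simp
  then have "L2.cauchy_seq m (\<lambda>k. S (s k))"
    by (rule L2_cauchyI[OF D_L2(3)[OF s] c zero_le_one])
  then obtain w where w: "w \<in> L2 m" "(\<lambda>k. nsq m (form_lc 1 (S (s k)) (-1) w)) \<longlonglongrightarrow> 0"
    using L2_complete_carrier unfolding L2.complete_carrier_def by blast
  note sA = dbar_domD[OF D_dbar[OF s]] and sS = dbar_star_domD[OF D_star[OF s]]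
  have wk: "weak_dbar \<Omega> (Suc m) u v"
    by (rule weak_dbar_closed[where s = s and t = "\<lambda>k. A (s k)", OF sA(1) sA(2) sA(3) u v])
  have ad: "is_dbar_adjoint \<Omega> m u w"
    by (rule adjoint_closed[where s = s and t = "\<lambda>k. S (s k)", OF sS(1) sS(2) sS(3) u w])
  have uD: "u \<in> D"
    unfolding D_def using dbar_domI[OF u(1) v(1) wk] dbar_star_domI[OF u(1) w(1) ad] by blast
  note Au = dbar_eqI[OF u(1) v(1) wk] and Su = dbar_star_eqI[OF u(1) w(1) ad]
  have "E.sqn (form_lc 1 (s k) (-1) u) = nsq (Suc (Suc m)) (form_lc 1 (A (s k)) (-1) v) + nsq m (form_lc 1 (S (s k)) (-1) w)" for k
    unfolding E_sqn_diff[OF s uD]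
      nsq_cong[OF form_lc_L2[OF sA(2) D_L2(2)[OF uD]] form_lc_L2[OF sA(2) v(1)] form_eq_lc[OF form_eq_refl Au]]
      nsq_cong[OF form_lc_L2[OF sS(2) D_L2(3)[OF uD]] form_lc_L2[OF sS(2) w(1)] form_eq_lc[OF form_eq_refl Su]] ..
  moreover have "(\<lambda>k. nsq (Suc (Suc m)) (form_lc 1 (A (s k)) (-1) v) + nsq m (form_lc 1 (S (s k)) (-1) w)) \<longlonglongrightarrow> 0 + 0"
    by (intro tendsto_add v(2) w(2))
  ultimately have "(\<lambda>k. E.sqn (form_lc 1 (s k) (-1) u)) \<longlonglongrightarrow> 0" by (simp only: add_0_left)
  then show "\<exists>u\<in>D. (\<lambda>k. E.sqn (form_lc 1 (s k) (-1) u)) \<longlonglongrightarrow> 0" using uD by blast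
qed

lemma weak_solution_unique:
  assumes u: "u \<in> D" and v: "v \<in> D" and eq: "\<And>w. w \<in> D \<Longrightarrow> Q w u = Q w v"
  shows "form_eq \<Omega> (Suc m) u v"
proof -
  have d: "form_lc 1 u (-1) v \<in> D" by (rule D_lc(1)[OF u v])
  have "Q (form_lc 1 u (-1) v) (form_lc 1 u (-1) v) = 0"
    by (simp add: E.B_lc_right[OF u v d] eq[OF d])
  then have "E.sqn (form_lc 1 u (-1) v) = 0" by (simp add: E.sqn_def)
  then have "nsq (Suc m) (form_lc 1 u (-1) v) \<le> 0" using coercive_E[OF d] by simp
  moreover have "nsq (Suc m) (form_lc 1 u (-1) v) \<ge> 0" by (simp add: L2_sqn)
  ultimately show ?thesis
    by (intro nsq_diff_eq_0_imp D_L2(1) u v) simp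
qed

text \<open>Testing with the component of \<open>g\<close> orthogonal to the kernel of the Cauchy--Riemann operator
  removes the second term of \<open>Q\<close>; since the operators form a complex, that component is again in
  the form domain.  The same works for the adjoint.\<close>

lemma dbar_weak_solution:
  assumes f: "f \<in> L2 (Suc m)" and u: "u \<in> D" and sol: "\<And>v. v \<in> D \<Longrightarrow> Q v u = ip (Suc m) v f"
  shows "A u \<in> dbar_star_dom \<Omega> (Suc m)"
proof -
  define K where "K = {g \<in> L2 (Suc m). weak_dbar \<Omega> (Suc m) g zero_form}"
  have K_L2: "K \<subseteq> L2 (Suc m)" by (auto simp: K_def)
  have K_dom: "g \<in> dbar_dom \<Omega> (Suc m)" "form_eq \<Omega> (Suc (Suc m)) (A g) zero_form" if "g \<in> K" for g
    using that dbar_domI[OF _ zero_form_L2] dbar_eqI[OF _ zero_form_L2] by (auto simp: K_def)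
  have "weak_dbar \<Omega> (Suc m) zero_form zero_form" by (simp add: weak_dbar_def zero_form_def)
  then have K_ne: "K \<noteq> {}" unfolding K_def using zero_form_L2 by blast
  have K_lc: "form_lc a g b h \<in> K" if "g \<in> K" "h \<in> K" for a b g h
  proof -
    have "weak_dbar \<Omega> (Suc m) (form_lc a g b h) (form_lc a zero_form b zero_form)"
      using that by (intro weak_dbar_lc zero_form_L2) (auto simp: K_def)
    moreover have "form_lc a zero_form b zero_form = (zero_form :: 'n form)" by (simp add: form_lc_def zero_form_def)
    ultimately show ?thesis using that by (simp add: K_def form_lc_L2)
  qed
  have K_closed: "\<exists>w\<in>K. (\<lambda>k. nsq (Suc m) (form_lc 1 (s k) (-1) w)) \<longlonglongrightarrow> 0"
    if c: "L2.cauchy_seq (Suc m) s" and sK: "\<And>k. s k \<in> K" for s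
  proof -
    obtain w where w: "w \<in> L2 (Suc m)" "(\<lambda>k. nsq (Suc m) (form_lc 1 (s k) (-1) w)) \<longlonglongrightarrow> 0"
      using L2_complete_carrier c unfolding L2.complete_carrier_def by blast
    have s: "s k \<in> L2 (Suc m)" "weak_dbar \<Omega> (Suc m) (s k) zero_form" for k using sK[of k] by (simp_all add: K_def)
    have z: "form_lc 1 zero_form (-1) zero_form = (zero_form :: 'n form)" by (simp add: form_lc_def zero_form_def)
    have "(\<lambda>k::nat. nsq (Suc (Suc m)) (form_lc 1 zero_form (-1) zero_form)) \<longlonglongrightarrow> 0"
      unfolding z L2.sqn_def by (simp add: ip_zero)
    then have "weak_dbar \<Omega> (Suc m) w zero_form"
      by (rule weak_dbar_closed[where t = "\<lambda>_. zero_form", OF s(1) zero_form_L2 s(2) w zero_form_L2])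
    then show ?thesis using w by (auto simp: K_def)
  qed
  have proj: "\<exists>p\<in>K. \<forall>v\<in>K. ip (Suc m) v (form_lc 1 g (-1) p) = 0" if "g \<in> L2 (Suc m)" for g
    by (rule L2.orthogonal_projection[OF K_L2 K_ne K_lc K_closed that])
  obtain p where p: "p \<in> K" "\<And>v. v \<in> K \<Longrightarrow> ip (Suc m) v (form_lc 1 f (-1) p) = 0" using proj[OF f] by blast
  have pL: "p \<in> L2 (Suc m)" using p(1) K_L2 by blast
  have f2: "form_lc 1 f (-1) p \<in> L2 (Suc m)" by (rule form_lc_L2[OF f pL])
  \<comment> \<open>The adjoint image of \<open>A u\<close> is f minus its projection p onto the
    kernel. Since g = g2 + r with r in the kernel and g2 orthogonal to it, pairing g2 with f or with
    f - p gives the same value, and r is orthogonal to f - p.\<close>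
  have "is_dbar_adjoint \<Omega> (Suc m) (A u) (form_lc 1 f (-1) p)"
    unfolding is_dbar_adjoint_def
  proof
    fix g assume g: "g \<in> dbar_dom \<Omega> (Suc m)"
    note gL = dbar_domD[OF g]
    obtain r where r: "r \<in> K" "\<And>v. v \<in> K \<Longrightarrow> ip (Suc m) v (form_lc 1 g (-1) r) = 0" using proj[OF gL(1)] by blast
    have rL: "r \<in> L2 (Suc m)" using r(1) K_L2 by blast
    define g2 where "g2 = form_lc 1 g (-1) r"
    have g2L: "g2 \<in> L2 (Suc m)" unfolding g2_def by (rule form_lc_L2[OF gL(1) rL])
    have g2_dom: "g2 \<in> dbar_dom \<Omega> (Suc m)" unfolding g2_def by (rule dbar_dom_lc(1)[OF g K_dom(1)[OF r(1)]])
    have "form_eq \<Omega> (Suc (Suc m)) (A g2) (form_lc 1 (A g) (-1) (A r))"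
      unfolding g2_def by (rule dbar_dom_lc(2)[OF g K_dom(1)[OF r(1)]])
    also have "form_eq \<Omega> (Suc (Suc m)) (form_lc 1 (A g) (-1) (A r)) (form_lc 1 (A g) (-1) zero_form)"
      by (rule form_eq_lc[OF form_eq_refl K_dom(2)[OF r(1)]])
    also (form_eq_trans) have "form_lc 1 (A g) (-1) zero_form = A g" by (simp add: form_lc_def zero_form_def)
    finally have Ag2: "form_eq \<Omega> (Suc (Suc m)) (A g2) (A g)" .
    \<comment> \<open>The kernel contains every \<open>dbar \<Omega> m h\<close>, and g2 is
      orthogonal to the kernel; so the adjoint maps g2 to zero.\<close>
    have ad: "is_dbar_adjoint \<Omega> m g2 zero_form"
      unfolding is_dbar_adjoint_def
    proof
      fix h assume "h \<in> dbar_dom \<Omega> m"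
      note hL = dbar_domD[OF this]
      have "dbar \<Omega> m h \<in> K" using hL(2) weak_dbar_dbar[OF hL] by (simp add: K_def)
      then show "ip (Suc m) (dbar \<Omega> m h) g2 = ip m h zero_form" using r(2) by (simp add: g2_def ip_zero)
    qed
    have g2D: "g2 \<in> D" unfolding D_def using g2_dom dbar_star_domI[OF g2L zero_form_L2 ad] by blast
    have "ip m (S g2) (S u) = ip m zero_form (S u)"
      by (rule ip_cong[OF D_L2(3)[OF g2D] zero_form_L2 D_L2(3)[OF u] D_L2(3)[OF u] dbar_star_eqI[OF g2L zero_form_L2 ad] form_eq_refl])
    moreover have "ip (Suc (Suc m)) (A g2) (A u) = ip (Suc (Suc m)) (A g) (A u)"
      by (rule ip_cong[OF D_L2(2)[OF g2D] gL(2) D_L2(2)[OF u] D_L2(2)[OF u] Ag2 form_eq_refl])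
    ultimately have 1: "ip (Suc (Suc m)) (A g) (A u) = ip (Suc m) g2 f"
      using sol[OF g2D] by (simp add: Q_def ip_zero)
    have "ip (Suc m) g2 p = cnj (ip (Suc m) p g2)" by (rule L2_inner_cnj)
    also have "\<dots> = 0" using r(2)[OF p(1)] by (simp add: g2_def)
    finally have 2: "ip (Suc m) g2 (form_lc 1 f (-1) p) = ip (Suc m) g2 f"
      by (simp add: L2.B_lc_right[OF f pL g2L])
    have "ip (Suc m) g2 (form_lc 1 f (-1) p) = ip (Suc m) g (form_lc 1 f (-1) p)"
      unfolding g2_def L2.B_lc[OF gL(1) rL f2] using p(2)[OF r(1)] by simp
    then show "ip (Suc (Suc m)) (A g) (A u) = ip (Suc m) g (form_lc 1 f (-1) p)" using 1 2 by simp
  qed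
  then show ?thesis by (rule dbar_star_domI[OF D_L2(2)[OF u] f2])
qed

text \<open>The kernel of the adjoint replaces the kernel of the Cauchy-Riemann operator, and the
  image of \<open>S u\<close> is again f minus its projection. A weak equation is tested with
  \<open>single_form J \<phi>\<close> only, so only these forms are decomposed.\<close>

lemma dbar_star_weak_solution:
  assumes f: "f \<in> L2 (Suc m)" and u: "u \<in> D" and sol: "\<And>v. v \<in> D \<Longrightarrow> Q v u = ip (Suc m) v f"
  shows "S u \<in> dbar_dom \<Omega> m"
proof -
  define K where "K = {g \<in> L2 (Suc m). is_dbar_adjoint \<Omega> m g zero_form}"
  have K_L2: "K \<subseteq> L2 (Suc m)" by (auto simp: K_def)
  have "zero_form \<in> K" by (simp add: K_def zero_form_L2 is_dbar_adjoint_def ip_zero)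
  then have K_ne: "K \<noteq> {}" by blast
  have K_lc: "form_lc a g b h \<in> K" if "g \<in> K" "h \<in> K" for a b g h
  proof -
    have "is_dbar_adjoint \<Omega> m (form_lc a g b h) (form_lc a zero_form b zero_form)"
      using that by (intro adjoint_lc zero_form_L2) (auto simp: K_def)
    moreover have "form_lc a zero_form b zero_form = (zero_form :: 'n form)" by (simp add: form_lc_def zero_form_def)
    ultimately show ?thesis using that by (simp add: K_def form_lc_L2)
  qed
  have K_closed: "\<exists>w\<in>K. (\<lambda>k. nsq (Suc m) (form_lc 1 (s k) (-1) w)) \<longlonglongrightarrow> 0"
    if c: "L2.cauchy_seq (Suc m) s" and sK: "\<And>k. s k \<in> K" for s
  proof -
    obtain w where w: "w \<in> L2 (Suc m)" "(\<lambda>k. nsq (Suc m) (form_lc 1 (s k) (-1) w)) \<longlonglongrightarrow> 0"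
      using L2_complete_carrier c unfolding L2.complete_carrier_def by blast
    have s: "s k \<in> L2 (Suc m)" "is_dbar_adjoint \<Omega> m (s k) zero_form" for k using sK[of k] by (simp_all add: K_def)
    have z: "form_lc 1 zero_form (-1) zero_form = (zero_form :: 'n form)" by (simp add: form_lc_def zero_form_def)
    have "(\<lambda>k::nat. nsq m (form_lc 1 zero_form (-1) zero_form)) \<longlonglongrightarrow> 0"
      unfolding z L2.sqn_def by (simp add: ip_zero)
    then have "is_dbar_adjoint \<Omega> m w zero_form"
      by (rule adjoint_closed[where t = "\<lambda>_. zero_form", OF s(1) zero_form_L2 s(2) w zero_form_L2])
    then show ?thesis using w by (auto simp: K_def)
  qed
  have proj: "\<exists>p\<in>K. \<forall>v\<in>K. ip (Suc m) v (form_lc 1 g (-1) p) = 0" if "g \<in> L2 (Suc m)" for g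
    by (rule L2.orthogonal_projection[OF K_L2 K_ne K_lc K_closed that])
  obtain p where p: "p \<in> K" "\<And>v. v \<in> K \<Longrightarrow> ip (Suc m) v (form_lc 1 f (-1) p) = 0" using proj[OF f] by blast
  have pL: "p \<in> L2 (Suc m)" using p(1) K_L2 by blast
  have f2: "form_lc 1 f (-1) p \<in> L2 (Suc m)" by (rule form_lc_L2[OF f pL])
  have "weak_dbar \<Omega> m (S u) (form_lc 1 f (-1) p)"
    unfolding weak_dbar_iff[OF D_L2(3)[OF u] f2]
  proof (intro allI impI)
    fix J :: "'n set" and \<phi> assume J: "card J = Suc m" and \<phi>: "\<phi> \<in> test"
    define g where "g = single_form J \<phi>"
    have gL: "g \<in> L2 (Suc m)" unfolding g_def by (rule single_form_L2[OF \<phi>])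
    have \<theta>L: "formal_adjoint J \<phi> \<in> L2 m" by (rule formal_adjoint_L2[OF \<phi>])
    have g_ad: "is_dbar_adjoint \<Omega> m g (formal_adjoint J \<phi>)" unfolding g_def by (rule adjoint_single_form[OF J \<phi>])
    obtain r where r: "r \<in> K" "\<And>v. v \<in> K \<Longrightarrow> ip (Suc m) v (form_lc 1 g (-1) r) = 0" using proj[OF gL] by blast
    have rL: "r \<in> L2 (Suc m)" and r_ad: "is_dbar_adjoint \<Omega> m r zero_form" using r(1) by (simp_all add: K_def)
    define g2 where "g2 = form_lc 1 g (-1) r"
    have g2L: "g2 \<in> L2 (Suc m)" unfolding g2_def by (rule form_lc_L2[OF gL rL])
    have z: "form_lc 1 (formal_adjoint J \<phi>) (-1) zero_form = formal_adjoint J \<phi>" by (simp add: form_lc_def zero_form_def)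
    have g2_ad: "is_dbar_adjoint \<Omega> m g2 (formal_adjoint J \<phi>)"
      using adjoint_lc[OF gL \<theta>L rL zero_form_L2 g_ad r_ad, of 1 "-1"] by (simp only: z g2_def)
    have wk: "weak_dbar \<Omega> (Suc m) g2 zero_form"
      unfolding weak_dbar_iff[OF g2L zero_form_L2]
    proof (intro allI impI)
      fix J' :: "'n set" and \<psi> assume J': "card J' = Suc (Suc m)" and \<psi>: "\<psi> \<in> test"
      have \<theta>'L: "formal_adjoint J' \<psi> \<in> L2 (Suc m)" by (rule formal_adjoint_L2[OF \<psi>])
      \<comment> \<open>By \<open>weak_dbar_dbar\<close> a formal adjoint is orthogonal to the range
        of \<open>dbar \<Omega> m\<close>. It lies therefore in \<open>K\<close>, and g2 is
        orthogonal to it, which says that g2 is closed.\<close>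
      have "is_dbar_adjoint \<Omega> m (formal_adjoint J' \<psi>) zero_form"
        unfolding is_dbar_adjoint_def
      proof
        fix h assume "h \<in> dbar_dom \<Omega> m"
        note hL = dbar_domD[OF this]
        have "ip (Suc (Suc m)) (single_form J' \<psi>) zero_form = ip (Suc m) (formal_adjoint J' \<psi>) (dbar \<Omega> m h)"
          using weak_dbar_dbar[OF hL] J' \<psi> unfolding weak_dbar_iff[OF hL(2) zero_form_L2] by blast
        then have "ip (Suc m) (formal_adjoint J' \<psi>) (dbar \<Omega> m h) = 0" by (simp add: ip_zero)
        then show "ip (Suc m) (dbar \<Omega> m h) (formal_adjoint J' \<psi>) = ip m h zero_form"
          by (simp add: L2_inner_cnj[of \<Omega> "Suc m" "dbar \<Omega> m h"] ip_zero)
      qed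
      then have "formal_adjoint J' \<psi> \<in> K" using \<theta>'L by (simp add: K_def)
      then show "ip (Suc (Suc m)) (single_form J' \<psi>) zero_form = ip (Suc m) (formal_adjoint J' \<psi>) g2"
        using r(2) by (simp add: g2_def ip_zero)
    qed
    have g2D: "g2 \<in> D"
      unfolding D_def using dbar_domI[OF g2L zero_form_L2 wk] dbar_star_domI[OF g2L \<theta>L g2_ad] by blast
    have "ip (Suc (Suc m)) (A g2) (A u) = ip (Suc (Suc m)) zero_form (A u)"
      by (rule ip_cong[OF D_L2(2)[OF g2D] zero_form_L2 D_L2(2)[OF u] D_L2(2)[OF u] dbar_eqI[OF g2L zero_form_L2 wk] form_eq_refl])
    moreover have "ip m (S g2) (S u) = ip m (formal_adjoint J \<phi>) (S u)"
      by (rule ip_cong[OF D_L2(3)[OF g2D] \<theta>L D_L2(3)[OF u] D_L2(3)[OF u] dbar_star_eqI[OF g2L \<theta>L g2_ad] form_eq_refl])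
    ultimately have 1: "ip m (formal_adjoint J \<phi>) (S u) = ip (Suc m) g2 f"
      using sol[OF g2D] by (simp add: Q_def ip_zero)
    have "ip (Suc m) g2 p = cnj (ip (Suc m) p g2)" by (rule L2_inner_cnj)
    also have "\<dots> = 0" using r(2)[OF p(1)] by (simp add: g2_def)
    finally have 2: "ip (Suc m) g2 (form_lc 1 f (-1) p) = ip (Suc m) g2 f"
      by (simp add: L2.B_lc_right[OF f pL g2L])
    have "ip (Suc m) g2 (form_lc 1 f (-1) p) = ip (Suc m) g (form_lc 1 f (-1) p)"
      unfolding g2_def L2.B_lc[OF gL rL f2] using p(2)[OF r(1)] by simp
    then show "ip (Suc m) (single_form J \<phi>) (form_lc 1 f (-1) p) = ip m (formal_adjoint J \<phi>) (S u)"
      using 1 2 by (simp add: g_def)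
  qed
  then show ?thesis by (rule dbar_domI[OF D_L2(3)[OF u] f2])
qed

section \<open>From weak solutions to the Neumann operator\<close>

lemma box_domD:
  assumes "u \<in> box_dom \<Omega> (Suc m)"
  shows "u \<in> D" "A u \<in> dbar_star_dom \<Omega> (Suc m)" "S u \<in> dbar_dom \<Omega> m" "box \<Omega> (Suc m) u \<in> L2 (Suc m)"
    "v \<in> D \<Longrightarrow> Q v u = ip (Suc m) v (box \<Omega> (Suc m) u)"
proof -
  show u: "u \<in> D" and Au: "A u \<in> dbar_star_dom \<Omega> (Suc m)" and Su: "S u \<in> dbar_dom \<Omega> m"
    using assms by (simp_all add: box_dom_def D_def)
  have box: "box \<Omega> (Suc m) u = form_lc 1 (dbar \<Omega> m (S u)) 1 (dbar_star \<Omega> (Suc m) (A u))"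
    by (simp add: box_def form_lc_def)
  note a = dbar_domD[OF Su] and b = dbar_star_domD[OF Au]
  show "box \<Omega> (Suc m) u \<in> L2 (Suc m)" unfolding box by (rule form_lc_L2[OF a(2) b(2)])
  show "Q v u = ip (Suc m) v (box \<Omega> (Suc m) u)" if v: "v \<in> D"
  proof -
    note vS = dbar_star_domD[OF D_star[OF v]]
    have "ip (Suc m) v (dbar \<Omega> m (S u)) = cnj (ip (Suc m) (dbar \<Omega> m (S u)) v)" by (rule L2_inner_cnj)
    also have "\<dots> = cnj (ip m (S u) (S v))" using adjointD[OF vS(3) Su] by simp
    also have "\<dots> = ip m (S v) (S u)" by (rule L2_inner_cnj[symmetric])
    finally have 1: "ip (Suc m) v (dbar \<Omega> m (S u)) = ip m (S v) (S u)" .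
    have 2: "ip (Suc (Suc m)) (A v) (A u) = ip (Suc m) v (dbar_star \<Omega> (Suc m) (A u))"
      by (rule adjointD[OF b(3) D_dbar[OF v]])
    show ?thesis
      unfolding box Q_def L2.B_lc_right[OF a(2) b(2) D_L2(1)[OF v]] 1 2 by simp
  qed
qed

text \<open>The domain statement makes integration by parts in \<open>Q\<close> legitimate; since
  the form domain contains all test forms, the weak equation then identifies the Laplacian of u with
  f.\<close>

lemma weak_solution_box:
  assumes f: "f \<in> L2 (Suc m)" and u: "u \<in> D" and sol: "\<And>v. v \<in> D \<Longrightarrow> Q v u = ip (Suc m) v f"
  shows "u \<in> box_dom \<Omega> (Suc m)" "form_eq \<Omega> (Suc m) (box \<Omega> (Suc m) u) f"
proof -
  show ub: "u \<in> box_dom \<Omega> (Suc m)"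
    using dbar_weak_solution[OF f u sol] dbar_star_weak_solution[OF f u sol] u
    by (simp add: box_dom_def D_def)
  show "form_eq \<Omega> (Suc m) (box \<Omega> (Suc m) u) f"
  proof (rule single_forms_separate[OF box_domD(4)[OF ub] f])
    fix K :: "'n set" and \<phi> assume "card K = Suc m" "\<phi> \<in> test"
    then have d: "single_form K \<phi> \<in> D" by (rule single_form_D)
    show "ip (Suc m) (single_form K \<phi>) (box \<Omega> (Suc m) u) = ip (Suc m) (single_form K \<phi>) f"
      using box_domD(5)[OF ub d] sol[OF d] by simp
  qed
qed

lemma weak_solution_exists:
  assumes "\<And>a u b v. u \<in> D \<Longrightarrow> v \<in> D \<Longrightarrow> l (form_lc a u b v) = a * l u + b * l v"
    and "\<And>v. v \<in> D \<Longrightarrow> cmod (l v) \<le> B * sqrt (E.sqn v)"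
  shows "\<exists>u\<in>D. \<forall>v\<in>D. Q v u = l v"
  by (rule E.Riesz_representation[OF E_complete assms])

text \<open>\<open>dbar_neumann\<close> chooses some solution of the Laplace equation. Every such
  solution satisfies the weak equation, and later arguments refer to the operator through that
  equation alone.\<close>

lemma dbar_neumann_weak_solution:
  assumes f: "f \<in> L2 (Suc m)"
  shows "dbar_neumann \<Omega> (Suc m) f \<in> D" "\<And>v. v \<in> D \<Longrightarrow> Q v (dbar_neumann \<Omega> (Suc m) f) = ip (Suc m) v f"
proof -
  have "\<exists>u\<in>D. \<forall>v\<in>D. Q v u = ip (Suc m) v f"
  proof (rule weak_solution_exists)
    show "ip (Suc m) (form_lc a u b v) f = a * ip (Suc m) u f + b * ip (Suc m) v f" if "u \<in> D" "v \<in> D" for a u b v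
      by (rule L2.B_lc[OF D_L2(1)[OF that(1)] D_L2(1)[OF that(2)] f])
    show "cmod (ip (Suc m) v f) \<le> sqrt C0 * sqrt (nsq (Suc m) f) * sqrt (E.sqn v)" if v: "v \<in> D" for v
    proof -
      have "cmod (ip (Suc m) v f) \<le> sqrt (nsq (Suc m) v) * sqrt (nsq (Suc m) f)"
        by (rule L2.norm_B_le[OF D_L2(1)[OF v] f])
      also have "\<dots> \<le> sqrt (C0 * E.sqn v) * sqrt (nsq (Suc m) f)"
        using coercive_E[OF v] by (intro mult_right_mono real_sqrt_le_mono) (simp_all add: L2_sqn)
      finally show ?thesis by (simp add: real_sqrt_mult mult_ac)
    qed
  qed
  then obtain u where u: "u \<in> D" "\<And>v. v \<in> D \<Longrightarrow> Q v u = ip (Suc m) v f" by blast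
  have "\<exists>u. u \<in> box_dom \<Omega> (Suc m) \<and> form_eq \<Omega> (Suc m) (box \<Omega> (Suc m) u) f"
    using weak_solution_box[OF f u] by blast
  then have "dbar_neumann \<Omega> (Suc m) f \<in> box_dom \<Omega> (Suc m)
      \<and> form_eq \<Omega> (Suc m) (box \<Omega> (Suc m) (dbar_neumann \<Omega> (Suc m) f)) f"
    unfolding dbar_neumann_def by (rule someI_ex)
  then have N: "dbar_neumann \<Omega> (Suc m) f \<in> box_dom \<Omega> (Suc m)"
    and eq: "form_eq \<Omega> (Suc m) (box \<Omega> (Suc m) (dbar_neumann \<Omega> (Suc m) f)) f" by blast+
  show "dbar_neumann \<Omega> (Suc m) f \<in> D" by (rule box_domD(1)[OF N])
  show "Q v (dbar_neumann \<Omega> (Suc m) f) = ip (Suc m) v f" if v: "v \<in> D" for v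
    unfolding box_domD(5)[OF N v]
    by (rule ip_cong[OF D_L2(1)[OF v] D_L2(1)[OF v] box_domD(4)[OF N] f form_eq_refl eq])
qed

end

section \<open>Forms in other Lebesgue spaces\<close>

text \<open>The Euclidean norm is at most the number of multi-indices times the largest coefficient,
  and the p-th power of the latter is one of the summands.\<close>

lemma form_abs_powr_le:
  fixes u :: "'n::finite form"
  assumes "p > 0"
  shows "form_abs q u z powr p \<le> real (card {J :: 'n set. card J = q}) powr p * (\<Sum>J | card J = q. cmod (u J z) powr p)"
proof (cases "{J :: 'n set. card J = q} = {}")
  case True
  then show ?thesis unfolding form_abs_def True by simp
next
  case False
  let ?I = "{J :: 'n set. card J = q}"
  define \<mu> where "\<mu> = Max ((\<lambda>J. cmod (u J z)) ` ?I)"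
  have "\<mu> \<in> (\<lambda>J. cmod (u J z)) ` ?I" unfolding \<mu>_def using False by (intro Max_in) auto
  then obtain J0 where J0: "J0 \<in> ?I" "\<mu> = cmod (u J0 z)" by blast
  have "form_abs q u z \<le> (\<Sum>J\<in>?I. cmod (u J z))"
    using L2_set_le_sum[of ?I "\<lambda>J. cmod (u J z)"] by (simp add: form_abs_def L2_set_def)
  also have "\<dots> \<le> (\<Sum>J\<in>?I. \<mu>)"
    unfolding \<mu>_def by (intro sum_mono Max_ge) auto
  also have "\<dots> = real (card ?I) * \<mu>" by simp
  finally have "form_abs q u z powr p \<le> (real (card ?I) * \<mu>) powr p"
    using assms by (intro powr_mono2) (auto simp: form_abs_def sum_nonneg)
  also have "\<dots> = real (card ?I) powr p * \<mu> powr p" using J0 by (simp add: powr_mult)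
  also have "\<mu> powr p \<le> (\<Sum>J\<in>?I. cmod (u J z) powr p)"
    unfolding J0(2) using J0(1) by (intro member_le_sum[of J0 ?I "\<lambda>J. cmod (u J z) powr p"]) auto
  finally show ?thesis by (simp add: mult_left_mono)
qed

lemma form_abs_measurable:
  assumes "\<And>J. card J = q \<Longrightarrow> u J \<in> borel_measurable M"
  shows "form_abs q u \<in> borel_measurable M"
proof -
  have "(\<lambda>z. \<Sum>J | card J = q. (cmod (u J z))\<^sup>2) \<in> borel_measurable M"
    using assms by (intro borel_measurable_sum borel_measurable_power borel_measurable_norm) simp
  moreover have "continuous_on UNIV sqrt" by (intro continuous_intros)
  ultimately have "(\<lambda>z. sqrt (\<Sum>J | card J = q. (cmod (u J z))\<^sup>2)) \<in> borel_measurable M"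
    by (intro borel_measurable_continuous_on[where f = sqrt])
  then show ?thesis unfolding form_abs_def .
qed

lemma form_abs_nonneg: "form_abs q u z \<ge> 0"
  by (simp add: form_abs_def sum_nonneg)

lemma Lp_form_abs_integrable:
  assumes u: "u \<in> Lp_forms \<Omega> p q" and p: "p > 0"
  shows "form_abs q u \<in> borel_measurable (lebesgue_on \<Omega>)" "integrable (lebesgue_on \<Omega>) (\<lambda>z. form_abs q u z powr p)"
proof -
  show m: "form_abs q u \<in> borel_measurable (lebesgue_on \<Omega>)"
    using u by (intro form_abs_measurable) (simp add: Lp_forms_def)
  have "integrable (lebesgue_on \<Omega>) (\<lambda>z. real (card {J :: 'a set. card J = q}) powr p * (\<Sum>J | card J = q. cmod (u J z) powr p))"
    using u by (intro integrable_mult_right Bochner_Integration.integrable_sum) (simp add: Lp_forms_def)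
  then show "integrable (lebesgue_on \<Omega>) (\<lambda>z. form_abs q u z powr p)"
  proof (rule Bochner_Integration.integrable_bound)
    show "(\<lambda>z. form_abs q u z powr p) \<in> borel_measurable (lebesgue_on \<Omega>)" using m by simp
    show "AE z in lebesgue_on \<Omega>. norm (form_abs q u z powr p)
        \<le> norm (real (card {J :: 'a set. card J = q}) powr p * (\<Sum>J | card J = q. cmod (u J z) powr p))"
      using order_trans[OF form_abs_powr_le[OF p] abs_ge_self] by (intro AE_I2) simp
  qed
qed

lemma L2_inner_integrable_Lp:
  assumes pq: "p > 1" "r > 1" "1 / p + 1 / r = 1"
    and u: "u \<in> Lp_forms \<Omega> p q" and v: "v \<in> Lp_forms \<Omega> r q" and J: "card J = q"
  shows "integrable (lebesgue_on \<Omega>) (\<lambda>z. u J z * cnj (v J z))"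
proof -
  have m: "u J \<in> borel_measurable (lebesgue_on \<Omega>)" "v J \<in> borel_measurable (lebesgue_on \<Omega>)"
    and i: "integrable (lebesgue_on \<Omega>) (\<lambda>z. cmod (u J z) powr p)" "integrable (lebesgue_on \<Omega>) (\<lambda>z. cmod (v J z) powr r)"
    using u v J by (simp_all add: Lp_forms_def)
  have "integrable (lebesgue_on \<Omega>) (\<lambda>z. cmod (u J z) * cmod (v J z))"
    by (rule Holder_integral(1)[OF pq]) (use m i in simp_all)
  then show ?thesis
    by (rule Bochner_Integration.integrable_bound)
      (use m in \<open>simp_all add: norm_mult borel_measurable_times borel_measurable_cnj\<close>)
qed

text \<open>Cauchy-Schwarz over the multi-indices at each point, then Hoelder in z.\<close>

lemma L2_inner_le_Lp:
  assumes pq: "p > 1" "r > 1" "1 / p + 1 / r = 1"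
    and u: "u \<in> Lp_forms \<Omega> p q" and v: "v \<in> Lp_forms \<Omega> r q"
  shows "cmod (L2_inner \<Omega> q u v) \<le> Lp_norm \<Omega> p q u * Lp_norm \<Omega> r q v"
proof -
  let ?M = "lebesgue_on \<Omega>"
  note U = Lp_form_abs_integrable[OF u] and V = Lp_form_abs_integrable[OF v]
  have "cmod (L2_inner \<Omega> q u v) \<le> (LINT z|?M. \<bar>form_abs q u z * form_abs q v z\<bar>)"
    unfolding L2_inner_def
  proof (rule Bochner_Integration.integral_norm_bound_integral)
    show "integrable ?M (\<lambda>z. \<Sum>J | card J = q. u J z * cnj (v J z))"
      using L2_inner_integrable_Lp[OF pq u v] by (intro Bochner_Integration.integrable_sum) simp
    show "integrable ?M (\<lambda>z. \<bar>form_abs q u z * form_abs q v z\<bar>)"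
      using pq U V by (intro integrable_abs Holder_integral(1)[OF pq]) (simp_all add: form_abs_nonneg)
    fix z
    have "cmod (\<Sum>J | card J = q. u J z * cnj (v J z)) \<le> (\<Sum>J | card J = q. \<bar>cmod (u J z)\<bar> * \<bar>cmod (v J z)\<bar>)"
      by (rule sum_norm_le) (simp add: norm_mult)
    also have "\<dots> \<le> form_abs q u z * form_abs q v z"
      using L2_set_mult_ineq[of "\<lambda>J. cmod (u J z)" "\<lambda>J. cmod (v J z)" "{J. card J = q}"]
      by (simp add: form_abs_def L2_set_def)
    finally show "cmod (\<Sum>J | card J = q. u J z * cnj (v J z)) \<le> \<bar>form_abs q u z * form_abs q v z\<bar>" by linarith
  qed
  also have "\<dots> \<le> (LINT z|?M. \<bar>form_abs q u z\<bar> powr p) powr (1 / p) * (LINT z|?M. \<bar>form_abs q v z\<bar> powr r) powr (1 / r)"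
    using pq U V by (intro Holder_integral(2)[OF pq]) (simp_all add: form_abs_nonneg)
  finally show ?thesis by (simp add: Lp_norm_def form_abs_nonneg)
qed

lemma Lp_forms_lc:
  assumes "u \<in> Lp_forms \<Omega> p q" "v \<in> Lp_forms \<Omega> p q" "p > 0"
  shows "form_lc a u b v \<in> Lp_forms \<Omega> p q"
proof -
  have "form_lc a u b v J \<in> borel_measurable (lebesgue_on \<Omega>)
      \<and> integrable (lebesgue_on \<Omega>) (\<lambda>z. cmod (form_lc a u b v J z) powr p)" if J: "card J = q" for J
  proof -
    have m: "u J \<in> borel_measurable (lebesgue_on \<Omega>)" "v J \<in> borel_measurable (lebesgue_on \<Omega>)"
      and i: "integrable (lebesgue_on \<Omega>) (\<lambda>z. cmod (u J z) powr p)" "integrable (lebesgue_on \<Omega>) (\<lambda>z. cmod (v J z) powr p)"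
      using assms J by (simp_all add: Lp_forms_def)
    have ml: "form_lc a u b v J \<in> borel_measurable (lebesgue_on \<Omega>)"
      unfolding form_lc_def by (intro borel_measurable_add borel_measurable_times borel_measurable_const m)
    have "integrable (lebesgue_on \<Omega>) (\<lambda>z. 2 powr p * ((cmod a) powr p * cmod (u J z) powr p + (cmod b) powr p * cmod (v J z) powr p))"
      using i by simp
    then have "integrable (lebesgue_on \<Omega>) (\<lambda>z. cmod (form_lc a u b v J z) powr p)"
    proof (rule Bochner_Integration.integrable_bound)
      show "(\<lambda>z. cmod (form_lc a u b v J z) powr p) \<in> borel_measurable (lebesgue_on \<Omega>)" using ml by simp
      show "AE z in lebesgue_on \<Omega>. norm (cmod (form_lc a u b v J z) powr p)
        \<le> norm (2 powr p * ((cmod a) powr p * cmod (u J z) powr p + (cmod b) powr p * cmod (v J z) powr p))"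
      proof (rule AE_I2)
        fix z
        have "cmod (form_lc a u b v J z) \<le> cmod a * cmod (u J z) + cmod b * cmod (v J z)"
          unfolding form_lc_def norm_mult[symmetric] by (rule norm_triangle_ineq)
        then have "cmod (form_lc a u b v J z) powr p \<le> (cmod a * cmod (u J z) + cmod b * cmod (v J z)) powr p"
          using assms(3) by (intro powr_mono2) auto
        also have "\<dots> \<le> 2 powr p * ((cmod a * cmod (u J z)) powr p + (cmod b * cmod (v J z)) powr p)"
          using assms(3) by (intro powr_sum_le) auto
        also have "\<dots> = 2 powr p * ((cmod a) powr p * cmod (u J z) powr p + (cmod b) powr p * cmod (v J z) powr p)"
          by (simp add: powr_mult)
        finally show "norm (cmod (form_lc a u b v J z) powr p)
          \<le> norm (2 powr p * ((cmod a) powr p * cmod (u J z) powr p + (cmod b) powr p * cmod (v J z) powr p))"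
          by simp
      qed
    qed
    then show ?thesis using ml by blast
  qed
  then show ?thesis by (simp add: Lp_forms_def)
qed

lemma slobodeckij_eq: "slobodeckij \<Omega> \<epsilon> f = (\<integral>\<^sup>+x. gagliardo \<Omega> \<epsilon> f x \<partial>lebesgue_on \<Omega>)"
  by (simp add: slobodeckij_def gagliardo_def mult.commute)

lemma sobolev_norm_power2:
  "(sobolev_norm \<Omega> \<epsilon> q u)\<^sup>2 = (Lp_norm \<Omega> 2 q u)\<^sup>2 + (\<Sum>J | card J = q. enn2real (slobodeckij \<Omega> \<epsilon> (u J)))"
  unfolding sobolev_norm_def by (rule real_sqrt_pow2) (simp add: sum_nonneg)

lemma sobolev_norm_nonneg: "sobolev_norm \<Omega> \<epsilon> q u \<ge> 0"
  by (simp add: sobolev_norm_def sum_nonneg)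

context bounded_open
begin

lemma Lp_norm_2_power2: "(Lp_norm \<Omega> 2 q u)\<^sup>2 = nsq q u"
  by (simp add: Lp_norm_2 L2_sqn)

lemma sobolev_embedding_forms:
  assumes dens: "measure_density \<Omega> c r0" and \<epsilon>: "0 < \<epsilon>" "\<epsilon> < real CARD('n)"
    and p: "p = 2 * real CARD('n) / (real CARD('n) - \<epsilon>)"
  shows "\<exists>C>0. \<forall>u\<in>sobolev_forms \<Omega> \<epsilon> q. u \<in> Lp_forms \<Omega> p q \<and> Lp_norm \<Omega> p q u \<le> C * sobolev_norm \<Omega> \<epsilon> q u"
proof -
  have d: "real DIM((complex,'n) vec) = 2 * real CARD('n)" by simp
  \<comment> \<open>The real dimension d = 2n turns the critical exponent 2d/(d - 2\<epsilon>) into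
    2n/(n - \<epsilon>).\<close>
  have p': "p = 2 * real DIM((complex,'n) vec) / (real DIM((complex,'n) vec) - 2 * \<epsilon>)"
    unfolding d p using \<epsilon> by (simp add: field_simps)
  have \<epsilon>': "2 * \<epsilon> < real DIM((complex,'n) vec)" using \<epsilon> by simp
  have p0: "p > 0" using \<epsilon> by (simp add: p)
  obtain C where C: "C > 0" and emb: "\<And>f :: (complex,'n) vec \<Rightarrow> complex. f \<in> borel_measurable M \<Longrightarrow>
      integrable M (\<lambda>x. (cmod (f x))\<^sup>2) \<Longrightarrow> (\<integral>\<^sup>+x. gagliardo \<Omega> \<epsilon> f x \<partial>M) < \<infinity> \<Longrightarrow>
      integrable M (\<lambda>x. cmod (f x) powr p) \<and>
      (LINT x|M. cmod (f x) powr p) powr (1 / p)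
        \<le> C * sqrt ((LINT x|M. (cmod (f x))\<^sup>2) + enn2real (\<integral>\<^sup>+x. gagliardo \<Omega> \<epsilon> f x \<partial>M))"
    using sobolev_embedding[OF domain_lmeasurable dens \<epsilon>(1) \<epsilon>' p'] by blast
  define n where "n = real (card {J :: 'n set. card J = q})"
  have n: "n \<ge> 0" by (simp add: n_def)
  \<comment> \<open>The factor n stems from \<open>form_abs_powr_le\<close> and n^(1/p) from summing
    over the multi-indices; the added 1 keeps K positive when there are none.\<close>
  define K where "K = n * n powr (1 / p) * C + 1"
  have K: "K > 0" using n C by (simp add: K_def add_nonneg_pos)
  have "u \<in> Lp_forms \<Omega> p q \<and> Lp_norm \<Omega> p q u \<le> K * sobolev_norm \<Omega> \<epsilon> q u" if u: "u \<in> sobolev_forms \<Omega> \<epsilon> q" for u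
  proof -
    define W where "W = sobolev_norm \<Omega> \<epsilon> q u"
    have W: "W \<ge> 0" by (simp add: W_def sobolev_norm_nonneg)
    have uL: "u \<in> L2 q" using u by (simp add: sobolev_forms_def)
    have J: "integrable M (\<lambda>x. cmod (u J x) powr p)" "(LINT x|M. cmod (u J x) powr p) \<le> (C * W) powr p"
      if J: "card J = q" for J
    proof -
      have fin: "(\<integral>\<^sup>+x. gagliardo \<Omega> \<epsilon> (u J) x \<partial>M) < \<infinity>"
        using u J by (simp add: sobolev_forms_def slobodeckij_eq)
      note e = emb[OF L2_component(1,2)[OF uL J] fin]
      show "integrable M (\<lambda>x. cmod (u J x) powr p)" using e by blast
      have "(LINT z|M. (cmod (u J z))\<^sup>2) \<le> (Lp_norm \<Omega> 2 q u)\<^sup>2"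
        unfolding Lp_norm_2_power2 nsq_eq_sum[OF uL] by (rule member_le_sum) (use J in auto)
      moreover have "enn2real (slobodeckij \<Omega> \<epsilon> (u J)) \<le> (\<Sum>J | card J = q. enn2real (slobodeckij \<Omega> \<epsilon> (u J)))"
        by (rule member_le_sum) (use J in auto)
      ultimately have "(LINT z|M. (cmod (u J z))\<^sup>2) + enn2real (\<integral>\<^sup>+x. gagliardo \<Omega> \<epsilon> (u J) x \<partial>M) \<le> W\<^sup>2"
        by (simp add: W_def sobolev_norm_power2 slobodeckij_eq)
      then have "sqrt ((LINT z|M. (cmod (u J z))\<^sup>2) + enn2real (\<integral>\<^sup>+x. gagliardo \<Omega> \<epsilon> (u J) x \<partial>M)) \<le> W"
        using W by (rule real_le_lsqrt[rotated])
      then have "(LINT x|M. cmod (u J x) powr p) powr (1 / p) \<le> C * W"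
        using e C mult_left_mono[of _ W C] by (meson less_imp_le order_trans)
      then have "((LINT x|M. cmod (u J x) powr p) powr (1 / p)) powr p \<le> (C * W) powr p"
        using p0 by (intro powr_mono2) auto
      then show "(LINT x|M. cmod (u J x) powr p) \<le> (C * W) powr p" using p0 by (simp add: powr_powr)
    qed
    have uLp: "u \<in> Lp_forms \<Omega> p q"
      using J(1) L2_component(1)[OF uL] by (simp add: Lp_forms_def)
    have "(LINT z|M. form_abs q u z powr p) \<le> (LINT z|M. n powr p * (\<Sum>J | card J = q. cmod (u J z) powr p))"
    proof (rule integral_mono)
      show "integrable M (\<lambda>z. form_abs q u z powr p)" by (rule Lp_form_abs_integrable(2)[OF uLp p0])
      show "integrable M (\<lambda>z. n powr p * (\<Sum>J | card J = q. cmod (u J z) powr p))"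
        using J(1) by (intro integrable_mult_right Bochner_Integration.integrable_sum) simp
    qed (unfold n_def, rule form_abs_powr_le[OF p0])
    also have "\<dots> = n powr p * (\<Sum>J | card J = q. LINT z|M. cmod (u J z) powr p)"
      using J(1) by (simp add: Bochner_Integration.integral_sum)
    also have "\<dots> \<le> n powr p * (\<Sum>J :: 'n set | card J = q. (C * W) powr p)"
      using J(2) by (intro mult_left_mono sum_mono) auto
    also have "\<dots> = n powr p * (n * (C * W) powr p)" by (simp add: n_def)
    finally have "(LINT z|M. form_abs q u z powr p) powr (1 / p) \<le> (n powr p * (n * (C * W) powr p)) powr (1 / p)"
      using p0 by (intro powr_mono2) auto
    also have "\<dots> = n * (n powr (1 / p) * (C * W))"
      using p0 n C W by (simp add: powr_mult powr_powr)
    also have "\<dots> \<le> K * W" using W by (simp add: K_def algebra_simps)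
    finally show ?thesis using uLp by (simp add: Lp_norm_def W_def)
  qed
  then show ?thesis using K by blast
qed

lemma L2_subset_Lp:
  assumes "0 < p" "p \<le> 2" and f: "f \<in> L2 q"
  shows "f \<in> Lp_forms \<Omega> p q"
proof -
  have "integrable M (\<lambda>z. cmod (f J z) powr p)" if J: "card J = q" for J
  proof (rule Bochner_Integration.integrable_bound)
    show "integrable M (\<lambda>z. 1 + (cmod (f J z))\<^sup>2)" using L2_component(2)[OF f J] by simp
    show "(\<lambda>z. cmod (f J z) powr p) \<in> borel_measurable M" using L2_component(1)[OF f J] by simp
    show "AE z in M. norm (cmod (f J z) powr p) \<le> norm (1 + (cmod (f J z))\<^sup>2)"
    proof (rule AE_I2)
      fix z
      have "cmod (f J z) powr p \<le> 1 + (cmod (f J z))\<^sup>2"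
      proof (cases "cmod (f J z) \<le> 1")
        case True
        then have "cmod (f J z) powr p \<le> 1 powr p" using assms(1) by (intro powr_mono2) auto
        then show ?thesis by (simp add: add_increasing2)
      next
        case False
        then have "cmod (f J z) powr p \<le> cmod (f J z) powr 2" using assms(2) by (intro powr_mono) auto
        also have "\<dots> = (cmod (f J z))\<^sup>2" by (simp add: powr_numeral)
        finally show ?thesis by simp
      qed
      then show "norm (cmod (f J z) powr p) \<le> norm (1 + (cmod (f J z))\<^sup>2)" by simp
    qed
  qed
  then show ?thesis using L2_component(1)[OF f] by (simp add: Lp_forms_def)
qed

end

section \<open>Compactness and extension of the Neumann operator\<close>

text \<open>Cantor's diagonal argument over an enumeration of S; at each point Bolzano-Weierstrass
  extracts a convergent subsequence.\<close>

lemma diagonal_convergent_subsequence: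
  fixes c :: "nat \<Rightarrow> 'i \<Rightarrow> complex"
  assumes S: "countable S" and bdd: "\<And>k x. x \<in> S \<Longrightarrow> cmod (c k x) \<le> K"
  shows "\<exists>s. strict_mono (s :: nat \<Rightarrow> nat) \<and> (\<forall>x\<in>S. convergent (\<lambda>k. c (s k) x))"
proof (cases "S = {}")
  case True
  then show ?thesis using strict_mono_id by blast
next
  case False
  define P where "P n s \<longleftrightarrow> convergent (\<lambda>k. c (s k) (from_nat_into S n))" for n and s :: "nat \<Rightarrow> nat"
  interpret subseqs P
  proof
    fix n and s :: "nat \<Rightarrow> nat" assume "strict_mono s"
    have "bounded (range (\<lambda>k. c (s k) (from_nat_into S n)))"
      using bdd[OF from_nat_into[OF False]] by (intro boundedI[where B = K]) auto
    then obtain l r where r: "strict_mono r" "((\<lambda>k. c (s k) (from_nat_into S n)) \<circ> r) \<longlonglongrightarrow> l"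
      using bounded_imp_convergent_subsequence by blast
    then have "P n (s \<circ> r)" unfolding P_def by (auto simp: o_def convergent_def)
    then show "\<exists>r. strict_mono r \<and> P n (s \<circ> r)" using r(1) by blast
  qed
  have "convergent (\<lambda>k. c (diagseq k) x)" if "x \<in> S" for x
  proof -
    obtain n where n: "from_nat_into S n = x" using from_nat_into_surj[OF S \<open>x \<in> S\<close>] by blast
    \<comment> \<open>The diagonal sequence inherits the n-th property only after an initial
      segment, which is harmless for convergence.\<close>
    have "P n (diagseq \<circ> ((+) (Suc n)))"
    proof (rule diagseq_holds)
      fix r s :: "nat \<Rightarrow> nat" and n assume "strict_mono r" "P n s"
      then show "P n (s \<circ> r)"
        unfolding P_def using convergent_subseq_convergent[of "\<lambda>k. c (s k) (from_nat_into S n)" r] by (simp add: o_def)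
    qed
    then have "convergent (\<lambda>k. c (diagseq (k + Suc n)) x)"
      unfolding P_def n by (simp add: o_def add.commute)
    then show ?thesis
      using convergent_ignore_initial_segment[of "\<lambda>k. c (diagseq k) x" "Suc n"] by simp
  qed
  then show ?thesis using subseq_diagseq by blast
qed

lemma integrable_lebesgue_on_subset:
  fixes f :: "'a::euclidean_space \<Rightarrow> complex"
  assumes E: "E \<in> sets lebesgue" "\<Omega> \<in> sets lebesgue" "E \<subseteq> \<Omega>" and f: "integrable (lebesgue_on \<Omega>) f"
  shows "integrable (lebesgue_on E) f" "cmod (LINT x|lebesgue_on E. f x) \<le> (LINT x|lebesgue_on \<Omega>. cmod (f x))"
proof -
  have m: "f \<in> borel_measurable (lebesgue_on E)"
    using f by (intro lebesgue_on_subset_measurable[OF E(3)]) simp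
  have le: "(\<integral>\<^sup>+x. ennreal (cmod (f x)) \<partial>lebesgue_on E) \<le> ennreal (LINT x|lebesgue_on \<Omega>. cmod (f x))"
    using nn_integral_lebesgue_on_mono[OF E, of "\<lambda>x. ennreal (cmod (f x))"]
      nn_integral_eq_integral[OF integrable_norm[OF f]] by simp
  have i: "integrable (lebesgue_on E) (\<lambda>x. cmod (f x))"
    using m by (intro integrableI_nonneg le_less_trans[OF le]) auto
  then show fi: "integrable (lebesgue_on E) f" using m by (simp add: integrable_norm_iff)
  have "cmod (LINT x|lebesgue_on E. f x) \<le> (LINT x|lebesgue_on E. cmod (f x))" by (rule integral_norm_bound)
  also have "\<dots> \<le> (LINT x|lebesgue_on \<Omega>. cmod (f x))"
    using le by (simp add: nn_integral_eq_integral[OF i])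
  finally show "cmod (LINT x|lebesgue_on E. f x) \<le> (LINT x|lebesgue_on \<Omega>. cmod (f x))" .
qed

context bounded_open
begin

text \<open>\<open>rellich_estimate\<close> with e = 1/(i+1) for all i involves countably many sets
  in total, so one diagonal subsequence makes all integrals over them converge. The estimate is
  applied to differences of members of the sequence, and this is why the Sobolev bound is assumed
  for differences.\<close>

lemma rellich_forms:
  fixes u :: "nat \<Rightarrow> 'n form"
  assumes dens: "measure_density \<Omega> c r0" and \<epsilon>: "0 < \<epsilon>"
    and u: "\<And>k. u k \<in> L2 q" "\<And>k. nsq q (u k) \<le> R"
    and diff: "\<And>k l. form_lc 1 (u k) (-1) (u l) \<in> sobolev_forms \<Omega> \<epsilon> q"
      "\<And>k l. sobolev_norm \<Omega> \<epsilon> q (form_lc 1 (u k) (-1) (u l)) \<le> R'"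
  shows "\<exists>s :: nat \<Rightarrow> nat. strict_mono s \<and> L2.cauchy_seq q (\<lambda>k. u (s k))"
proof -
  have "\<forall>i::nat. \<exists>\<E> C. finite \<E> \<and> C \<ge> 0 \<and> (\<forall>E\<in>\<E>. E \<in> sets lebesgue \<and> E \<subseteq> \<Omega>) \<and>
    (\<forall>f :: (complex,'n) vec \<Rightarrow> complex. f \<in> borel_measurable M \<longrightarrow> integrable M (\<lambda>x. (cmod (f x))\<^sup>2) \<longrightarrow>
      (\<integral>\<^sup>+x. gagliardo \<Omega> \<epsilon> f x \<partial>M) < \<infinity> \<longrightarrow>
      (LINT x|M. (cmod (f x))\<^sup>2) \<le> 1 / Suc i * enn2real (\<integral>\<^sup>+x. gagliardo \<Omega> \<epsilon> f x \<partial>M)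
         + C * (\<Sum>E\<in>\<E>. (cmod (LINT x|lebesgue_on E. f x))\<^sup>2))"
    by (intro allI rellich_estimate[OF open_domain bounded_domain dens \<epsilon>]) simp
  from choice[OF this] obtain \<E> :: "nat \<Rightarrow> (complex,'n) vec set set" where
    "\<forall>i::nat. \<exists>C. finite (\<E> i) \<and> C \<ge> 0 \<and> (\<forall>E\<in>\<E> i. E \<in> sets lebesgue \<and> E \<subseteq> \<Omega>) \<and>
    (\<forall>f :: (complex,'n) vec \<Rightarrow> complex. f \<in> borel_measurable M \<longrightarrow> integrable M (\<lambda>x. (cmod (f x))\<^sup>2) \<longrightarrow>
      (\<integral>\<^sup>+x. gagliardo \<Omega> \<epsilon> f x \<partial>M) < \<infinity> \<longrightarrow>
      (LINT x|M. (cmod (f x))\<^sup>2) \<le> 1 / Suc i * enn2real (\<integral>\<^sup>+x. gagliardo \<Omega> \<epsilon> f x \<partial>M)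
         + C * (\<Sum>E\<in>\<E> i. (cmod (LINT x|lebesgue_on E. f x))\<^sup>2))" by blast
  from choice[OF this] obtain C :: "nat \<Rightarrow> real" where \<E>: "\<And>i. finite (\<E> i)" "\<And>i. C i \<ge> 0"
    "\<And>i E. E \<in> \<E> i \<Longrightarrow> E \<in> sets lebesgue" "\<And>i E. E \<in> \<E> i \<Longrightarrow> E \<subseteq> \<Omega>"
    and est: "\<And>i (f :: (complex,'n) vec \<Rightarrow> complex). f \<in> borel_measurable M \<Longrightarrow> integrable M (\<lambda>x. (cmod (f x))\<^sup>2) \<Longrightarrow>
      (\<integral>\<^sup>+x. gagliardo \<Omega> \<epsilon> f x \<partial>M) < \<infinity> \<Longrightarrow>
      (LINT x|M. (cmod (f x))\<^sup>2) \<le> 1 / Suc i * enn2real (\<integral>\<^sup>+x. gagliardo \<Omega> \<epsilon> f x \<partial>M)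
         + C i * (\<Sum>E\<in>\<E> i. (cmod (LINT x|lebesgue_on E. f x))\<^sup>2)" by blast
  define I where "I = {J :: 'n set. card J = q} \<times> (\<Union>i. \<E> i)"
  define b where "b k x = (LINT z|lebesgue_on (snd x). u k (fst x) z)" for k and x :: "'n set \<times> (complex,'n) vec set"
  have int: "integrable (lebesgue_on E) (u k J)" if "E \<in> \<E> i" "card J = q" for E i k J
    using \<E>(3,4)[OF that(1)] fmeasurableD[OF domain_lmeasurable]
    by (intro integrable_lebesgue_on_subset(1)[OF _ _ _ L2_component(3)[OF u(1) that(2)]]) auto
  have "countable (\<Union>i. \<E> i)" by (rule countable_UN) (simp_all add: countable_finite \<E>(1))
  then have "countable I" unfolding I_def by (intro countable_SIGMA[OF countable_finite]) simp_all
  moreover have "cmod (b k x) \<le> sqrt (measure M (space M)) * sqrt R" if "x \<in> I" for k x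
  proof -
    obtain J E i where x: "x = (J, E)" "card J = q" "E \<in> \<E> i" using \<open>x \<in> I\<close> unfolding I_def by blast
    have "cmod (b k x) \<le> (LINT z|M. \<bar>cmod (u k J z)\<bar>)"
      unfolding b_def x(1) fst_conv snd_conv abs_norm_cancel
      using \<E>(3,4)[OF x(3)] fmeasurableD[OF domain_lmeasurable]
      by (intro integrable_lebesgue_on_subset(2) L2_component(3)[OF u(1) x(2)]) auto
    also have "\<dots> \<le> sqrt (measure M (space M)) * sqrt (LINT z|M. (cmod (u k J z))\<^sup>2)"
      using L2_component[OF u(1) x(2)] by (intro integral_abs_le_sqrt(2)) auto
    also have "\<dots> \<le> sqrt (measure M (space M)) * sqrt R"
    proof (intro mult_left_mono real_sqrt_le_mono)
      have "(LINT z|M. (cmod (u k J z))\<^sup>2) \<le> nsq q (u k)"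
        unfolding nsq_eq_sum[OF u(1)] by (rule member_le_sum) (use x(2) in auto)
      then show "(LINT z|M. (cmod (u k J z))\<^sup>2) \<le> R" using u(2)[of k] by linarith
    qed simp
    finally show ?thesis .
  qed
  ultimately obtain s where s: "strict_mono s" "\<And>x. x \<in> I \<Longrightarrow> convergent (\<lambda>k. b (s k) x)"
    using diagonal_convergent_subsequence[of I b] by blast
  define L where "L x = lim (\<lambda>k. b (s k) x)" for x
  have L: "(\<lambda>k. b (s k) x) \<longlonglongrightarrow> L x" if "x \<in> I" for x
    using s(2)[OF that] by (simp add: L_def convergent_LIMSEQ_iff)
  have key: "nsq q (form_lc 1 (u k) (-1) (u l)) \<le> 1 / Suc i * R'\<^sup>2
      + C i * (\<Sum>J | card J = q. \<Sum>E\<in>\<E> i. (cmod (b k (J, E) - b l (J, E)))\<^sup>2)" for k l i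
  proof -
    define w where "w = form_lc 1 (u k) (-1) (u l)"
    have wL: "w \<in> L2 q" unfolding w_def by (rule form_lc_L2[OF u(1) u(1)])
    have "nsq q w = (\<Sum>J | card J = q. LINT z|M. (cmod (w J z))\<^sup>2)" by (rule nsq_eq_sum[OF wL])
    also have "\<dots> \<le> (\<Sum>J | card J = q. 1 / Suc i * enn2real (slobodeckij \<Omega> \<epsilon> (w J))
        + C i * (\<Sum>E\<in>\<E> i. (cmod (b k (J, E) - b l (J, E)))\<^sup>2))"
    proof (rule sum_mono)
      fix J :: "'n set" assume "J \<in> {J. card J = q}"
      then have J: "card J = q" by simp
      have fin: "(\<integral>\<^sup>+x. gagliardo \<Omega> \<epsilon> (w J) x \<partial>M) < \<infinity>"
        using diff(1)[of k l] J by (simp add: sobolev_forms_def slobodeckij_eq w_def)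
      have "(LINT x|lebesgue_on E. w J x) = b k (J, E) - b l (J, E)" if "E \<in> \<E> i" for E
      proof -
        have "(LINT x|lebesgue_on E. w J x) = (LINT x|lebesgue_on E. u k J x - u l J x)"
          by (simp add: w_def form_lc_def)
        also have "\<dots> = b k (J, E) - b l (J, E)"
          unfolding b_def fst_conv snd_conv by (rule Bochner_Integration.integral_diff[OF int[OF that J] int[OF that J]])
        finally show ?thesis .
      qed
      then have "(\<Sum>E\<in>\<E> i. (cmod (LINT x|lebesgue_on E. w J x))\<^sup>2) = (\<Sum>E\<in>\<E> i. (cmod (b k (J, E) - b l (J, E)))\<^sup>2)"
        by (intro sum.cong refl) simp
      then show "(LINT z|M. (cmod (w J z))\<^sup>2) \<le> 1 / Suc i * enn2real (slobodeckij \<Omega> \<epsilon> (w J))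
        + C i * (\<Sum>E\<in>\<E> i. (cmod (b k (J, E) - b l (J, E)))\<^sup>2)"
        using est[OF L2_component(1,2)[OF wL J] fin, of i] by (simp only: slobodeckij_eq)
    qed
    also have "\<dots> = 1 / Suc i * (\<Sum>J | card J = q. enn2real (slobodeckij \<Omega> \<epsilon> (w J)))
        + C i * (\<Sum>J | card J = q. \<Sum>E\<in>\<E> i. (cmod (b k (J, E) - b l (J, E)))\<^sup>2)"
      by (simp only: sum.distrib sum_distrib_left)
    also have "(\<Sum>J | card J = q. enn2real (slobodeckij \<Omega> \<epsilon> (w J))) \<le> R'\<^sup>2"
    proof -
      have "(\<Sum>J | card J = q. enn2real (slobodeckij \<Omega> \<epsilon> (w J))) \<le> (sobolev_norm \<Omega> \<epsilon> q w)\<^sup>2"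
        by (simp add: sobolev_norm_power2)
      also have "\<dots> \<le> R'\<^sup>2"
        unfolding w_def by (intro power_mono diff(2) sobolev_norm_nonneg)
      finally show ?thesis .
    qed
    finally show ?thesis by (simp add: w_def mult_left_mono divide_right_mono)
  qed
  have "L2.cauchy_seq q (\<lambda>k. u (s k))"
    unfolding L2.cauchy_seq_def
  proof (intro conjI allI impI u(1))
    fix e :: real assume e: "e > 0"
    have "e / (2 * (R'\<^sup>2 + 1)) > 0" using e by (simp add: add_nonneg_pos)
    then obtain i where i: "1 / Suc i < e / (2 * (R'\<^sup>2 + 1))" by (rule nat_approx_posE)
    have "1 / Suc i * R'\<^sup>2 \<le> 1 / Suc i * (R'\<^sup>2 + 1)" by (intro mult_left_mono) auto
    also have "\<dots> < e / (2 * (R'\<^sup>2 + 1)) * (R'\<^sup>2 + 1)"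
      using i by (intro mult_strict_right_mono) (auto simp: add_nonneg_pos)
    also have "\<dots> = e / 2"
    proof -
      have "e / (2 * y) * y = e / 2" if "y \<noteq> 0" for y :: real using that by simp
      moreover have "R'\<^sup>2 + 1 \<noteq> 0" using zero_le_power2[of R'] by linarith
      ultimately show ?thesis by blast
    qed
    finally have 1: "1 / Suc i * R'\<^sup>2 < e / 2" .
    \<comment> \<open>Passing through the limits L splits the contribution of the integrals into h k
      + h l, each below e/4; the energy term accounts for the remaining e/2.\<close>
    define h where "h k = C i * (\<Sum>J | card J = q. \<Sum>E\<in>\<E> i. 2 * (cmod (b (s k) (J, E) - L (J, E)))\<^sup>2)" for k
    have "h \<longlonglongrightarrow> C i * (\<Sum>J :: 'n set | card J = q. \<Sum>E\<in>\<E> i. 2 * (cmod (L (J, E) - L (J, E)))\<^sup>2)"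
      unfolding h_def by (intro tendsto_intros L) (auto simp: I_def)
    then have "h \<longlonglongrightarrow> 0" by simp
    then have "\<exists>N. \<forall>k\<ge>N. norm (h k - 0) < e / 4" by (rule LIMSEQ_D) (use e in simp)
    then obtain N where N: "\<And>k. k \<ge> N \<Longrightarrow> \<bar>h k\<bar> < e / 4" by auto
    have "nsq q (form_lc 1 (u (s k)) (-1) (u (s l))) < e" if kl: "k \<ge> N" "l \<ge> N" for k l
    proof -
      have sq: "(cmod (x - y))\<^sup>2 \<le> 2 * (cmod (x - z))\<^sup>2 + 2 * (cmod (y - z))\<^sup>2" for x y z
      proof -
        have "cmod (x - y) \<le> cmod (x - z) + cmod (y - z)"
          using norm_triangle_ineq4[of "x - z" "y - z"] by simp
        then have "(cmod (x - y))\<^sup>2 \<le> (cmod (x - z) + cmod (y - z))\<^sup>2" by (intro power_mono) auto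
        also have "\<dots> \<le> 2 * (cmod (x - z))\<^sup>2 + 2 * (cmod (y - z))\<^sup>2"
          using zero_le_power2[of "cmod (x - z) - cmod (y - z)"] by (simp add: power2_sum power2_diff)
        finally show ?thesis .
      qed
      have "C i * (\<Sum>J | card J = q. \<Sum>E\<in>\<E> i. (cmod (b (s k) (J, E) - b (s l) (J, E)))\<^sup>2)
          \<le> C i * (\<Sum>J | card J = q. \<Sum>E\<in>\<E> i. 2 * (cmod (b (s k) (J, E) - L (J, E)))\<^sup>2 + 2 * (cmod (b (s l) (J, E) - L (J, E)))\<^sup>2)"
        by (intro mult_left_mono sum_mono sq \<E>(2))
      also have "\<dots> = h k + h l" by (simp only: h_def sum.distrib distrib_left)
      finally show ?thesis
        using key[of "s k" "s l" i] N[OF kl(1)] N[OF kl(2)] 1 by linarith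
    qed
    then show "\<exists>N. \<forall>k\<ge>N. \<forall>l\<ge>N. nsq q (form_lc 1 (u (s k)) (-1) (u (s l))) < e" by blast
  qed
  then show ?thesis using s(1) by blast
qed

end

locale subelliptic_domain = bounded_open \<Omega> for \<Omega> :: "(complex^'n::{finite,linorder}) set" +
  fixes m :: nat and \<epsilon> C c r0 :: real
  assumes dens: "measure_density \<Omega> c r0" and eps: "0 < \<epsilon>" "\<epsilon> \<le> 1 / 2" and C_pos: "C > 0"
    and dom_sobolev: "dbar_dom \<Omega> (Suc m) \<inter> dbar_star_dom \<Omega> m \<subseteq> sobolev_forms \<Omega> \<epsilon> (Suc m)"
    and subelliptic: "\<And>u. u \<in> dbar_dom \<Omega> (Suc m) \<inter> dbar_star_dom \<Omega> m \<Longrightarrow>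
      sobolev_norm \<Omega> \<epsilon> (Suc m) u \<le> C * sqrt ((Lp_norm \<Omega> 2 (Suc (Suc m)) (dbar \<Omega> (Suc m) u))\<^sup>2
        + (Lp_norm \<Omega> 2 m (dbar_star \<Omega> m u))\<^sup>2)"
begin

sublocale coercive_domain \<Omega> m "C\<^sup>2"
proof
  show "0 \<le> C\<^sup>2" by simp
  fix u assume u: "u \<in> dbar_dom \<Omega> (Suc m) \<inter> dbar_star_dom \<Omega> m"
  have "L2.sqn (Suc m) u \<le> (sobolev_norm \<Omega> \<epsilon> (Suc m) u)\<^sup>2"
    by (simp add: sobolev_norm_power2 Lp_norm_2_power2 sum_nonneg)
  also have "\<dots> \<le> (C * sqrt ((Lp_norm \<Omega> 2 (Suc (Suc m)) (dbar \<Omega> (Suc m) u))\<^sup>2 + (Lp_norm \<Omega> 2 m (dbar_star \<Omega> m u))\<^sup>2))\<^sup>2"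
    by (intro power_mono subelliptic u sobolev_norm_nonneg)
  also have "\<dots> = C\<^sup>2 * (L2.sqn (Suc (Suc m)) (dbar \<Omega> (Suc m) u) + L2.sqn m (dbar_star \<Omega> m u))"
    by (simp add: power_mult_distrib Lp_norm_2_power2 L2_sqn)
  finally show "L2.sqn (Suc m) u \<le> C\<^sup>2 * (L2.sqn (Suc (Suc m)) (dbar \<Omega> (Suc m) u) + L2.sqn m (dbar_star \<Omega> m u))" .
qed

abbreviation "N \<equiv> dbar_neumann \<Omega> (Suc m)"

lemma sobolev_norm_le_E: "u \<in> D \<Longrightarrow> sobolev_norm \<Omega> \<epsilon> (Suc m) u \<le> C * sqrt (E.sqn u)"
  using subelliptic[of u] by (simp add: D_def E_sqn Lp_norm_2_power2)

lemma D_sobolev: "u \<in> D \<Longrightarrow> u \<in> sobolev_forms \<Omega> \<epsilon> (Suc m)"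
  using dom_sobolev by (auto simp: D_def)

text \<open>Testing the weak equation with N f itself gives Q(Nf, Nf) = (Nf, f), at most C
  sqrt(Q(Nf, Nf)) times the norm of f; one square root cancels.\<close>

lemma E_sqn_N_le:
  assumes f: "f \<in> L2 (Suc m)"
  shows "sqrt (E.sqn (N f)) \<le> C * sqrt (nsq (Suc m) f)"
proof -
  note n = dbar_neumann_weak_solution[OF f]
  define e where "e = sqrt (E.sqn (N f))"
  have e0: "e \<ge> 0" by (simp add: e_def E.sqn_nonneg[OF n(1)])
  have "e\<^sup>2 = E.sqn (N f)" by (simp add: e_def E.sqn_nonneg[OF n(1)])
  also have "\<dots> = Re (ip (Suc m) (N f) f)" using n(2)[OF n(1)] by (simp add: E.sqn_def)
  also have "\<dots> \<le> cmod (ip (Suc m) (N f) f)" by (rule complex_Re_le_cmod)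
  also have "\<dots> \<le> sqrt (nsq (Suc m) (N f)) * sqrt (nsq (Suc m) f)"
    by (rule L2.norm_B_le[OF D_L2(1)[OF n(1)] f])
  also have "\<dots> \<le> sqrt (C\<^sup>2 * E.sqn (N f)) * sqrt (nsq (Suc m) f)"
    using coercive_E[OF n(1)] by (intro mult_right_mono real_sqrt_le_mono) (simp_all add: L2_sqn)
  also have "\<dots> = e * (C * sqrt (nsq (Suc m) f))"
    using C_pos by (simp add: e_def real_sqrt_mult)
  finally have le: "e * e \<le> e * (C * sqrt (nsq (Suc m) f))" by (simp add: power2_eq_square)
  show ?thesis
  proof (cases "e = 0")
    case True
    then show ?thesis using C_pos by (simp add: e_def[symmetric] L2_sqn)
  next
    case False
    then show ?thesis using le e0 by (simp add: e_def[symmetric])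
  qed
qed

text \<open>\<open>Q v u\<close> is conjugate linear in u, so coefficients of a combination of
  solutions appear conjugated on the right-hand side. The pairing with f behaves in the same way,
  which makes the solution operators complex linear.\<close>

lemma weak_solution_lc:
  assumes u: "u \<in> D" "\<And>v. v \<in> D \<Longrightarrow> Q v u = l v" and w: "w \<in> D" "\<And>v. v \<in> D \<Longrightarrow> Q v w = l' v"
    and x: "x \<in> D" "\<And>v. v \<in> D \<Longrightarrow> Q v x = cnj a * l v + cnj b * l' v"
  shows "form_eq \<Omega> (Suc m) x (form_lc a u b w)"
proof (rule weak_solution_unique[OF x(1) D_lc(1)[OF u(1) w(1)]])
  fix v assume v: "v \<in> D"
  show "Q v x = Q v (form_lc a u b w)"
    using E.B_lc_right[OF u(1) w(1) v] x(2)[OF v] u(2)[OF v] w(2)[OF v] by simp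
qed

lemma neumann_linear: "linear_form_operator \<Omega> (Suc m) 2 2 N"
  unfolding linear_form_operator_def
proof (intro conjI ballI allI impI)
  show "N f \<in> L2 (Suc m)" if "f \<in> L2 (Suc m)" for f
    by (rule D_L2(1)[OF dbar_neumann_weak_solution(1)[OF that]])
  show "form_eq \<Omega> (Suc m) (N f) (N g)" if f: "f \<in> L2 (Suc m)" and g: "g \<in> L2 (Suc m)" and eq: "form_eq \<Omega> (Suc m) f g" for f g
  proof (rule weak_solution_unique[OF dbar_neumann_weak_solution(1)[OF f] dbar_neumann_weak_solution(1)[OF g]])
    fix v assume v: "v \<in> D"
    show "Q v (N f) = Q v (N g)"
      unfolding dbar_neumann_weak_solution(2)[OF f v] dbar_neumann_weak_solution(2)[OF g v]
      by (rule ip_cong[OF D_L2(1)[OF v] D_L2(1)[OF v] f g form_eq_refl eq])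
  qed
  show "form_eq \<Omega> (Suc m) (N (\<lambda>J z. a * f J z + b * g J z)) (\<lambda>J z. a * N f J z + b * N g J z)"
    if f: "f \<in> L2 (Suc m)" and g: "g \<in> L2 (Suc m)" for f g a b
  proof -
    have lc: "form_lc a f b g \<in> L2 (Suc m)" by (rule form_lc_L2[OF f g])
    note nf = dbar_neumann_weak_solution[OF f] and ng = dbar_neumann_weak_solution[OF g] and n = dbar_neumann_weak_solution[OF lc]
    have lin: "Q v (N (form_lc a f b g)) = cnj a * ip (Suc m) v f + cnj b * ip (Suc m) v g" if v: "v \<in> D" for v
      unfolding n(2)[OF v] by (rule L2.B_lc_right[OF f g D_L2(1)[OF v]])
    have "form_eq \<Omega> (Suc m) (N (form_lc a f b g)) (form_lc a (N f) b (N g))"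
      by (rule weak_solution_lc[OF nf ng n(1) lin])
    then show ?thesis by (simp only: form_lc_def)
  qed
qed

lemma neumann_compact: "compact_L2_operator \<Omega> (Suc m) N"
  unfolding compact_L2_operator_def
proof (intro conjI neumann_linear allI impI)
  fix f :: "nat \<Rightarrow> 'n form" and B
  assume "\<forall>k. f k \<in> L2 (Suc m) \<and> Lp_norm \<Omega> 2 (Suc m) (f k) \<le> B"
  then have f: "\<And>k. f k \<in> L2 (Suc m)" "\<And>k. sqrt (nsq (Suc m) (f k)) \<le> B" by (simp_all add: Lp_norm_2)
  note n = dbar_neumann_weak_solution(1)[OF f(1)]
  have "0 \<le> sqrt (nsq (Suc m) (f 0))" by (simp add: L2_sqn)
  then have B: "B \<ge> 0" using f(2)[of 0] by (rule order_trans)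
  have sE: "E.sqn (N (f k)) \<le> (C * B)\<^sup>2" for k
  proof -
    have "C * sqrt (nsq (Suc m) (f k)) \<le> C * B" using f(2) C_pos by (intro mult_left_mono) auto
    then have "sqrt (E.sqn (N (f k))) \<le> C * B" using E_sqn_N_le[OF f(1)[of k]] by linarith
    then have "(sqrt (E.sqn (N (f k))))\<^sup>2 \<le> (C * B)\<^sup>2"
      by (intro power_mono) (simp_all add: E.sqn_nonneg[OF n])
    then show ?thesis by (simp add: E.sqn_nonneg[OF n])
  qed
  have dD: "form_lc 1 (N (f k)) (-1) (N (f l)) \<in> D" for k l by (rule D_lc(1)[OF n n])
  \<comment> \<open>The parallelogram law with the nonnegative term of the sum dropped; hence the
    factor 4.\<close>
  have dE: "E.sqn (form_lc 1 (N (f k)) (-1) (N (f l))) \<le> 4 * (C * B)\<^sup>2" for k l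
  proof -
    have "0 \<le> E.sqn (form_lc 1 (N (f k)) 1 (N (f l)))" by (rule E.sqn_nonneg[OF D_lc(1)[OF n n]])
    then have "E.sqn (form_lc 1 (N (f k)) (-1) (N (f l))) \<le> 2 * E.sqn (N (f k)) + 2 * E.sqn (N (f l))"
      by (simp add: E.sqn_lc[OF n n])
    then show ?thesis using sE[of k] sE[of l] by linarith
  qed
  have "\<exists>s. strict_mono s \<and> L2.cauchy_seq (Suc m) (\<lambda>k. N (f (s k)))"
  proof (rule rellich_forms[OF dens eps(1)])
    show "N (f k) \<in> L2 (Suc m)" for k by (rule D_L2(1)[OF n])
    show "nsq (Suc m) (N (f k)) \<le> C\<^sup>2 * (C * B)\<^sup>2" for k
      using coercive_E[OF n[of k]] mult_left_mono[OF sE[of k], of "C\<^sup>2"] by simp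
    show "form_lc 1 (N (f k)) (-1) (N (f l)) \<in> sobolev_forms \<Omega> \<epsilon> (Suc m)" for k l
      by (rule D_sobolev[OF dD])
    show "sobolev_norm \<Omega> \<epsilon> (Suc m) (form_lc 1 (N (f k)) (-1) (N (f l))) \<le> C * sqrt (4 * (C * B)\<^sup>2)" for k l
    proof -
      have "C * sqrt (E.sqn (form_lc 1 (N (f k)) (-1) (N (f l)))) \<le> C * sqrt (4 * (C * B)\<^sup>2)"
        using dE C_pos by (intro mult_left_mono real_sqrt_le_mono) auto
      then show ?thesis using sobolev_norm_le_E[OF dD[of k l]] by linarith
    qed
  qed
  then obtain s :: "nat \<Rightarrow> nat" where s: "strict_mono s" "L2.cauchy_seq (Suc m) (\<lambda>k. N (f (s k)))" by blast
  obtain g where g: "g \<in> L2 (Suc m)"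
    "(\<lambda>k. nsq (Suc m) (form_lc 1 (N (f (s k))) (-1) g)) \<longlonglongrightarrow> 0"
    using L2_complete_carrier[unfolded L2.complete_carrier_def, rule_format, OF s(2)] by blast
  have "(\<lambda>k. sqrt (nsq (Suc m) (form_lc 1 (N (f (s k))) (-1) g))) \<longlonglongrightarrow> sqrt 0"
    by (intro tendsto_real_sqrt g(2))
  then have "(\<lambda>k. Lp_norm \<Omega> 2 (Suc m) (\<lambda>J z. N (f (s k)) J z - g J z)) \<longlonglongrightarrow> 0"
    unfolding Lp_norm_2 form_lc_def by simp
  then show "\<exists>s g. strict_mono s \<and> g \<in> L2 (Suc m)
      \<and> (\<lambda>k. Lp_norm \<Omega> 2 (Suc m) (\<lambda>J z. N (f (s k)) J z - g J z)) \<longlonglongrightarrow> 0"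
    by (intro exI[of _ s] exI[of _ g] conjI s(1) g(1))
qed

section \<open>Extension to the dual Lebesgue exponents\<close>

context
  fixes p1 p2 :: real
  assumes p1: "p1 = 2 * real CARD('n) / (real CARD('n) + \<epsilon>)"
    and p2: "p2 = 2 * real CARD('n) / (real CARD('n) - \<epsilon>)"
begin

text \<open>The reciprocals are (n - \<epsilon>)/(2n) and (n + \<epsilon>)/(2n), so the target
  exponent is dual to the source exponent. The strict bounds come from \<epsilon> <= 1/2 <
  n.\<close>

lemma exponents: "p2 > 1" "p1 > 1" "1 / p2 + 1 / p1 = 1" "p1 \<le> 2" "\<epsilon> < real CARD('n)"
proof -
  have "CARD('n) \<ge> 1" using zero_less_card_finite[where 'a = 'n] by linarith
  then have n: "real CARD('n) \<ge> 1" by (simp only: real_of_nat_ge_one_iff)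
  show less: "\<epsilon> < real CARD('n)" using n eps by linarith
  have d: "real CARD('n) - \<epsilon> > 0" "real CARD('n) + \<epsilon> > 0" using less n eps(1) by linarith+
  show "p2 > 1" unfolding p2 less_divide_eq_1_pos[OF d(1)] using n eps by linarith
  show "p1 > 1" unfolding p1 less_divide_eq_1_pos[OF d(2)] using n eps by linarith
  show "p1 \<le> 2" unfolding p1 pos_divide_le_eq[OF d(2)] using eps(1) by simp
  have "1 / p2 + 1 / p1 = (real CARD('n) - \<epsilon>) / (2 * real CARD('n)) + (real CARD('n) + \<epsilon>) / (2 * real CARD('n))"
    by (simp add: p1 p2)
  also have "\<dots> = 1" using n by (simp add: add_divide_distrib[symmetric])
  finally show "1 / p2 + 1 / p1 = 1" .
qed

text \<open>The weak equation of the Neumann operator with \<open>ip\<close> read as the duality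
  pairing of \<open>L\<^sup>p\<close> spaces with conjugate exponents.\<close>

definition extended_neumann :: "'n form \<Rightarrow> 'n form" where
  "extended_neumann f = (SOME u. u \<in> D \<and> (\<forall>v\<in>D. Q v u = ip (Suc m) v f))"

theorem neumann_extension:
  "\<exists>T. linear_form_operator \<Omega> (Suc m) p1 p2 T
    \<and> (\<forall>u \<in> L2 (Suc m). form_eq \<Omega> (Suc m) (T u) (N u))
    \<and> (\<exists>C'>0. \<forall>u \<in> Lp_forms \<Omega> p1 (Suc m). Lp_norm \<Omega> p2 (Suc m) (T u) \<le> C' * Lp_norm \<Omega> p1 (Suc m) u)"
proof -
  obtain Cs where Cs: "Cs > 0" and emb: "\<And>u. u \<in> sobolev_forms \<Omega> \<epsilon> (Suc m) \<Longrightarrow> u \<in> Lp_forms \<Omega> p2 (Suc m)"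
    "\<And>u. u \<in> sobolev_forms \<Omega> \<epsilon> (Suc m) \<Longrightarrow> Lp_norm \<Omega> p2 (Suc m) u \<le> Cs * sobolev_norm \<Omega> \<epsilon> (Suc m) u"
    using sobolev_embedding_forms[OF dens eps(1) exponents(5) p2, of "Suc m"] by blast
  have DLp: "v \<in> Lp_forms \<Omega> p2 (Suc m)" if "v \<in> D" for v by (rule emb(1)[OF D_sobolev[OF that]])
  have D_le: "Lp_norm \<Omega> p2 (Suc m) v \<le> Cs * C * sqrt (E.sqn v)" if v: "v \<in> D" for v
  proof -
    have "Lp_norm \<Omega> p2 (Suc m) v \<le> Cs * sobolev_norm \<Omega> \<epsilon> (Suc m) v" by (rule emb(2)[OF D_sobolev[OF v]])
    also have "\<dots> \<le> Cs * (C * sqrt (E.sqn v))" using Cs by (intro mult_left_mono sobolev_norm_le_E[OF v]) simp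
    finally show ?thesis by simp
  qed
  have norm_nonneg: "Lp_norm \<Omega> p (Suc m) v \<ge> 0" for p v by (simp add: Lp_norm_def)
  \<comment> \<open>Hoelder combined with the embedding of the form domain: f acts as a bounded
    functional in the \<open>Q\<close> norm, as the Riesz theorem requires.\<close>
  have pair: "cmod (ip (Suc m) v f) \<le> Cs * C * Lp_norm \<Omega> p1 (Suc m) f * sqrt (E.sqn v)"
    if f: "f \<in> Lp_forms \<Omega> p1 (Suc m)" and v: "v \<in> D" for f v
  proof -
    have "cmod (ip (Suc m) v f) \<le> Lp_norm \<Omega> p2 (Suc m) v * Lp_norm \<Omega> p1 (Suc m) f"
      by (rule L2_inner_le_Lp[OF exponents(1-3) DLp[OF v] f])
    also have "\<dots> \<le> Cs * C * sqrt (E.sqn v) * Lp_norm \<Omega> p1 (Suc m) f"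
      by (intro mult_right_mono D_le v norm_nonneg)
    finally show ?thesis by (simp add: mult_ac)
  qed
  have ip_sum: "ip (Suc m) v f = (\<Sum>J | card J = Suc m. LINT z|M. v J z * cnj (f J z))"
    if "f \<in> Lp_forms \<Omega> p1 (Suc m)" "v \<in> D" for f v
    unfolding L2_inner_def
    using L2_inner_integrable_Lp[OF exponents(1-3) DLp[OF that(2)] that(1)]
    by (intro Bochner_Integration.integral_sum) simp
  have T: "extended_neumann f \<in> D \<and> (\<forall>v\<in>D. Q v (extended_neumann f) = ip (Suc m) v f)"
    if f: "f \<in> Lp_forms \<Omega> p1 (Suc m)" for f
  proof -
    have "\<exists>u\<in>D. \<forall>v\<in>D. Q v u = ip (Suc m) v f"
    proof (rule weak_solution_exists[OF _ pair[OF f]])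
      show "ip (Suc m) (form_lc a u b v) f = a * ip (Suc m) u f + b * ip (Suc m) v f" if u: "u \<in> D" and v: "v \<in> D" for a u b v
      proof -
        have "(LINT z|M. form_lc a u b v J z * cnj (f J z)) = a * (LINT z|M. u J z * cnj (f J z)) + b * (LINT z|M. v J z * cnj (f J z))"
          if J: "card J = Suc m" for J
        proof -
          have i: "integrable M (\<lambda>z. u J z * cnj (f J z))" "integrable M (\<lambda>z. v J z * cnj (f J z))"
            by (rule L2_inner_integrable_Lp[OF exponents(1-3) DLp[OF u] f J], rule L2_inner_integrable_Lp[OF exponents(1-3) DLp[OF v] f J])
          have "(LINT z|M. form_lc a u b v J z * cnj (f J z)) = (LINT z|M. a * (u J z * cnj (f J z)) + b * (v J z * cnj (f J z)))"
            by (simp add: form_lc_def algebra_simps)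
          then show ?thesis using i by simp
        qed
        then show ?thesis
          unfolding ip_sum[OF f D_lc(1)[OF u v]] ip_sum[OF f u] ip_sum[OF f v]
          by (simp add: sum.distrib sum_distrib_left)
      qed
    qed
    then have "\<exists>u. u \<in> D \<and> (\<forall>v\<in>D. Q v u = ip (Suc m) v f)" by blast
    then show ?thesis unfolding extended_neumann_def by (rule someI_ex)
  qed
  have TD: "extended_neumann f \<in> D" if "f \<in> Lp_forms \<Omega> p1 (Suc m)" for f
    using T[OF that] by (rule conjunct1)
  have TQ: "Q v (extended_neumann f) = ip (Suc m) v f" if "f \<in> Lp_forms \<Omega> p1 (Suc m)" "v \<in> D" for f v
    by (rule bspec[OF conjunct2[OF T[OF that(1)]] that(2)])
  have lin: "linear_form_operator \<Omega> (Suc m) p1 p2 extended_neumann"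
    unfolding linear_form_operator_def
  proof (intro conjI ballI allI impI)
    show "extended_neumann f \<in> Lp_forms \<Omega> p2 (Suc m)" if "f \<in> Lp_forms \<Omega> p1 (Suc m)" for f
      by (rule DLp[OF TD[OF that]])
    show "form_eq \<Omega> (Suc m) (extended_neumann f) (extended_neumann g)"
      if f: "f \<in> Lp_forms \<Omega> p1 (Suc m)" and g: "g \<in> Lp_forms \<Omega> p1 (Suc m)" and eq: "form_eq \<Omega> (Suc m) f g" for f g
    proof (rule weak_solution_unique[OF TD[OF f] TD[OF g]])
      fix v assume v: "v \<in> D"
      have "(LINT z|M. v J z * cnj (f J z)) = (LINT z|M. v J z * cnj (g J z))" if J: "card J = Suc m" for J
      proof (rule Bochner_Integration.integral_cong_AE)
        have "AE z in M. f J z = g J z" using eq J by (simp add: form_eq_def)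
        then show "AE z in M. v J z * cnj (f J z) = v J z * cnj (g J z)" by eventually_elim simp
      qed (use f g J L2_component(1)[OF D_L2(1)[OF v] J] in \<open>simp_all add: Lp_forms_def borel_measurable_times borel_measurable_cnj\<close>)
      then show "Q v (extended_neumann f) = Q v (extended_neumann g)"
        unfolding TQ[OF f v] TQ[OF g v] ip_sum[OF f v] ip_sum[OF g v] by simp
    qed
    show "form_eq \<Omega> (Suc m) (extended_neumann (\<lambda>J z. a * f J z + b * g J z))
        (\<lambda>J z. a * extended_neumann f J z + b * extended_neumann g J z)"
      if f: "f \<in> Lp_forms \<Omega> p1 (Suc m)" and g: "g \<in> Lp_forms \<Omega> p1 (Suc m)" for f g a b
    proof -
      have lc: "form_lc a f b g \<in> Lp_forms \<Omega> p1 (Suc m)"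
        using exponents(2) by (intro Lp_forms_lc[OF f g]) linarith
      have lin: "Q v (extended_neumann (form_lc a f b g)) = cnj a * ip (Suc m) v f + cnj b * ip (Suc m) v g" if v: "v \<in> D" for v
      proof -
        have "(LINT z|M. v J z * cnj (form_lc a f b g J z)) = cnj a * (LINT z|M. v J z * cnj (f J z)) + cnj b * (LINT z|M. v J z * cnj (g J z))"
          if J: "card J = Suc m" for J
        proof -
          have i: "integrable M (\<lambda>z. v J z * cnj (f J z))" "integrable M (\<lambda>z. v J z * cnj (g J z))"
            by (rule L2_inner_integrable_Lp[OF exponents(1-3) DLp[OF v] f J], rule L2_inner_integrable_Lp[OF exponents(1-3) DLp[OF v] g J])
          have "(LINT z|M. v J z * cnj (form_lc a f b g J z)) = (LINT z|M. cnj a * (v J z * cnj (f J z)) + cnj b * (v J z * cnj (g J z)))"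
            by (simp add: form_lc_def algebra_simps)
          then show ?thesis using i by simp
        qed
        then show ?thesis
          unfolding TQ[OF lc v] ip_sum[OF lc v] ip_sum[OF f v] ip_sum[OF g v]
          by (simp add: sum.distrib sum_distrib_left)
      qed
      have "form_eq \<Omega> (Suc m) (extended_neumann (form_lc a f b g)) (form_lc a (extended_neumann f) b (extended_neumann g))"
        by (rule weak_solution_lc[where l = "\<lambda>v. ip (Suc m) v f" and l' = "\<lambda>v. ip (Suc m) v g",
              OF TD[OF f] TQ[OF f] TD[OF g] TQ[OF g] TD[OF lc] lin])
      then show ?thesis by (simp only: form_lc_def)
    qed
  qed
  have ext: "form_eq \<Omega> (Suc m) (extended_neumann f) (N f)" if f: "f \<in> L2 (Suc m)" for f
  proof -
    have f1: "f \<in> Lp_forms \<Omega> p1 (Suc m)"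
      by (rule L2_subset_Lp[OF _ exponents(4) f]) (use exponents(2) in linarith)
    note n = dbar_neumann_weak_solution[OF f]
    show ?thesis
    proof (rule weak_solution_unique[OF TD[OF f1] n(1)])
      show "Q v (extended_neumann f) = Q v (N f)" if "v \<in> D" for v
        unfolding TQ[OF f1 that] n(2)[OF that] ..
    qed
  qed
  \<comment> \<open>The solution is tested against itself as in \<open>E_sqn_N_le\<close>. The
    constant Cs C enters once through \<open>pair\<close>, bounding the \<open>Q\<close> norm by f,
    and once through \<open>D_le\<close>, returning to the target norm.\<close>
  have bound: "Lp_norm \<Omega> p2 (Suc m) (extended_neumann f) \<le> (Cs * C)\<^sup>2 * Lp_norm \<Omega> p1 (Suc m) f"
    if f: "f \<in> Lp_forms \<Omega> p1 (Suc m)" for f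
  proof -
    let ?u = "extended_neumann f"
    define e where "e = sqrt (E.sqn ?u)"
    have e0: "e \<ge> 0" by (simp add: e_def E.sqn_nonneg[OF TD[OF f]])
    have "e\<^sup>2 = E.sqn ?u" by (simp add: e_def E.sqn_nonneg[OF TD[OF f]])
    also have "\<dots> = Re (ip (Suc m) ?u f)" using TQ[OF f TD[OF f]] by (simp add: E.sqn_def)
    also have "\<dots> \<le> cmod (ip (Suc m) ?u f)" by (rule complex_Re_le_cmod)
    also have "\<dots> \<le> Cs * C * Lp_norm \<Omega> p1 (Suc m) f * e"
      unfolding e_def by (rule pair[OF f TD[OF f]])
    finally have le: "e * e \<le> Cs * C * Lp_norm \<Omega> p1 (Suc m) f * e" by (simp add: power2_eq_square)
    have e_le: "e \<le> Cs * C * Lp_norm \<Omega> p1 (Suc m) f"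
    proof (cases "e = 0")
      case True
      then show ?thesis using Cs C_pos norm_nonneg by simp
    next
      case False
      then show ?thesis using le e0 mult_right_le_imp_le[of e e "Cs * C * Lp_norm \<Omega> p1 (Suc m) f"] by simp
    qed
    have "Lp_norm \<Omega> p2 (Suc m) ?u \<le> Cs * C * e" unfolding e_def by (rule D_le[OF TD[OF f]])
    also have "\<dots> \<le> Cs * C * (Cs * C * Lp_norm \<Omega> p1 (Suc m) f)"
      using e_le Cs C_pos by (intro mult_left_mono) auto
    finally show ?thesis by (simp add: power2_eq_square mult_ac)
  qed
  have "(Cs * C)\<^sup>2 > 0" using Cs C_pos by simp
  then show ?thesis
    by (intro exI[of _ extended_neumann] conjI lin ballI ext exI[of _ "(Cs * C)\<^sup>2"] bound)
qed

end

end

theorem theorem2p3: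
  fixes \<Omega> :: "(complex ^ 'n::{finite,linorder}) set" and q :: nat and \<epsilon> :: real
  assumes "open \<Omega>" and "connected \<Omega>" and "\<Omega> \<noteq> {}" and "bounded \<Omega>"
    and "smooth_boundary \<Omega>" and "pseudoconvex \<Omega>"
    and "1 \<le> q" and "q \<le> CARD('n)"
    and "0 < \<epsilon>" and "\<epsilon> \<le> 1 / 2"
    and "dbar_dom \<Omega> q \<inter> dbar_star_dom \<Omega> (q - 1) \<subseteq> sobolev_forms \<Omega> \<epsilon> q"
    and "\<exists>C>0. \<forall>u \<in> dbar_dom \<Omega> q \<inter> dbar_star_dom \<Omega> (q - 1).
           sobolev_norm \<Omega> \<epsilon> q u \<le>
             C * sqrt ((Lp_norm \<Omega> 2 (q + 1) (dbar \<Omega> q u))\<^sup>2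
                       + (Lp_norm \<Omega> 2 (q - 1) (dbar_star \<Omega> (q - 1) u))\<^sup>2)"
  shows "compact_L2_operator \<Omega> q (dbar_neumann \<Omega> q)
    \<and> (\<exists>Nt. linear_form_operator \<Omega> q
               (2 * real CARD('n) / (real CARD('n) + \<epsilon>))
               (2 * real CARD('n) / (real CARD('n) - \<epsilon>)) Nt
          \<and> (\<forall>u \<in> Lp_forms \<Omega> 2 q. form_eq \<Omega> q (Nt u) (dbar_neumann \<Omega> q u))
          \<and> (\<exists>C'>0. \<forall>u \<in> Lp_forms \<Omega> (2 * real CARD('n) / (real CARD('n) + \<epsilon>)) q.
               Lp_norm \<Omega> (2 * real CARD('n) / (real CARD('n) - \<epsilon>)) q (Nt u)
                 \<le> C' * Lp_norm \<Omega> (2 * real CARD('n) / (real CARD('n) + \<epsilon>)) q u))"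
proof -
  obtain m where q: "q = Suc m" using assms(7) by (cases q) auto
  obtain U r where U: "smooth_defining_function \<Omega> U r" using assms(5) unfolding smooth_boundary_def by blast
  have U': "open U" "frontier \<Omega> \<subseteq> U" "smooth_on U r" "\<Omega> \<inter> U = {z\<in>U. r z < 0}"
    and grad: "\<And>p. p \<in> frontier \<Omega> \<Longrightarrow> frechet_derivative r (at p) \<noteq> (\<lambda>_. 0)"
    using U by (simp_all only: smooth_defining_function_def simp_thms)
  have "Ck_on 1 U r" using U'(3) by (simp only: smooth_on_def)
  then obtain c r0 where dens: "measure_density \<Omega> c r0"
    using smooth_domain_measure_density[OF assms(1,4) U'(1,2) _ U'(4) grad] by blast
  obtain C where C: "C > 0" and est: "\<And>u. u \<in> dbar_dom \<Omega> q \<inter> dbar_star_dom \<Omega> (q - 1) \<Longrightarrow>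
    sobolev_norm \<Omega> \<epsilon> q u \<le> C * sqrt ((Lp_norm \<Omega> 2 (q + 1) (dbar \<Omega> q u))\<^sup>2
                       + (Lp_norm \<Omega> 2 (q - 1) (dbar_star \<Omega> (q - 1) u))\<^sup>2)"
    using assms(12) by blast
  interpret subelliptic_domain \<Omega> m \<epsilon> C c r0
  proof
    show "open \<Omega>" "bounded \<Omega>" "measure_density \<Omega> c r0" "0 < \<epsilon>" "\<epsilon> \<le> 1 / 2" "C > 0"
      by (fact assms dens C)+
    show "dbar_dom \<Omega> (Suc m) \<inter> dbar_star_dom \<Omega> m \<subseteq> sobolev_forms \<Omega> \<epsilon> (Suc m)"
      using assms(11) by (simp add: q)
    show "sobolev_norm \<Omega> \<epsilon> (Suc m) u \<le> C * sqrt ((Lp_norm \<Omega> 2 (Suc (Suc m)) (dbar \<Omega> (Suc m) u))\<^sup>2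
        + (Lp_norm \<Omega> 2 m (dbar_star \<Omega> m u))\<^sup>2)" if "u \<in> dbar_dom \<Omega> (Suc m) \<inter> dbar_star_dom \<Omega> m" for u
      using est[of u] that by (simp add: q)
  qed
  show ?thesis unfolding q by (rule conjI[OF neumann_compact neumann_extension[OF refl refl]])
qed

end
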